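(* Let $n$ be a positive integer and let $\Gamma$ be a Young $\mathrm{Sym}(n)$-set. Let $\Omega$ be a cosaturated Young $\mathrm{Sym}(n)$-set containing $\Gamma$ as a $\mathrm{Sym}(n)$-stable subset, let $\leq$ be a partial order on $\zeta(\Omega)$ refining the dominance order, and let $\Lambda^+$, $N$, $C$ and ${}^*$ be constructed from these data as described in the context. Then $(\Lambda^+,N,C,{}^* )$ is a cell datum (cell structure) for the $\mathbb{Z}$-algebra $S_{\Gamma,\mathbb{Z}}=eS_{\Omega,\mathbb{Z}}e=\mathrm{End}_{\mathrm{Sym}(n)}(\mathbb{Z}\Gamma)$.
   Context: **Young sets.** $\mathrm{Par}(n)$ is the set of partitions of $n$, with dominance order $\trianglelefteq$: $\lambda\trianglelefteq\mu$ iff $\lambda_1+\cdots+\lambda_a\le\mu_1+\cdots+\mu_a$ for all $1\le a\le n$. For $\lambda\in\mathrm{Par}(n)$, $\mathrm{Sym}(\lambda)=\mathrm{Sym}(\lambda_1)\times\mathrm{Sym}(\lambda_2)\times\cdots\le\mathrm{Sym}(n)$ is the Young subgroup. A Young $\mathrm{Sym}(n)$-set is a finite $\mathrm{Sym}(n)$-set in which every point stabiliser is conjugate to a Young subgroup. The support $\zeta(\Omega)$ of a Young $\mathrm{Sym}(n)$-set $\Omega$ is the set of $\lambda\in\mathrm{Par}(n)$ such that $\mathrm{Sym}(\lambda)$ is the stabiliser of some point of $\Omega$, and $\zeta^{\trianglerighteq}(\Omega)=\{\mu\in\mathrm{Par}(n) : \mu\trianglerighteq\lambda \text{ for some }\lambda\in\zeta(\Omega)\}$.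 The set $\Omega$ is cosaturated if $\lambda\in\zeta(\Omega)$, $\mu\in\mathrm{Par}(n)$ and $\lambda\trianglelefteq\mu$ imply $\mu\in\zeta(\Omega)$. **Endomorphism algebras and the anti-involution.** For a commutative ring $R$, $S_{\Omega,R}=\mathrm{End}_{\mathrm{Sym}(n)}(R\Omega)$, the endomorphism algebra of the permutation module $R\Omega$. For a $\mathrm{Sym}(n)$-stable subset $\mathcal{A}\subseteq\Omega\times\Omega$, let $a_{\mathcal{A}}\in S_{\Omega,R}$ be defined by $a_{\mathcal{A}}(x)=\sum_{y:(y,x)\in\mathcal{A}}y$ for $x\in\Omega$; the $a_{\mathcal{A}}$, with $\mathcal{A}$ an orbit of $\mathrm{Sym}(n)$ on $\Omega\times\Omega$, form an $R$-basis of $S_{\Omega,R}$. The involutory anti-automorphism ${}^*$ of $S_{\Omega,R}$ is the $R$-linear map with $a_{\mathcal{A}}^*=a_{\mathcal{A}^*}$, where $\mathcal{A}^*=\{(y,x):(x,y)\in\mathcal{A}\}$ (i.e. transpose with respect to the basis $\Omega$). **Idempotents.** Write $S=S_{\Omega,\mathbb{Z}}$. Let $e=e_\Gamma\in S$ be the idempotent with $e(x)=x$ for $x\in\Gamma$ and $e(x)=0$ for $x\in\Omega\setminus\Gamma$. Then $e^*=e$, and $eSe$ is identified with $\mathrm{End}_{\mathrm{Sym}(n)}(\mathbb{Z}\Gamma)$, with ${}^*$ restricting to $eSe$. For each $\lambda\in\zeta(\Omega)$ choose an orbit $\mathcal{O}_{\alpha(\lambda)}$ of $\Omega$ containing a point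 with stabiliser $\mathrm{Sym}(\lambda)$, and let $\xi_\lambda\in S$ be the idempotent which is the identity on $\mathcal{O}_{\alpha(\lambda)}$ and $0$ on the other points of $\Omega$. Let $S(>\lambda)=\sum_{\mu\in\zeta(\Omega),\,\mu>\lambda}S\xi_\mu S$, a two-sided ideal of $S$. **The data.** $\Lambda^+=\zeta^{\trianglerighteq}(\Gamma)\subseteq\zeta(\Omega)$ with the order induced by $\leq$. For $\lambda\in\zeta(\Omega)$ let $\nabla_\Omega(\lambda)_{\mathbb{Q}}=\mathrm{Hom}_{\mathrm{Sym}(n)}(\mathbb{Q}\Omega,\mathrm{Sp}(\lambda)_{\mathbb{Q}})$, where $\mathrm{Sp}(\lambda)_{\mathbb{Q}}$ is the Specht module (with the convention that the multiplicity of $\mathrm{Sp}(\lambda)_{\mathbb{Q}}$ in $\mathbb{Q}\,\mathrm{Sym}(n)/\mathrm{Sym}(\mu)$ is nonzero iff $\mu\trianglelefteq\lambda$, and is $1$ for $\mu=\lambda$), regarded as a left $S_{\Omega,\mathbb{Q}}$-module by $s\cdot f=f\circ s^*$. For $\lambda\in\Lambda^+$ put $n_\lambda=\dim_{\mathbb{Q}}e\nabla_\Omega(\lambda)_{\mathbb{Q}}$ and $N(\lambda)=\{1,\ldots,n_\lambda\}$. The abelian group $(eS\xi_\lambda+S(>\lambda))/S(>\lambda)$ is free of rank $n_\lambda$; choose $d_{\lambda,1},\ldots,d_{\lambda,n_\lambda}\in eS\xi_\lambda$ whose classes form a $\mathbb{Z}$-basis of it. Define $C:\coprod_{\lambda\in\Lambda^+}N(\lambda)\times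 N(\lambda)\to eSe$ by $C(t,u)=C^\lambda_{t,u}=d_{\lambda,t}d_{\lambda,u}^*$ for $t,u\in N(\lambda)$. **Cell datum.** A cell datum $(\Lambda^+,N,C,{}^* )$ for an algebra $A$ over a commutative ring $R$ consists of: (C1) a partially ordered set $\Lambda^+$, for each $\lambda\in\Lambda^+$ a finite set $N(\lambda)$, and an injective map $C:\coprod_{\lambda\in\Lambda^+}N(\lambda)\times N(\lambda)\to A$ whose image is an $R$-basis of $A$; (C2) writing $C(t,u)=C^\lambda_{t,u}\in A$ for $t,u\in N(\lambda)$, an $R$-linear anti-involution ${}^*$ of $A$ with $(C^\lambda_{t,u})^*=C^\lambda_{u,t}$; (C3) for $\lambda\in\Lambda^+$, $t,u\in N(\lambda)$ and $a\in A$, $aC^\lambda_{t,u}\equiv\sum_{t'\in N(\lambda)}r_a(t',t)C^\lambda_{t',u}\pmod{A(>\lambda)}$, where $r_a(t',t)\in R$ is independent of $u$ and $A(>\lambda)$ is the $R$-submodule of $A$ generated by the $C^\mu_{t'',u''}$ with $\mu\in\Lambda^+$, $\mu>\lambda$ and $t'',u''\in N(\mu)$. *)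

theory Defs
  imports Complex_Main "HOL-Algebra.Group_Action" "HOL-Algebra.Sym_Groups" "HOL-Library.Function_Algebras"
begin

section \<open>Partitions and Young sets\<close>

definition Par :: "nat \<Rightarrow> nat list set" where
  "Par n = {l. sorted_wrt (\<ge>) l \<and> 0 \<notin> set l \<and> sum_list l = n}"

text \<open>\<^const>\<open>take\<close> stops at the end of the list, so missing parts count as zero.\<close>

definition dominated :: "nat \<Rightarrow> nat list \<Rightarrow> nat list \<Rightarrow> bool" where
  "dominated n l m \<longleftrightarrow> (\<forall>a\<in>{1..n}. sum_list (take a l) \<le> sum_list (take a m))"

definition block :: "nat list \<Rightarrow> nat \<Rightarrow> nat set" where
  "block l i = {sum_list (take i l) + 1 .. sum_list (take (Suc i) l)}"

definition young_subgroup :: "nat \<Rightarrow> nat list \<Rightarrow> (nat \<Rightarrow> nat) set" where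
  "young_subgroup n l = {g \<in> carrier (sym_group n). \<forall>i<length l. g ` block l i = block l i}"

definition young_set :: "nat \<Rightarrow> 'a set \<Rightarrow> ((nat \<Rightarrow> nat) \<Rightarrow> 'a \<Rightarrow> 'a) \<Rightarrow> bool" where
  "young_set n X \<phi> \<longleftrightarrow> finite X \<and> group_action (sym_group n) X \<phi> \<and>
     (\<forall>x\<in>X. \<exists>l\<in>Par n. \<exists>g\<in>carrier (sym_group n).
        stabilizer (sym_group n) \<phi> x =
          g <#\<^bsub>sym_group n\<^esub> young_subgroup n l #>\<^bsub>sym_group n\<^esub> (inv\<^bsub>sym_group n\<^esub> g))"

definition supp :: "nat \<Rightarrow> 'a set \<Rightarrow> ((nat \<Rightarrow> nat) \<Rightarrow> 'a \<Rightarrow> 'a) \<Rightarrow> nat list set" where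
  "supp n X \<phi> = {l \<in> Par n. \<exists>x\<in>X. stabilizer (sym_group n) \<phi> x = young_subgroup n l}"

definition supp_up :: "nat \<Rightarrow> 'a set \<Rightarrow> ((nat \<Rightarrow> nat) \<Rightarrow> 'a \<Rightarrow> 'a) \<Rightarrow> nat list set" where
  "supp_up n X \<phi> = {m \<in> Par n. \<exists>l\<in>supp n X \<phi>. dominated n l m}"

definition cosaturated :: "nat \<Rightarrow> 'a set \<Rightarrow> ((nat \<Rightarrow> nat) \<Rightarrow> 'a \<Rightarrow> 'a) \<Rightarrow> bool" where
  "cosaturated n X \<phi> \<longleftrightarrow>
     (\<forall>l\<in>supp n X \<phi>. \<forall>m\<in>Par n. dominated n l m \<longrightarrow> m \<in> supp n X \<phi>)"

section \<open>Permutation modules and their homomorphisms\<close>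

text \<open>The permutation module of a finite set \<open>X\<close> over \<open>'r\<close> is the set of functions that vanish
  off \<open>X\<close>, and \<open>pt x\<close> is the basis vector \<open>x\<close>.\<close>

definition vscale :: "'r::comm_ring_1 \<Rightarrow> ('a \<Rightarrow> 'r) \<Rightarrow> 'a \<Rightarrow> 'r" where
  "vscale c v = (\<lambda>x. c * v x)"

definition mscale :: "'r::comm_ring_1 \<Rightarrow> (('a \<Rightarrow> 'r) \<Rightarrow> 'b \<Rightarrow> 'r) \<Rightarrow> ('a \<Rightarrow> 'r) \<Rightarrow> 'b \<Rightarrow> 'r" where
  "mscale c s = (\<lambda>v. vscale c (s v))"

lemma module_vscale: "Modules.module vscale"
  by unfold_locales (auto simp: vscale_def fun_eq_iff algebra_simps)

lemma module_mscale: "Modules.module mscale"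
  by unfold_locales (auto simp: mscale_def vscale_def fun_eq_iff algebra_simps)

lemma vector_space_vscale: "vector_space (vscale :: 'r::field \<Rightarrow> ('a \<Rightarrow> 'r) \<Rightarrow> _)"
  by unfold_locales (auto simp: vscale_def fun_eq_iff algebra_simps)

lemma vector_space_mscale:
  "vector_space (mscale :: 'r::field \<Rightarrow> (('a \<Rightarrow> 'r) \<Rightarrow> 'b \<Rightarrow> 'r) \<Rightarrow> _)"
  by unfold_locales (auto simp: mscale_def vscale_def fun_eq_iff algebra_simps)

definition pt :: "'a \<Rightarrow> 'a \<Rightarrow> 'r::comm_ring_1" where
  "pt x = (\<lambda>y. if y = x then 1 else 0)"

definition perm_mod :: "'a set \<Rightarrow> ('a \<Rightarrow> 'r::comm_ring_1) set" where
  "perm_mod X = {v. \<forall>x. x \<notin> X \<longrightarrow> v x = 0}"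

definition perm_act ::
  "'a set \<Rightarrow> ((nat \<Rightarrow> nat) \<Rightarrow> 'a \<Rightarrow> 'a) \<Rightarrow> (nat \<Rightarrow> nat) \<Rightarrow> ('a \<Rightarrow> 'r::comm_ring_1) \<Rightarrow> 'a \<Rightarrow> 'r" where
  "perm_act X \<phi> g v = (\<Sum>x\<in>X. vscale (v x) (pt (\<phi> g x)))"

text \<open>The linear map that is the identity on the points of \<open>X\<close> and zero on all other points.\<close>

definition proj :: "'a set \<Rightarrow> ('a \<Rightarrow> 'r::comm_ring_1) \<Rightarrow> 'a \<Rightarrow> 'r" where
  "proj X v = (\<lambda>x. if x \<in> X then v x else 0)"

text \<open>Equivariant linear maps from the permutation module of \<open>X\<close> to a submodule \<open>M\<close> of a function
  space on which the group acts by \<open>\<rho>\<close>.  HOL functions are total, so a map defined on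
  \<open>perm_mod X\<close> is represented by its unique extension that kills every point outside \<open>X\<close>
  (the condition \<open>f v = f (proj X v)\<close>).  With this convention the identification of
  \<open>e End(R X) e\<close> with \<open>End(R Y)\<close>, for \<open>Y \<subseteq> X\<close> stable and \<open>e = proj Y\<close>, is an equality, and
  \<open>proj X\<close> is the identity of \<open>End(R X)\<close>.\<close>

definition perm_hom ::
  "nat \<Rightarrow> 'a set \<Rightarrow> ((nat \<Rightarrow> nat) \<Rightarrow> 'a \<Rightarrow> 'a) \<Rightarrow> ('b \<Rightarrow> 'r) set \<Rightarrow>
   ((nat \<Rightarrow> nat) \<Rightarrow> ('b \<Rightarrow> 'r) \<Rightarrow> 'b \<Rightarrow> 'r) \<Rightarrow> (('a \<Rightarrow> 'r::comm_ring_1) \<Rightarrow> 'b \<Rightarrow> 'r) set" where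
  "perm_hom n X \<phi> M \<rho> = {f. Modules.module_hom vscale vscale f \<and>
     (\<forall>v. f v \<in> M) \<and> (\<forall>v. f v = f (proj X v)) \<and>
     (\<forall>g\<in>carrier (sym_group n). \<forall>v\<in>perm_mod X. f (perm_act X \<phi> g v) = \<rho> g (f v))}"

definition perm_end ::
  "nat \<Rightarrow> 'a set \<Rightarrow> ((nat \<Rightarrow> nat) \<Rightarrow> 'a \<Rightarrow> 'a) \<Rightarrow> (('a \<Rightarrow> 'r::comm_ring_1) \<Rightarrow> 'a \<Rightarrow> 'r) set" where
  "perm_end n X \<phi> = perm_hom n X \<phi> (perm_mod X) (perm_act X \<phi>)"

text \<open>Transpose with respect to the basis \<open>X\<close>: the entry of \<open>s\<close> in row \<open>x\<close> and column \<open>y\<close>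
  is \<open>s (pt y) x\<close>.\<close>

definition star :: "'a set \<Rightarrow> (('a \<Rightarrow> 'r::comm_ring_1) \<Rightarrow> 'a \<Rightarrow> 'r) \<Rightarrow> ('a \<Rightarrow> 'r) \<Rightarrow> 'a \<Rightarrow> 'r" where
  "star X s v = (\<lambda>y. if y \<in> X then (\<Sum>x\<in>X. s (pt y) x * v x) else 0)"

definition rel_map :: "'a set \<Rightarrow> ('a \<times> 'a) set \<Rightarrow> ('a \<Rightarrow> 'r::comm_ring_1) \<Rightarrow> 'a \<Rightarrow> 'r" where
  "rel_map X A v = (\<Sum>x\<in>X. vscale (v x) (\<Sum>y | (y, x) \<in> A. pt y))"

lemma sum_fun_apply: "(\<Sum>i\<in>I. f i) y = (\<Sum>i\<in>I. f i y)" for f :: "'i \<Rightarrow> 'a \<Rightarrow> 'r::comm_ring_1"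
  by (induction I rule: infinite_finite_induct) auto

text \<open>For stable \<open>A\<close>, \<open>rel_map X A\<close> is the basis element of \<open>End(R X)\<close> attached to \<open>A\<close>;
  the transpose takes it to the one attached to the converse relation.\<close>

lemma star_rel_map:
  assumes "finite X" "A \<subseteq> X \<times> X"
  shows "star X (rel_map X A) = (rel_map X (A\<inverse>) :: ('a \<Rightarrow> 'r::comm_ring_1) \<Rightarrow> 'a \<Rightarrow> 'r)"
proof -
  have *: "rel_map X B v y = (\<Sum>x\<in>X. if (y, x) \<in> B then v x else 0)"
    if "B \<subseteq> X \<times> X" for B and v :: "'a \<Rightarrow> 'r" and y
  proof -
    have "finite {y. (y, x) \<in> B}" for x
      by (rule finite_subset[of _ X]) (use that assms in auto)
    then show ?thesis
      by (auto simp: rel_map_def vscale_def pt_def sum_fun_apply intro!: sum.cong)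
  qed
  have "A\<inverse> \<subseteq> X \<times> X" using assms by auto
  show ?thesis
  proof (intro ext)
    fix v :: "'a \<Rightarrow> 'r" and y
    have eq: "(\<Sum>z\<in>X. if (x, z) \<in> A then pt y z else 0) = (if (x, y) \<in> A then 1 else (0::'r))" for x
    proof -
      have "(\<Sum>z\<in>X. if (x, z) \<in> A then pt y z else 0)
          = (\<Sum>z\<in>X. if z = y then (if (x, y) \<in> A then 1 else (0::'r)) else 0)"
        by (rule sum.cong) (auto simp: pt_def)
      also have "\<dots> = (if (x, y) \<in> A then 1 else 0)" using assms by auto
      finally show ?thesis .
    qed
    have "y \<notin> X \<Longrightarrow> (x, y) \<notin> A" for x using assms by auto
    then show "star X (rel_map X A) v y = rel_map X (A\<inverse>) v y"
      by (auto simp: star_def *[OF assms(2)] *[OF \<open>A\<inverse> \<subseteq> X \<times> X\<close>] eq intro!: sum.cong)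
  qed
qed

section \<open>Specht modules\<close>

text \<open>Rows, columns and cells are numbered from 0.  A tabloid is encoded by the function that sends
  each entry in \<open>{1..n}\<close> to the row containing it.\<close>

definition diagram :: "nat list \<Rightarrow> (nat \<times> nat) set" where
  "diagram l = {(i, j). i < length l \<and> j < l ! i}"

definition tableaux :: "nat \<Rightarrow> nat list \<Rightarrow> (nat \<times> nat \<Rightarrow> nat) set" where
  "tableaux n l = {T. bij_betw T (diagram l) {1..n}}"

definition tabloids :: "nat \<Rightarrow> nat list \<Rightarrow> (nat \<Rightarrow> nat) set" where
  "tabloids n l = {q \<in> {1..n} \<rightarrow>\<^sub>E {..<length l}. \<forall>i<length l. card {x \<in> {1..n}. q x = i} = l ! i}"

definition tabloid_act :: "nat \<Rightarrow> (nat \<Rightarrow> nat) \<Rightarrow> (nat \<Rightarrow> nat) \<Rightarrow> nat \<Rightarrow> nat" where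
  "tabloid_act n g q = (\<lambda>x\<in>{1..n}. q (inv' g x))"

definition tabloid_of :: "nat \<Rightarrow> nat list \<Rightarrow> (nat \<times> nat \<Rightarrow> nat) \<Rightarrow> nat \<Rightarrow> nat" where
  "tabloid_of n l T = (\<lambda>x\<in>{1..n}. fst (inv_into (diagram l) T x))"

definition column_stabilizer :: "nat \<Rightarrow> nat list \<Rightarrow> (nat \<times> nat \<Rightarrow> nat) \<Rightarrow> (nat \<Rightarrow> nat) set" where
  "column_stabilizer n l T = {p \<in> carrier (sym_group n).
     \<forall>x\<in>{1..n}. snd (inv_into (diagram l) T (p x)) = snd (inv_into (diagram l) T x)}"

definition polytabloid ::
  "nat \<Rightarrow> nat list \<Rightarrow> (nat \<times> nat \<Rightarrow> nat) \<Rightarrow> (nat \<Rightarrow> nat) \<Rightarrow> 'r::comm_ring_1" where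
  "polytabloid n l T = (\<Sum>p\<in>column_stabilizer n l T.
     vscale (of_int (sign p)) (pt (tabloid_act n p (tabloid_of n l T))))"

text \<open>James's convention: a submodule of the permutation module on tabloids of shape \<open>l\<close>, so that
  over the rationals it occurs in the permutation module on cosets of the Young subgroup of
  \<open>m\<close> iff \<open>m\<close> is dominated by \<open>l\<close>.\<close>

definition specht :: "nat \<Rightarrow> nat list \<Rightarrow> ((nat \<Rightarrow> nat) \<Rightarrow> 'r::comm_ring_1) set" where
  "specht n l = module.span vscale (polytabloid n l ` tableaux n l)"

definition nabla ::
  "nat \<Rightarrow> 'a set \<Rightarrow> ((nat \<Rightarrow> nat) \<Rightarrow> 'a \<Rightarrow> 'a) \<Rightarrow> nat list \<Rightarrow>
   (('a \<Rightarrow> rat) \<Rightarrow> (nat \<Rightarrow> nat) \<Rightarrow> rat) set" where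
  "nabla n X \<phi> l = perm_hom n X \<phi> (specht n l) (perm_act (tabloids n l) (tabloid_act n))"

definition nabla_act ::
  "'a set \<Rightarrow> (('a \<Rightarrow> 'r::comm_ring_1) \<Rightarrow> 'a \<Rightarrow> 'r) \<Rightarrow> (('a \<Rightarrow> 'r) \<Rightarrow> 'b) \<Rightarrow> ('a \<Rightarrow> 'r) \<Rightarrow> 'b" where
  "nabla_act X s f = f \<circ> star X s"

section \<open>The data of the construction\<close>

text \<open>\<open>orb l\<close> is the chosen orbit for \<open>l\<close>, so the idempotent attached to \<open>l\<close> is \<open>proj (orb l)\<close>.\<close>

definition chosen_orbits ::
  "nat \<Rightarrow> 'a set \<Rightarrow> ((nat \<Rightarrow> nat) \<Rightarrow> 'a \<Rightarrow> 'a) \<Rightarrow> (nat list \<Rightarrow> 'a set) \<Rightarrow> bool" where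
  "chosen_orbits n X \<phi> orb \<longleftrightarrow> (\<forall>l\<in>supp n X \<phi>.
     orb l \<in> orbits (sym_group n) X \<phi> \<and>
     (\<exists>x\<in>orb l. stabilizer (sym_group n) \<phi> x = young_subgroup n l))"

text \<open>The sum, over \<open>m\<close> in the support with \<open>m > l\<close>, of the ideals \<open>S (proj (orb m)) S\<close>.\<close>

definition ideal_above ::
  "nat \<Rightarrow> 'a set \<Rightarrow> ((nat \<Rightarrow> nat) \<Rightarrow> 'a \<Rightarrow> 'a) \<Rightarrow> (nat list \<Rightarrow> 'a set) \<Rightarrow> (nat list \<times> nat list) set \<Rightarrow>
   nat list \<Rightarrow> (('a \<Rightarrow> int) \<Rightarrow> 'a \<Rightarrow> int) set" where
  "ideal_above n X \<phi> orb ord l = module.span mscale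
     {s \<circ> proj (orb m) \<circ> s' | s s' m. s \<in> perm_end n X \<phi> \<and> s' \<in> perm_end n X \<phi> \<and>
        m \<in> supp n X \<phi> \<and> (l, m) \<in> ord \<and> m \<noteq> l}"

definition eSxi ::
  "nat \<Rightarrow> 'a set \<Rightarrow> ((nat \<Rightarrow> nat) \<Rightarrow> 'a \<Rightarrow> 'a) \<Rightarrow> 'a set \<Rightarrow> (nat list \<Rightarrow> 'a set) \<Rightarrow>
   nat list \<Rightarrow> (('a \<Rightarrow> int) \<Rightarrow> 'a \<Rightarrow> int) set" where
  "eSxi n X \<phi> Y orb l = {proj Y \<circ> s \<circ> proj (orb l) | s. s \<in> perm_end n X \<phi>}"

definition n_dim :: "nat \<Rightarrow> 'a set \<Rightarrow> ((nat \<Rightarrow> nat) \<Rightarrow> 'a \<Rightarrow> 'a) \<Rightarrow> 'a set \<Rightarrow> nat list \<Rightarrow> nat" where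
  "n_dim n X \<phi> Y l = vector_space.dim mscale (nabla_act X (proj Y) ` nabla n X \<phi> l)"

definition N_idx :: "nat \<Rightarrow> 'a set \<Rightarrow> ((nat \<Rightarrow> nat) \<Rightarrow> 'a \<Rightarrow> 'a) \<Rightarrow> 'a set \<Rightarrow> nat list \<Rightarrow> nat set" where
  "N_idx n X \<phi> Y l = {1..n_dim n X \<phi> Y l}"

text \<open>The classes of the family \<open>(d j)\<close>, \<open>j \<in> J\<close>, in the quotient \<open>M / I\<close> are linearly independent
  and generate the quotient.\<close>

definition basis_mod ::
  "('r::comm_ring_1 \<Rightarrow> 'b::ab_group_add \<Rightarrow> 'b) \<Rightarrow> 'b set \<Rightarrow> 'b set \<Rightarrow> 'j set \<Rightarrow> ('j \<Rightarrow> 'b) \<Rightarrow> bool" where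
  "basis_mod scale M I J d \<longleftrightarrow> finite J \<and> (\<forall>j\<in>J. d j \<in> M) \<and>
     (\<forall>c. (\<Sum>j\<in>J. scale (c j) (d j)) \<in> I \<longrightarrow> (\<forall>j\<in>J. c j = 0)) \<and>
     (\<forall>m\<in>M. \<exists>c. m - (\<Sum>j\<in>J. scale (c j) (d j)) \<in> I)"

definition chosen_lifts ::
  "nat \<Rightarrow> 'a set \<Rightarrow> ((nat \<Rightarrow> nat) \<Rightarrow> 'a \<Rightarrow> 'a) \<Rightarrow> 'a set \<Rightarrow> (nat list \<Rightarrow> 'a set) \<Rightarrow>
   (nat list \<times> nat list) set \<Rightarrow> nat list \<Rightarrow> (nat \<Rightarrow> ('a \<Rightarrow> int) \<Rightarrow> 'a \<Rightarrow> int) \<Rightarrow> bool" where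
  "chosen_lifts n X \<phi> Y orb ord l d \<longleftrightarrow>
     (\<forall>t\<in>N_idx n X \<phi> Y l. d t \<in> eSxi n X \<phi> Y orb l) \<and>
     basis_mod mscale
       {a + b | a b. a \<in> eSxi n X \<phi> Y orb l \<and> b \<in> ideal_above n X \<phi> orb ord l}
       (ideal_above n X \<phi> orb ord l) (N_idx n X \<phi> Y l) d"

section \<open>Cell data\<close>

locale algebra_on = Modules.module scale
  for scale :: "'r::comm_ring_1 \<Rightarrow> 'b::ab_group_add \<Rightarrow> 'b" +
  fixes A :: "'b set" and mul :: "'b \<Rightarrow> 'b \<Rightarrow> 'b" and one :: 'b
  assumes A_subspace: "subspace A"
    and one_in: "one \<in> A"
    and mul_in: "a \<in> A \<Longrightarrow> b \<in> A \<Longrightarrow> mul a b \<in> A"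
    and mul_assoc: "a \<in> A \<Longrightarrow> b \<in> A \<Longrightarrow> c \<in> A \<Longrightarrow> mul (mul a b) c = mul a (mul b c)"
    and one_mul: "a \<in> A \<Longrightarrow> mul one a = a"
    and mul_one: "a \<in> A \<Longrightarrow> mul a one = a"
    and mul_add_left: "a \<in> A \<Longrightarrow> b \<in> A \<Longrightarrow> c \<in> A \<Longrightarrow> mul (a + b) c = mul a c + mul b c"
    and mul_add_right: "a \<in> A \<Longrightarrow> b \<in> A \<Longrightarrow> c \<in> A \<Longrightarrow> mul a (b + c) = mul a b + mul a c"
    and mul_scale_left: "a \<in> A \<Longrightarrow> b \<in> A \<Longrightarrow> mul (scale k a) b = scale k (mul a b)"
    and mul_scale_right: "a \<in> A \<Longrightarrow> b \<in> A \<Longrightarrow> mul a (scale k b) = scale k (mul a b)"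

locale cell_datum = algebra_on scale A mul one
  for scale :: "'r::comm_ring_1 \<Rightarrow> 'b::ab_group_add \<Rightarrow> 'b" and A mul one +
  fixes L :: "'l set" and ord :: "('l \<times> 'l) set" and N :: "'l \<Rightarrow> 'm set"
    and C :: "'l \<Rightarrow> 'm \<Rightarrow> 'm \<Rightarrow> 'b" and inv_map :: "'b \<Rightarrow> 'b"
  assumes order: "partial_order_on L ord"
    and N_finite: "l \<in> L \<Longrightarrow> finite (N l)"
    and C_inj: "inj_on (\<lambda>(l, t, u). C l t u) (SIGMA l:L. N l \<times> N l)"
    and C_independent: "independent ((\<lambda>(l, t, u). C l t u) ` (SIGMA l:L. N l \<times> N l))"
    and C_span: "span ((\<lambda>(l, t, u). C l t u) ` (SIGMA l:L. N l \<times> N l)) = A"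
    and inv_map_in: "a \<in> A \<Longrightarrow> inv_map a \<in> A"
    and inv_map_add: "a \<in> A \<Longrightarrow> b \<in> A \<Longrightarrow> inv_map (a + b) = inv_map a + inv_map b"
    and inv_map_scale: "a \<in> A \<Longrightarrow> inv_map (scale k a) = scale k (inv_map a)"
    and inv_map_mul: "a \<in> A \<Longrightarrow> b \<in> A \<Longrightarrow> inv_map (mul a b) = mul (inv_map b) (inv_map a)"
    and inv_map_inv_map: "a \<in> A \<Longrightarrow> inv_map (inv_map a) = a"
    and inv_map_C: "l \<in> L \<Longrightarrow> t \<in> N l \<Longrightarrow> u \<in> N l \<Longrightarrow> inv_map (C l t u) = C l u t"
    and mul_C: "l \<in> L \<Longrightarrow> a \<in> A \<Longrightarrow>
      \<exists>\<rho>. \<forall>t\<in>N l. \<forall>u\<in>N l.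
        mul a (C l t u) - (\<Sum>t'\<in>N l. scale (\<rho> t' t) (C l t' u))
          \<in> span {C m t'' u'' | m t'' u''.
                m \<in> L \<and> (l, m) \<in> ord \<and> m \<noteq> l \<and> t'' \<in> N m \<and> u'' \<in> N m}"

end

theory Submission
  imports Defs
begin

text \<open>Specht modules are not needed: the number of lifts enters only through the hypothesis that
  their classes form a basis.  Write \<open>J l\<close> for the ideal generated by the \<open>\<xi>\<^sub>m\<close> with \<open>m > l\<close>.

  Two facts about permutation modules carry the proof: \<open>\<xi>\<^sub>l S \<xi>\<^sub>m \<subseteq> J l\<close> unless \<open>m\<close> is dominated by \<open>l\<close>, and
  \<open>\<xi>\<^sub>l S \<xi>\<^sub>l \<subseteq> \<int> \<xi>\<^sub>l + J l\<close>.  Identify the orbits with sets of words on \<open>{1..n}\<close> of content \<open>l\<close> and \<open>m\<close>.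
  A basis element is then given by a pair of words \<open>(w, v)\<close> up to simultaneous permutation, and a weak
  form of semistandard straightening rewrites it modulo \<open>J l\<close> in terms of pairs with \<open>w \<le> v\<close> pointwise.
  Such pairs exist only if \<open>m\<close> is dominated by \<open>l\<close>, and for \<open>m = l\<close> only if \<open>w = v\<close>.

  The rest is formal.  Downward induction on the order shows that the products \<open>d\<^sub>t d\<^sub>u\<^sup>*\<close> span.  They are
  independent because modulo \<open>J l\<close> the products \<open>d\<^sub>s\<^sup>* d\<^sub>t\<close> are multiples of \<open>\<xi>\<^sub>l\<close> and the resulting Gram
  matrix is nondegenerate: the transpose is anisotropic (\<open>a\<^sup>* a = 0\<close> implies \<open>a = 0\<close>), so that \<open>x\<^sup>* x \<in> J l\<close>
  forces a nonzero multiple of \<open>x\<close> into \<open>J l\<close>.\<close>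

section \<open>Algebras with an anisotropic involution\<close>

text \<open>Integrality shapes the argument. Quotients by the ideals \<open>J l\<close> are not
  shown to be torsion-free, so anisotropy only puts some nonzero multiple of \<open>x\<close> into
  the ideal; that the classes of the lifts form a basis then removes the multiple. Straightening may
  not divide either: all occurrences of one letter in a column are changed at once, which makes the
  leading coefficient exactly 1, whereas changing a single one of \<open>t\<close> occurrences would
  give the coefficient \<open>t\<close>. Cosaturation enters because a raised content, once sorted,
  is a partition strictly dominating the old one; its orbit has to be available in \<Omega> for the
  composite through it to lie in \<open>J l\<close>. Shapes of \<Omega> outside the index set
  contribute nothing new: for such \<open>l\<close>, no shape \<open>m\<close> of an orbit of
  \<Gamma> is dominated by \<open>l\<close>, so the transpose of the first fact puts
  \<open>e S \<xi>\<^sub>l\<close> into \<open>J l\<close>.\<close>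

context algebra_on
begin

lemma A_add: "a \<in> A \<Longrightarrow> b \<in> A \<Longrightarrow> a + b \<in> A"
  and A_diff: "a \<in> A \<Longrightarrow> b \<in> A \<Longrightarrow> a - b \<in> A"
  and A_scale: "a \<in> A \<Longrightarrow> scale k a \<in> A"
  and A_zero: "0 \<in> A"
  using A_subspace by (auto intro: subspace_add subspace_diff subspace_scale subspace_0)

lemma A_sum: "(\<And>i. i \<in> I \<Longrightarrow> f i \<in> A) \<Longrightarrow> sum f I \<in> A"
  using A_subspace by (rule subspace_sum)

lemmas A_intros = A_add A_diff A_scale A_zero A_sum mul_in one_in

lemma mul_zero_left [simp]: "c \<in> A \<Longrightarrow> mul 0 c = 0"
  using mul_scale_left[OF A_zero, of c 0] by simp

lemma mul_zero_right [simp]: "c \<in> A \<Longrightarrow> mul c 0 = 0"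
  using mul_scale_right[OF _ A_zero, of c 0] by simp

lemma mul_sum_left:
  assumes "\<And>i. i \<in> I \<Longrightarrow> f i \<in> A" "c \<in> A"
  shows "mul (sum f I) c = (\<Sum>i\<in>I. mul (f i) c)"
  using assms by (induction I rule: infinite_finite_induct) (simp_all add: mul_add_left A_sum)

lemma mul_sum_right:
  assumes "\<And>i. i \<in> I \<Longrightarrow> f i \<in> A" "c \<in> A"
  shows "mul c (sum f I) = (\<Sum>i\<in>I. mul c (f i))"
  using assms by (induction I rule: infinite_finite_induct) (simp_all add: mul_add_right A_sum)

lemma mul_diff_left:
  assumes "a \<in> A" "b \<in> A" "c \<in> A"
  shows "mul (a - b) c = mul a c - mul b c"
  using mul_add_left[of "a - b" b c] assms by (simp add: A_diff)

lemma mul_diff_right: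
  assumes "a \<in> A" "b \<in> A" "c \<in> A"
  shows "mul c (a - b) = mul c a - mul c b"
  using mul_add_right[of c "a - b" b] assms by (simp add: A_diff)

definition two_sided_ideal :: "'b set \<Rightarrow> bool" where
  "two_sided_ideal I \<longleftrightarrow> subspace I \<and> I \<subseteq> A \<and> (\<forall>a\<in>A. \<forall>i\<in>I. mul a i \<in> I \<and> mul i a \<in> I)"

lemma two_sided_idealD:
  assumes "two_sided_ideal I"
  shows "subspace I" "\<And>i. i \<in> I \<Longrightarrow> i \<in> A"
    "\<And>a i. a \<in> A \<Longrightarrow> i \<in> I \<Longrightarrow> mul a i \<in> I" "\<And>a i. a \<in> A \<Longrightarrow> i \<in> I \<Longrightarrow> mul i a \<in> I"
  using assms by (auto simp: two_sided_ideal_def)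

fun pow :: "'b \<Rightarrow> nat \<Rightarrow> 'b" where
  "pow h 0 = one"
| "pow h (Suc k) = mul h (pow h k)"

lemma pow_in: "h \<in> A \<Longrightarrow> pow h k \<in> A"
  by (induction k) (auto intro: one_in mul_in)

text \<open>\<open>k\<close> is the index of the lowest nonzero coefficient and \<open>a\<close> is
  that coefficient; all later terms carry a further factor \<open>h\<close>.\<close>

lemma polynomial_factor:
  assumes h: "h \<in> A" and "i \<le> K" "c i \<noteq> 0"
  shows "\<exists>k a r. a \<noteq> 0 \<and> r \<in> A \<and>
    (\<Sum>i\<le>K. scale (c i) (pow h i)) = mul (pow h k) (scale a one + mul h r)"
  using assms(2,3)
proof (induction K arbitrary: c i)
  case 0
  then have "c 0 \<noteq> 0" by auto
  moreover have "scale (c 0) one = mul (pow h 0) (scale (c 0) one + mul h 0)"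
    using h by (simp add: one_mul A_intros)
  ultimately show ?case by (intro exI[of _ 0] exI[of _ "c 0"]) (auto simp: A_zero)
next
  case (Suc K)
  let ?r = "\<Sum>i\<le>K. scale (c (Suc i)) (pow h i)"
  have r: "?r \<in> A" using h by (intro A_intros pow_in)
  have split: "(\<Sum>i\<le>Suc K. scale (c i) (pow h i)) = scale (c 0) one + mul h ?r"
    using h by (simp add: sum.atMost_Suc_shift mul_sum_right mul_scale_right A_intros pow_in
        del: sum.atMost_Suc)
  show ?case
  proof (cases "c 0 = 0")
    case True
    then obtain i' where "i = Suc i'" using Suc.prems by (metis not0_implies_Suc)
    then obtain k a r' where "a \<noteq> 0" "r' \<in> A" and eq: "?r = mul (pow h k) (scale a one + mul h r')"
      using Suc.IH[of i' "\<lambda>i. c (Suc i)"] Suc.prems by auto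
    moreover have "mul h ?r = mul (pow h (Suc k)) (scale a one + mul h r')"
      using h \<open>r' \<in> A\<close> unfolding eq by (simp add: mul_assoc A_intros pow_in)
    ultimately show ?thesis unfolding split using True
      by (intro exI[of _ "Suc k"] exI[of _ a] exI[of _ r']) auto
  next
    case False
    have "scale (c 0) one + mul h ?r = mul (pow h 0) (scale (c 0) one + mul h ?r)"
      using h r by (simp add: one_mul A_intros)
    then show ?thesis unfolding split using False r
      by (intro exI[of _ 0] exI[of _ "c 0"] exI[of _ ?r]) auto
  qed
qed

end

text \<open>\<open>finite_rank\<close> stands in for a finite basis: any \<open>Suc K\<close>
  elements satisfy a nontrivial integer relation. It is applied to the powers of one
  element.\<close>

locale star_algebra = algebra_on scale A mul one
  for scale :: "int \<Rightarrow> 'b::ab_group_add \<Rightarrow> 'b" and A mul one +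
  fixes star :: "'b \<Rightarrow> 'b"
  assumes star_in: "a \<in> A \<Longrightarrow> star a \<in> A"
    and star_add: "a \<in> A \<Longrightarrow> b \<in> A \<Longrightarrow> star (a + b) = star a + star b"
    and star_scale: "a \<in> A \<Longrightarrow> star (scale k a) = scale k (star a)"
    and star_mul: "a \<in> A \<Longrightarrow> b \<in> A \<Longrightarrow> star (mul a b) = mul (star b) (star a)"
    and star_star: "a \<in> A \<Longrightarrow> star (star a) = a"
    and anisotropic: "a \<in> A \<Longrightarrow> mul (star a) a = 0 \<Longrightarrow> a = 0"
    and finite_rank: "\<exists>K::nat. \<forall>f. (\<forall>i. f i \<in> A) \<longrightarrow>
      (\<exists>c. (\<exists>i\<le>K. c i \<noteq> 0) \<and> (\<Sum>i\<le>K. scale (c i) (f i)) = 0)"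
begin

lemma star_zero [simp]: "star 0 = 0"
  using star_scale[OF A_zero, of 0] by simp

lemma star_sum: "(\<And>i. i \<in> I \<Longrightarrow> f i \<in> A) \<Longrightarrow> star (sum f I) = (\<Sum>i\<in>I. star (f i))"
  by (induction I rule: infinite_finite_induct) (simp_all add: star_add A_sum)

lemma star_diff:
  assumes "a \<in> A" "b \<in> A"
  shows "star (a - b) = star a - star b"
  using star_add[of "a - b" b] assms by (simp add: A_diff)

lemmas A_rules = A_intros star_in

text \<open>Since \<open>h = x\<^sup>* x\<close> is self-adjoint, \<open>h h z = 0\<close> gives
  \<open>(h z)\<^sup>* (h z) = 0\<close>, hence \<open>h z = 0\<close>. This lowers the power one
  step at a time to \<open>h q = 0\<close>, and then
  \<open>(x q)\<^sup>* (x q) = q\<^sup>* h q = 0\<close>.\<close>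

lemma pow_mul_zero_cancel:
  assumes x: "x \<in> A" and q: "q \<in> A" and "mul (pow (mul (star x) x) m) q = 0"
  shows "mul x q = 0"
  using assms(3)
proof (induction m rule: less_induct)
  case (less m)
  let ?h = "mul (star x) x"
  have h: "?h \<in> A" "star ?h = ?h" using x by (simp_all add: A_rules star_mul star_star)
  consider "m = 0" | "m = 1" | k where "m = Suc (Suc k)"
    by (metis One_nat_def old.nat.exhaust)
  then show ?case
  proof cases
    case 1
    then show ?thesis using less.prems x q by (simp add: one_mul)
  next
    case 2
    then have "mul ?h q = 0" using less.prems x q h by (simp add: mul_one)
    moreover have "mul (star (mul x q)) (mul x q) = mul (star q) (mul ?h q)"
      using x q by (simp add: star_mul mul_assoc A_rules)
    ultimately show ?thesis using x q by - (rule anisotropic; simp add: A_rules)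
  next
    case 3
    let ?z = "mul (pow ?h k) q"
    have z: "?z \<in> A" using h q by (simp add: A_rules pow_in)
    have zz: "mul ?h (mul ?h ?z) = 0"
      using less.prems 3 h q by (simp add: mul_assoc A_rules pow_in)
    have "mul (star (mul ?h ?z)) (mul ?h ?z) = mul (star ?z) (mul ?h (mul ?h ?z))"
      using star_mul[OF h(1) z] h z by (simp add: mul_assoc star_in mul_in)
    then have "mul ?h ?z = 0" using zz z h by - (rule anisotropic; simp add: A_rules)
    then have "mul (pow ?h (Suc k)) q = 0" using h q by (simp add: mul_assoc pow_in)
    then show ?thesis using less.IH[of "Suc k"] 3 by simp
  qed
qed

text \<open>Put \<open>h = x\<^sup>* x\<close>.  Some integer polynomial \<open>h\<^sup>k (a + h r)\<close> with \<open>a \<noteq> 0\<close> vanishes, and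
  anisotropy cancels \<open>h\<^sup>k\<close> down to \<open>x (a + h r) = 0\<close>, so \<open>a x = - x h r\<close> lies in \<open>I\<close>.\<close>

lemma star_mul_self_in_ideal:
  assumes I: "two_sided_ideal I" and x: "x \<in> A" and xI: "mul (star x) x \<in> I"
  shows "\<exists>k. k \<noteq> 0 \<and> scale k x \<in> I"
proof -
  let ?h = "mul (star x) x"
  have h: "?h \<in> A" using x by (simp add: A_rules)
  obtain K :: nat where "\<forall>f. (\<forall>i. f i \<in> A) \<longrightarrow>
      (\<exists>c. (\<exists>i\<le>K. c i \<noteq> 0) \<and> (\<Sum>i\<le>K. scale (c i) (f i)) = 0)"
    using finite_rank ..
  then have "\<exists>c. (\<exists>i\<le>K. c i \<noteq> 0) \<and> (\<Sum>i\<le>K. scale (c i) (pow ?h i)) = 0"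
    using h by (simp add: pow_in)
  then obtain c i where ci: "i \<le> K" "c i \<noteq> 0"
    and c0: "(\<Sum>i\<le>K. scale (c i) (pow ?h i)) = 0"
    by blast
  obtain k a r where a: "a \<noteq> 0" and r: "r \<in> A"
    and "mul (pow ?h k) (scale a one + mul ?h r) = 0"
    using polynomial_factor[where c = c, OF h ci] c0 by auto
  then have "mul x (scale a one + mul ?h r) = 0"
    using pow_mul_zero_cancel[OF x] h r by (simp add: A_rules)
  then have "scale a x + mul x (mul ?h r) = 0"
    using x h r by (simp add: mul_add_right mul_scale_right mul_one A_rules)
  moreover have "mul x (mul ?h r) \<in> I" using two_sided_idealD[OF I] x r xI by simp
  ultimately have "scale a x \<in> I"
    using two_sided_idealD(1)[OF I] by (metis add_eq_0_iff2 subspace_neg)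
  with a show ?thesis by blast
qed

end

section \<open>Cell data from a poset of idempotents\<close>

text \<open>Cell data ask separately for injectivity and for independence of the image. One
  criterion on indexed relations yields both: two equal members would give the relation with
  coefficients 1 and -1.\<close>

lemma (in Modules.module) family_independent:
  fixes f :: "'i \<Rightarrow> 'b"
  assumes I: "finite I" and nz: "(1::'a) \<noteq> 0"
    and ind: "\<And>c. (\<Sum>i\<in>I. scale (c i) (f i)) = 0 \<Longrightarrow> \<forall>i\<in>I. c i = 0"
  shows "inj_on f I" "independent (f ` I)"
proof -
  show inj: "inj_on f I"
  proof (rule inj_onI, rule ccontr)
    fix i j assume ij: "i \<in> I" "j \<in> I" "f i = f j" "i \<noteq> j"
    let ?c = "\<lambda>k. if k = i then 1 else if k = j then -1 else 0 :: 'a"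
    have "(\<Sum>k\<in>I. scale (?c k) (f k)) = (\<Sum>k\<in>{i, j}. scale (?c k) (f k))"
      using I ij by (intro sum.mono_neutral_right) auto
    then have "(\<Sum>k\<in>I. scale (?c k) (f k)) = 0" using ij by simp
    from ind[OF this] nz ij show False by auto
  qed
  show "independent (f ` I)"
  proof
    assume "dependent (f ` I)"
    then obtain u v where "(\<Sum>v\<in>f ` I. scale (u v) v) = 0" and "v \<in> f ` I" "u v \<noteq> 0"
      using I by (auto simp: dependent_finite)
    then show False using ind[of "u \<circ> f"] inj by (auto simp: sum.reindex)
  qed
qed

locale idempotent_poset = star_algebra scale A mul one star
  for scale :: "int \<Rightarrow> 'b::ab_group_add \<Rightarrow> 'b" and A mul one star +
  fixes P :: "'l set" and ord :: "('l \<times> 'l) set" and xi :: "'l \<Rightarrow> 'b" and e :: 'b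
  assumes finite_P: "finite P" and order_P: "partial_order_on P ord"
    and xi_in: "l \<in> P \<Longrightarrow> xi l \<in> A"
    and xi_idem: "l \<in> P \<Longrightarrow> mul (xi l) (xi l) = xi l"
    and star_xi: "l \<in> P \<Longrightarrow> star (xi l) = xi l"
    and e_in: "e \<in> A" and e_idem: "mul e e = e" and star_e: "star e = e"
begin

definition above :: "'l \<Rightarrow> 'b set" where
  "above l = span {mul (mul s (xi m)) s' | s s' m. s \<in> A \<and> s' \<in> A \<and> m \<in> P \<and> (l, m) \<in> ord \<and> m \<noteq> l}"

text \<open>Fixed-point equations make closure properties equational; \<open>corner_eq\<close>
  recovers the form \<open>e A e\<close>.\<close>

definition corner :: "'b set" where
  "corner = {x \<in> A. mul e x = x \<and> mul x e = x}"

lemma ord_trans: "(k, l) \<in> ord \<Longrightarrow> (l, m) \<in> ord \<Longrightarrow> (k, m) \<in> ord"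
  using order_P by (auto simp: partial_order_on_def preorder_on_def trans_def)

lemma ord_antisym: "(k, l) \<in> ord \<Longrightarrow> (l, k) \<in> ord \<Longrightarrow> k = l"
  using order_P by (auto simp: partial_order_on_def antisym_def)

lemma ord_refl: "l \<in> P \<Longrightarrow> (l, l) \<in> ord"
  using order_P by (auto simp: partial_order_on_def preorder_on_def refl_on_def)

text \<open>The size of the down-set serves to select a minimal shape, as the size of the up-set in
  \<open>card_up_less\<close> serves for downward induction.\<close>

lemma card_down_less:
  assumes "l \<in> P" "(m, l) \<in> ord" "m \<noteq> l"
  shows "card {k \<in> P. (k, m) \<in> ord} < card {k \<in> P. (k, l) \<in> ord}"
proof -
  have "l \<in> {k \<in> P. (k, l) \<in> ord} - {k \<in> P. (k, m) \<in> ord}"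
    using assms ord_antisym ord_refl by auto
  moreover have "{k \<in> P. (k, m) \<in> ord} \<subseteq> {k \<in> P. (k, l) \<in> ord}"
    using assms ord_trans by auto
  ultimately show ?thesis using finite_P by (intro psubset_card_mono) auto
qed

lemma card_up_less:
  assumes "l \<in> P" "(l, m) \<in> ord" "m \<noteq> l"
  shows "card {k \<in> P. (m, k) \<in> ord} < card {k \<in> P. (l, k) \<in> ord}"
proof -
  have "l \<in> {k \<in> P. (l, k) \<in> ord} - {k \<in> P. (m, k) \<in> ord}"
    using assms ord_antisym ord_refl by auto
  moreover have "{k \<in> P. (m, k) \<in> ord} \<subseteq> {k \<in> P. (l, k) \<in> ord}"
    using assms ord_trans by auto
  ultimately show ?thesis using finite_P by (intro psubset_card_mono) auto
qed

lemma above_gen: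
  assumes "s \<in> A" "s' \<in> A" "m \<in> P" "(l, m) \<in> ord" "m \<noteq> l"
  shows "mul (mul s (xi m)) s' \<in> above l"
  unfolding above_def using assms by (intro span_base) auto

lemma above_subset: "above l \<subseteq> A"
  unfolding above_def using xi_in by (intro span_minimal A_subspace) (auto intro!: mul_in)

lemma subspace_above: "subspace (above l)"
  unfolding above_def by (rule subspace_span)

text \<open>A generator \<open>s (xi m) s'\<close> only has its outer factors changed by
  multiplication; the involution swaps them because \<open>xi m\<close> is self-adjoint.\<close>

lemma above_closed:
  assumes a: "a \<in> A" and x: "x \<in> above l"
  shows "mul a x \<in> above l \<and> mul x a \<in> above l \<and> star x \<in> above l"
proof -
  let ?W = "{x \<in> A. mul a x \<in> above l \<and> mul x a \<in> above l \<and> star x \<in> above l}"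
  have "subspace ?W"
    using subspace_above a
    by (intro subspaceI) (auto simp: A_intros mul_add_left mul_add_right mul_scale_left mul_scale_right
        star_add star_scale subspace_0 subspace_add subspace_scale)
  moreover have "mul (mul s (xi m)) s' \<in> ?W"
    if m: "s \<in> A" "s' \<in> A" "m \<in> P" "(l, m) \<in> ord" "m \<noteq> l" for s s' m
  proof -
    have "mul a (mul (mul s (xi m)) s') = mul (mul (mul a s) (xi m)) s'"
      "mul (mul (mul s (xi m)) s') a = mul (mul s (xi m)) (mul s' a)"
      "star (mul (mul s (xi m)) s') = mul (mul (star s') (xi m)) (star s)"
      using a m xi_in star_xi by (simp_all add: mul_assoc star_mul A_rules)
    then show ?thesis using a m xi_in by (auto intro!: above_gen A_rules)
  qed
  ultimately have "above l \<subseteq> ?W" by (subst above_def, intro span_minimal) auto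
  with x show ?thesis by blast
qed

lemma above_ideal: "two_sided_ideal (above l)"
  using subspace_above above_subset above_closed by (auto simp: two_sided_ideal_def)

lemma above_mul_cong:
  assumes "a \<in> A" "a' \<in> A" "b \<in> A" "b' \<in> A" "a - a' \<in> above l" "b - b' \<in> above l"
  shows "mul a b - mul a' b' \<in> above l"
proof -
  have "mul a b - mul a' b' = mul a (b - b') + mul (a - a') b'"
    using assms by (simp add: mul_diff_left mul_diff_right)
  then show ?thesis using assms above_closed subspace_above by (auto intro: subspace_add)
qed

lemma corner_eq: "corner = {mul (mul e a) e | a. a \<in> A}"
proof
  show "corner \<subseteq> {mul (mul e a) e | a. a \<in> A}" by (force simp: corner_def)
  show "{mul (mul e a) e | a. a \<in> A} \<subseteq> corner"
  proof clarify
    fix a assume "a \<in> A"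
    then have "mul e (mul (mul e a) e) = mul (mul (mul e e) a) e"
      "mul (mul (mul e a) e) e = mul (mul e a) (mul e e)" "mul (mul e a) e \<in> A"
      using e_in by (simp_all only: mul_assoc A_rules)
    then show "mul (mul e a) e \<in> corner" by (simp add: corner_def e_idem)
  qed
qed

lemma corner_subspace: "subspace corner"
  using e_in by (intro subspaceI)
    (auto simp: corner_def A_rules mul_add_left mul_add_right mul_scale_left mul_scale_right)

lemma corner_mul: "a \<in> A \<Longrightarrow> b \<in> A \<Longrightarrow> mul e a = a \<Longrightarrow> mul b e = b \<Longrightarrow> mul a b \<in> corner"
  using e_in mul_assoc[of e a b, symmetric] by (simp add: corner_def A_rules mul_assoc)

end

text \<open>This is the interface between the formal argument and permutation modules.
  \<open>xi_local\<close> and \<open>xi_above\<close> come from straightening,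
  \<open>e_above\<close> discards the shapes outside \<open>L\<close>, and
  \<open>corner_generated\<close> provides the starting point of the spanning argument.\<close>

locale cell_ideals = idempotent_poset scale A mul one star P ord xi e
  for scale :: "int \<Rightarrow> 'b::ab_group_add \<Rightarrow> 'b" and A mul one star
    and P :: "'l set" and ord xi e +
  fixes L :: "'l set" and N :: "'l \<Rightarrow> 'm set" and d :: "'l \<Rightarrow> 'm \<Rightarrow> 'b"
  assumes L_subset: "L \<subseteq> P"
    and xi_local: "l \<in> L \<Longrightarrow> a \<in> A \<Longrightarrow> \<exists>k. mul (mul (xi l) a) (xi l) - scale k (xi l) \<in> above l"
    and xi_above: "l \<in> P \<Longrightarrow> m \<in> P \<Longrightarrow> (m, l) \<notin> ord \<Longrightarrow> a \<in> A \<Longrightarrow>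
      mul (mul (xi l) a) (xi m) \<in> above l"
    and e_above: "l \<in> P \<Longrightarrow> l \<notin> L \<Longrightarrow> a \<in> A \<Longrightarrow> mul (mul e a) (xi l) \<in> above l"
    and corner_generated: "corner \<subseteq>
      span {mul (mul (mul (mul e s) (xi m)) s') e | s s' m. s \<in> A \<and> s' \<in> A \<and> m \<in> P}"
    and d_in: "l \<in> L \<Longrightarrow> t \<in> N l \<Longrightarrow> d l t \<in> {mul (mul e s) (xi l) | s. s \<in> A}"
    and d_basis: "l \<in> L \<Longrightarrow> basis_mod scale
      {a + b | a b. a \<in> {mul (mul e s) (xi l) | s. s \<in> A} \<and> b \<in> above l} (above l) (N l) (d l)"
begin

definition cell :: "'l \<Rightarrow> 'm \<Rightarrow> 'm \<Rightarrow> 'b" where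
  "cell l t u = mul (d l t) (star (d l u))"

lemma L_in_P: "l \<in> L \<Longrightarrow> l \<in> P"
  using L_subset by blast

lemma N_fin: "l \<in> L \<Longrightarrow> finite (N l)"
  using d_basis by (auto simp: basis_mod_def)

lemma d_A:
  assumes "l \<in> L" "t \<in> N l"
  shows "d l t \<in> A" "mul e (d l t) = d l t" "mul (d l t) (xi l) = d l t"
    "star (d l t) \<in> A" "mul (star (d l t)) e = star (d l t)" "mul (xi l) (star (d l t)) = star (d l t)"
proof -
  obtain s where s: "s \<in> A" "d l t = mul (mul e s) (xi l)" using d_in[OF assms] by blast
  have l: "xi l \<in> A" using xi_in L_in_P assms by blast
  show 1: "d l t \<in> A" using s e_in l by (simp add: A_rules)
  have "mul e (mul (mul e s) (xi l)) = mul (mul (mul e e) s) (xi l)"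
    "mul (mul (mul e s) (xi l)) (xi l) = mul (mul e s) (mul (xi l) (xi l))"
    using s e_in l by (simp_all only: mul_assoc A_rules)
  then show 2: "mul e (d l t) = d l t" "mul (d l t) (xi l) = d l t"
    using s xi_idem L_in_P assms(1) by (simp_all add: e_idem)
  show "star (d l t) \<in> A" "mul (star (d l t)) e = star (d l t)" "mul (xi l) (star (d l t)) = star (d l t)"
    using star_mul[OF e_in 1] star_mul[OF 1 l] 1 2 star_xi L_in_P assms(1) by (simp_all add: star_e star_in)
qed

lemma d_independent:
  assumes "l \<in> L" "(\<Sum>t\<in>N l. scale (c t) (d l t)) \<in> above l" "t \<in> N l"
  shows "c t = 0"
  using d_basis[OF assms(1)] assms(2,3) unfolding basis_mod_def by blast

lemma d_spanning:
  assumes "l \<in> L" "s \<in> A"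
  shows "\<exists>c. mul (mul e s) (xi l) - (\<Sum>t\<in>N l. scale (c t) (d l t)) \<in> above l"
proof -
  have "mul (mul e s) (xi l) + 0 \<in> {a + b | a b. a \<in> {mul (mul e s) (xi l) | s. s \<in> A} \<and> b \<in> above l}"
    using assms subspace_above subspace_0 by blast
  then show ?thesis using d_basis[OF assms(1)] unfolding basis_mod_def by auto
qed

lemma cell_corner: "l \<in> L \<Longrightarrow> t \<in> N l \<Longrightarrow> u \<in> N l \<Longrightarrow> cell l t u \<in> corner"
  unfolding cell_def by (intro corner_mul) (simp_all add: d_A)

section \<open>Spanning by cells and the multiplication rule\<close>

definition cells_above :: "'l \<Rightarrow> 'b set" where
  "cells_above l = span {cell m t u | m t u. m \<in> L \<and> (l, m) \<in> ord \<and> m \<noteq> l \<and> t \<in> N m \<and> u \<in> N m}"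

definition cells_from :: "'l \<Rightarrow> 'b set" where
  "cells_from l = span {cell m t u | m t u. m \<in> L \<and> (l, m) \<in> ord \<and> t \<in> N m \<and> u \<in> N m}"

text \<open>Passes from the generators of the ideal to all its elements by linearity. The spanning
  statement is a hypothesis here because the lemma is needed inside the induction that proves it,
  and again afterwards.\<close>

lemma corner_sandwich_above:
  assumes IH: "\<And>m s s'. m \<in> P \<Longrightarrow> (l, m) \<in> ord \<Longrightarrow> m \<noteq> l \<Longrightarrow> s \<in> A \<Longrightarrow> s' \<in> A \<Longrightarrow>
      mul (mul (mul (mul e s) (xi m)) s') e \<in> cells_from m"
    and x: "x \<in> above l"
  shows "mul (mul e x) e \<in> cells_above l"
proof -
  let ?W = "{x \<in> A. mul (mul e x) e \<in> cells_above l}"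
  have V: "subspace (cells_above l)" unfolding cells_above_def by (rule subspace_span)
  have "subspace ?W"
    using V e_in by (intro subspaceI)
     (auto simp: A_rules mul_add_left mul_add_right mul_scale_left mul_scale_right
        subspace_0 subspace_add subspace_scale)
  moreover have "mul (mul s (xi m)) s' \<in> ?W"
    if m: "s \<in> A" "s' \<in> A" "m \<in> P" "(l, m) \<in> ord" "m \<noteq> l" for s s' m
  proof -
    have "cells_from m \<subseteq> cells_above l"
      unfolding cells_from_def cells_above_def
      by (intro span_mono) (use m ord_trans ord_antisym in blast)
    moreover have "mul (mul e (mul (mul s (xi m)) s')) e = mul (mul (mul (mul e s) (xi m)) s') e"
      using m e_in xi_in by (simp add: mul_assoc A_rules)
    ultimately show ?thesis using IH[of m s s'] m xi_in by (auto intro!: A_rules)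
  qed
  ultimately have "above l \<subseteq> ?W" by (subst above_def, intro span_minimal) auto
  with x show ?thesis by blast
qed

lemma cells_above_subset: "cells_above l \<subseteq> cells_from l"
  unfolding cells_from_def cells_above_def by (intro span_mono) blast

text \<open>Both halves of the product are expanded in the lifts modulo \<open>above l\<close>. The
  leading part is a combination of cells of shape \<open>l\<close>, and the error belongs to higher
  shapes, where the induction applies. For \<open>l\<close> outside \<open>L\<close> the whole
  product is already an error term.\<close>

lemma sandwich_in_cells:
  assumes "l \<in> P" "s \<in> A" "s' \<in> A"
  shows "mul (mul (mul (mul e s) (xi l)) s') e \<in> cells_from l"
  using assms
proof (induction "card {k \<in> P. (l, k) \<in> ord}" arbitrary: l s s' rule: less_induct)
  case less
  have xi: "xi l \<in> A" "mul (xi l) (xi l) = xi l" "star (xi l) = xi l"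
    using less.prems xi_in xi_idem star_xi by auto
  have sandwich: "mul (mul e x) e \<in> cells_from l" if "x \<in> above l" for x
  proof -
    have "mul (mul e x) e \<in> cells_above l"
      by (rule corner_sandwich_above[OF _ that])
        (use less.hyps less.prems(1) card_up_less in blast)
    then show ?thesis using cells_above_subset by blast
  qed
  show ?case
  proof (cases "l \<in> L")
    case False
    have "mul (mul (mul e s) (xi l)) s' \<in> above l"
      using e_above False less.prems above_closed by auto
    moreover have "mul (mul e (mul (mul (mul e s) (xi l)) s')) e
        = mul (mul (mul (mul (mul e e) s) (xi l)) s') e"
      using less.prems e_in xi by (simp only: mul_assoc A_rules)
    ultimately show ?thesis using sandwich by (metis e_idem)
  next
    case True
    \<comment> \<open>Idempotence of \<open>xi l\<close> splits the product as
      \<open>?a (star ?b)\<close>, so the right half becomes the star of an element that the lifts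
      can express.\<close>
    let ?a = "mul (mul e s) (xi l)" and ?b = "mul (mul e (star s')) (xi l)"
    obtain c where c: "?a - (\<Sum>t\<in>N l. scale (c t) (d l t)) \<in> above l" (is "?a - ?D \<in> _")
      using d_spanning True less.prems by blast
    obtain c' where c': "?b - (\<Sum>t\<in>N l. scale (c' t) (d l t)) \<in> above l" (is "?b - ?D' \<in> _")
      using d_spanning[OF True star_in] less.prems by blast
    have DA: "?D \<in> A" "?D' \<in> A" using True by (auto intro!: A_rules simp: d_A)
    have eD: "mul e ?D = ?D" "mul e ?D' = ?D'"
      using True e_in by (auto simp: mul_sum_right mul_scale_right A_rules d_A intro!: sum.cong)
    have A: "?a \<in> A" "?b \<in> A" using less.prems e_in xi by (auto intro!: A_rules)
    have ea: "mul e ?a = ?a" "mul e ?b = ?b"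
    proof -
      have "mul e (mul (mul e x) (xi l)) = mul (mul (mul e e) x) (xi l)" if "x \<in> A" for x
        using that e_in xi by (simp only: mul_assoc A_rules)
      then show "mul e ?a = ?a" "mul e ?b = ?b" using less.prems by (simp_all add: e_idem star_in)
    qed
    have corner: "mul x (star y) \<in> corner" if "x \<in> A" "y \<in> A" "mul e x = x" "mul e y = y" for x y
      using that star_mul[OF e_in that(2)] by (intro corner_mul) (simp_all add: star_e star_in)
    let ?r = "mul ?a (star ?b) - mul ?D (star ?D')"
    have "star ?b - star ?D' \<in> above l"
      using above_closed[OF e_in c'] A DA by (simp add: star_diff)
    then have r: "?r \<in> above l" using c A DA by (intro above_mul_cong) (simp_all add: star_in)
    \<comment> \<open>The error is fixed by \<open>e\<close> on both sides, so the statement about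
      sandwiched elements of \<open>above l\<close> applies to it directly.\<close>
    have "?r \<in> corner" using corner_subspace A DA ea eD by (intro subspace_diff corner)
    then have "?r = mul (mul e ?r) e" by (simp add: corner_def)
    then have rV: "?r \<in> cells_from l" using sandwich[OF r] by simp
    have "mul ?D (star ?D') = (\<Sum>u\<in>N l. \<Sum>t\<in>N l. scale (c' u) (scale (c t) (cell l t u)))"
      using True by (simp add: star_sum star_scale mul_sum_left mul_sum_right A_rules d_A
          mul_scale_left mul_scale_right cell_def scale_sum_right)
    also have "\<dots> \<in> cells_from l"
      unfolding cells_from_def using True less.prems ord_refl
      by (intro span_sum span_scale span_base) blast
    finally have "mul ?a (star ?b) \<in> cells_from l"
      using rV span_add[of ?r _ "mul ?D (star ?D')"] unfolding cells_from_def by simp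
    moreover have "mul ?a (star ?b) = mul (mul (mul (mul e s) (mul (xi l) (xi l))) s') e"
      using less.prems e_in xi(1,3) by (simp add: star_mul star_e star_star mul_assoc A_rules)
    ultimately show ?thesis by (simp add: xi)
  qed
qed

text \<open>Converts congruences modulo the ideal of the large algebra into congruences modulo
  higher cells, which is what the axiom (C3) asks for.\<close>

lemma corner_above:
  assumes "l \<in> P" "x \<in> corner" "x \<in> above l"
  shows "x \<in> cells_above l"
proof -
  have "mul (mul e x) e \<in> cells_above l"
    using sandwich_in_cells assms(3) by (intro corner_sandwich_above) auto
  then show ?thesis using assms(2) by (simp add: corner_def)
qed

lemma span_cells: "span ((\<lambda>(l, t, u). cell l t u) ` (SIGMA l:L. N l \<times> N l)) = corner"
  (is "span ?C = _")
proof
  show "span ?C \<subseteq> corner"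
    using cell_corner by (intro span_minimal corner_subspace) auto
  have "cells_from m \<subseteq> span ?C" for m
    unfolding cells_from_def by (intro span_mono) force
  then have "span {mul (mul (mul (mul e s) (xi m)) s') e | s s' m. s \<in> A \<and> s' \<in> A \<and> m \<in> P} \<subseteq> span ?C"
    using sandwich_in_cells by (intro span_minimal subspace_span) blast
  then show "corner \<subseteq> span ?C" using corner_generated by blast
qed

text \<open>The coefficients come from expanding \<open>a (d l t)\<close> in the lifts, before
  \<open>star (d l u)\<close> is multiplied on; hence they do not depend on
  \<open>u\<close>.\<close>

lemma mul_cell:
  assumes l: "l \<in> L" and a: "a \<in> corner"
  shows "\<exists>\<rho>. \<forall>t\<in>N l. \<forall>u\<in>N l.
    mul a (cell l t u) - (\<Sum>t'\<in>N l. scale (\<rho> t' t) (cell l t' u)) \<in> cells_above l"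
proof -
  have xi: "xi l \<in> A" using xi_in L_in_P l by blast
  have aA: "a \<in> A" "mul e a = a" using a by (auto simp: corner_def)
  have "\<exists>c. mul a (d l t) - (\<Sum>t'\<in>N l. scale (c t') (d l t')) \<in> above l" if t: "t \<in> N l" for t
  proof -
    have "mul (mul e (mul a (d l t))) (xi l) = mul (mul e a) (mul (d l t) (xi l))"
      using aA(1) d_A(1)[OF l t] xi e_in by (simp only: mul_assoc A_rules)
    then show ?thesis
      using d_spanning[OF l, of "mul a (d l t)"] aA d_A[OF l t] by (simp add: A_rules)
  qed
  then obtain c where c: "\<And>t. t \<in> N l \<Longrightarrow>
      mul a (d l t) - (\<Sum>t'\<in>N l. scale (c t t') (d l t')) \<in> above l"
    by metis
  have "mul a (cell l t u) - (\<Sum>t'\<in>N l. scale (c t t') (cell l t' u)) \<in> cells_above l"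
    if t: "t \<in> N l" and u: "u \<in> N l" for t u
  proof (rule corner_above)
    let ?D = "\<Sum>t'\<in>N l. scale (c t t') (d l t')"
    have D: "?D \<in> A" using l by (auto intro!: A_rules simp: d_A)
    have "mul (mul a (d l t) - ?D) (star (d l u))
        = mul a (cell l t u) - (\<Sum>t'\<in>N l. scale (c t t') (cell l t' u))"
      using l t u aA D by (simp add: mul_diff_left A_rules d_A mul_sum_left mul_scale_left cell_def mul_assoc)
    then show "mul a (cell l t u) - (\<Sum>t'\<in>N l. scale (c t t') (cell l t' u)) \<in> above l"
      using c[OF t] above_closed[OF d_A(4)[OF l u]] by metis
    have "mul a (cell l t u) \<in> corner"
      using corner_mul[of a "cell l t u"] cell_corner[OF l t u] aA by (auto simp: corner_def)
    then show "mul a (cell l t u) - (\<Sum>t'\<in>N l. scale (c t t') (cell l t' u)) \<in> corner"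
      using cell_corner l u by (intro subspace_diff subspace_sum subspace_scale corner_subspace) auto
  qed (use l L_in_P in auto)
  then show ?thesis by (intro exI[of _ "\<lambda>t' t. c t t'"]) auto
qed

section \<open>Gram matrices and independence of the cells\<close>

lemma d_gram:
  assumes "l \<in> L"
  shows "\<exists>g. \<forall>s\<in>N l. \<forall>t\<in>N l. mul (star (d l s)) (d l t) - scale (g s t) (xi l) \<in> above l"
proof -
  have "\<exists>k. mul (star (d l s)) (d l t) - scale k (xi l) \<in> above l" if st: "s \<in> N l" "t \<in> N l" for s t
  proof -
    have "mul (mul (xi l) (mul (star (d l s)) (d l t))) (xi l)
        = mul (mul (xi l) (star (d l s))) (mul (d l t) (xi l))"
      using assms st d_A(1,4) xi_in[OF L_in_P] by (simp only: mul_assoc A_rules)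
    then show ?thesis
      using xi_local[OF assms, of "mul (star (d l s)) (d l t)"] assms st by (simp add: d_A A_rules)
  qed
  then show ?thesis by metis
qed

text \<open>A nonzero multiple of the combination falls into the ideal, independence of the classes
  annihilates its coefficients, and the multiplier cancels in the integers.\<close>

lemma d_anisotropic:
  assumes l: "l \<in> L" and "mul (star (\<Sum>t\<in>N l. scale (c t) (d l t))) (\<Sum>t\<in>N l. scale (c t) (d l t)) \<in> above l"
    and t: "t \<in> N l"
  shows "c t = 0"
proof -
  let ?x = "\<Sum>t\<in>N l. scale (c t) (d l t)"
  have "?x \<in> A" using l by (auto intro!: A_rules simp: d_A)
  then obtain k where k: "k \<noteq> 0" "scale k ?x \<in> above l"
    using star_mul_self_in_ideal[OF above_ideal] assms(2) by blast
  then have "k * c t = 0"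
    using d_independent[OF l _ t, of "\<lambda>t. k * c t"] by (simp add: scale_sum_right)
  with k show ?thesis by simp
qed

lemma above_linear_combination:
  assumes "\<And>i. i \<in> I \<Longrightarrow> f i - scale (k i) y \<in> above l"
  shows "sum f I - scale (sum k I) y \<in> above l"
proof -
  have "sum f I - scale (sum k I) y = (\<Sum>i\<in>I. f i - scale (k i) y)"
    by (simp add: sum_subtractf scale_sum_left)
  also have "\<dots> \<in> above l" using assms by (intro subspace_sum subspace_above)
  finally show ?thesis .
qed

lemma above_scale_cong:
  assumes "x - scale k y \<in> above l"
  shows "scale c x - scale (c * k) y \<in> above l"
  using subspace_scale[OF subspace_above assms, of c] by (simp add: scale_right_diff_distrib)

lemma above_cong_zero: "x - scale k y \<in> above l \<Longrightarrow> k = 0 \<Longrightarrow> x \<in> above l"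
  by simp

text \<open>If \<open>g c = 0\<close>, then \<open>x = \<Sum> c t d t\<close> has
  \<open>star (d s) x\<close> in the ideal for all \<open>s\<close>, hence also
  \<open>star x x\<close>. Symmetry of \<open>g\<close> is not established, so
  \<open>gram_right\<close> repeats the argument for the other side.\<close>

lemma gram_left:
  assumes l: "l \<in> L"
    and g: "\<And>s t. s \<in> N l \<Longrightarrow> t \<in> N l \<Longrightarrow> mul (star (d l s)) (d l t) - scale (g s t) (xi l) \<in> above l"
    and zero: "\<And>s. s \<in> N l \<Longrightarrow> (\<Sum>t\<in>N l. c t * g s t) = 0" and t: "t \<in> N l"
  shows "c t = 0"
proof (rule d_anisotropic[OF l _ t])
  let ?x = "\<Sum>t\<in>N l. scale (c t) (d l t)"
  have x: "?x \<in> A" using l by (auto intro!: A_rules simp: d_A)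
  have "mul (star (d l s)) ?x \<in> above l" if s: "s \<in> N l" for s
  proof -
    have "mul (star (d l s)) ?x = (\<Sum>t\<in>N l. scale (c t) (mul (star (d l s)) (d l t)))"
      using l s by (simp add: mul_sum_right mul_scale_right A_rules d_A)
    then have "mul (star (d l s)) ?x - scale (\<Sum>t\<in>N l. c t * g s t) (xi l) \<in> above l"
      using g s by (simp only:) (intro above_linear_combination above_scale_cong)
    then show ?thesis using zero[OF s] by (rule above_cong_zero)
  qed
  moreover have "mul (star ?x) ?x = (\<Sum>s\<in>N l. scale (c s) (mul (star (d l s)) ?x))"
    using l x by (simp add: star_sum star_scale mul_sum_left mul_scale_left A_rules d_A)
  ultimately show "mul (star ?x) ?x \<in> above l"
    by (simp only:) (intro subspace_sum subspace_scale subspace_above)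
qed

lemma gram_right:
  assumes l: "l \<in> L"
    and g: "\<And>s t. s \<in> N l \<Longrightarrow> t \<in> N l \<Longrightarrow> mul (star (d l s)) (d l t) - scale (g s t) (xi l) \<in> above l"
    and zero: "\<And>t. t \<in> N l \<Longrightarrow> (\<Sum>s\<in>N l. c s * g s t) = 0" and t: "t \<in> N l"
  shows "c t = 0"
proof (rule d_anisotropic[OF l _ t])
  let ?x = "\<Sum>t\<in>N l. scale (c t) (d l t)"
  have x: "?x \<in> A" "star ?x \<in> A" using l by (auto intro!: A_rules simp: d_A)
  have "mul (star ?x) (d l t) \<in> above l" if t: "t \<in> N l" for t
  proof -
    have "mul (star ?x) (d l t) = (\<Sum>s\<in>N l. scale (c s) (mul (star (d l s)) (d l t)))"
      using l t by (simp add: star_sum star_scale mul_sum_left mul_scale_left A_rules d_A)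
    then have "mul (star ?x) (d l t) - scale (\<Sum>s\<in>N l. c s * g s t) (xi l) \<in> above l"
      using g t by (simp only:) (intro above_linear_combination above_scale_cong)
    then show ?thesis using zero[OF t] by (rule above_cong_zero)
  qed
  moreover have "mul (star ?x) ?x = (\<Sum>t\<in>N l. scale (c t) (mul (star ?x) (d l t)))"
    using l x by (simp add: mul_sum_right mul_scale_right A_rules d_A)
  ultimately show "mul (star ?x) ?x \<in> above l"
    by (simp only:) (intro subspace_sum subspace_scale subspace_above)
qed

text \<open>The inner factor \<open>star (d l s) (d m t)\<close> begins with \<open>xi l\<close> and
  ends with \<open>xi m\<close>, so \<open>xi_above\<close> already puts it into the ideal.\<close>

lemma cells_sandwiched:
  assumes l: "l \<in> L" and m: "m \<in> L" "t \<in> N m" "u \<in> N m" and s: "s \<in> N l" "v \<in> N l"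
    and "(m, l) \<notin> ord"
  shows "mul (mul (star (d l s)) (cell m t u)) (d l v) \<in> above l"
proof -
  note A = l m s xi_in[OF L_in_P] d_A(1,4)
  have "mul (mul (xi l) (mul (star (d l s)) (d m t))) (xi m)
      = mul (mul (xi l) (star (d l s))) (mul (d m t) (xi m))"
    using A by (simp only: mul_assoc A_rules)
  then have "mul (star (d l s)) (d m t) \<in> above l"
    using xi_above[of l m "mul (star (d l s)) (d m t)"] assms L_in_P by (simp add: d_A A_rules)
  then have "mul (mul (star (d l s)) (d m t)) (mul (star (d m u)) (d l v)) \<in> above l"
    using above_closed[of "mul (star (d m u)) (d l v)"] A by (simp add: A_rules)
  then show ?thesis using A by (simp add: cell_def mul_assoc A_rules)
qed

text \<open>Take \<open>l\<close> minimal among the shapes with a nonzero coefficient and sandwich the relation between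
  \<open>star (d l s)\<close> and \<open>d l v\<close>: modulo \<open>above l\<close> only the terms of shape \<open>l\<close> survive, and they give the matrix
  product \<open>g c g\<close> with the Gram matrix \<open>g\<close> of the \<open>d l t\<close>, which is nondegenerate.\<close>

lemma cells_independent:
  assumes zero: "(\<Sum>l\<in>L. \<Sum>t\<in>N l. \<Sum>u\<in>N l. scale (c l t u) (cell l t u)) = 0"
    and "l \<in> L" "t \<in> N l" "u \<in> N l"
  shows "c l t u = 0"
proof (rule ccontr)
  define Z where "Z l \<longleftrightarrow> l \<in> L \<and> (\<exists>t\<in>N l. \<exists>u\<in>N l. c l t u \<noteq> 0)" for l
  assume "c l t u \<noteq> 0"
  then have "Z l" using assms by (auto simp: Z_def)
  then obtain l where "Z l" and "\<And>m. Z m \<Longrightarrow> card {k \<in> P. (k, l) \<in> ord} \<le> card {k \<in> P. (k, m) \<in> ord}"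
    using ex_has_least_nat[of Z l "\<lambda>m. card {k \<in> P. (k, m) \<in> ord}"] by blast
  then have l: "l \<in> L" and min: "\<And>m. Z m \<Longrightarrow> m \<noteq> l \<Longrightarrow> (m, l) \<notin> ord"
    using card_down_less[of l] L_in_P by (force simp: Z_def, fastforce simp: Z_def not_less[symmetric])
  note A = l xi_in[OF L_in_P] d_A(1,4)
  obtain g where g: "\<And>s t. s \<in> N l \<Longrightarrow> t \<in> N l \<Longrightarrow>
      mul (star (d l s)) (d l t) - scale (g s t) (xi l) \<in> above l"
    using d_gram[OF l] by blast
  have main: "(\<Sum>t\<in>N l. (\<Sum>u\<in>N l. c l t u * g u v) * g s t) = 0" if sv: "s \<in> N l" "v \<in> N l" for s v
  proof -
    let ?F = "\<lambda>x. mul (mul (star (d l s)) x) (d l v)"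
    let ?S = "\<lambda>m. \<Sum>t\<in>N m. \<Sum>u\<in>N m. scale (c m t u) (?F (cell m t u))"
    have cA: "cell m t u \<in> A" if "m \<in> L" "t \<in> N m" "u \<in> N m" for m t u
      using cell_corner[OF that] by (simp add: corner_def)
    have "?F (\<Sum>l\<in>L. \<Sum>t\<in>N l. \<Sum>u\<in>N l. scale (c l t u) (cell l t u)) = (\<Sum>m\<in>L. ?S m)"
      using sv A by (simp add: mul_sum_left mul_sum_right mul_scale_left mul_scale_right A_rules cA)
    then have "(\<Sum>m\<in>L. ?S m) = 0" using zero sv A by (simp add: A_rules)
    moreover have "finite L" using finite_subset[OF L_subset finite_P] .
    ultimately have "?S l = - (\<Sum>m\<in>L - {l}. ?S m)"
      using l by (simp add: sum.remove eq_neg_iff_add_eq_0)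
    moreover have "(\<Sum>m\<in>L - {l}. ?S m) \<in> above l"
    proof (intro subspace_sum subspace_above)
      fix m t u assume m: "m \<in> L - {l}" "t \<in> N m" "u \<in> N m"
      show "scale (c m t u) (?F (cell m t u)) \<in> above l"
      proof (cases "c m t u = 0")
        case True
        then show ?thesis using subspace_above subspace_0 by simp
      next
        case False
        then have "(m, l) \<notin> ord" using min[of m] m by (auto simp: Z_def)
        then show ?thesis
          using cells_sandwiched l m sv by (intro subspace_scale subspace_above) auto
      qed
    qed
    ultimately have S: "?S l \<in> above l"
      using subspace_neg[OF subspace_above] by simp
    have "?F (cell l t u) - scale (g s t * g u v) (xi l) \<in> above l" if tu: "t \<in> N l" "u \<in> N l" for t u
    proof -
      have "mul (mul (star (d l s)) (d l t)) (mul (star (d l u)) (d l v))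
          - mul (scale (g s t) (xi l)) (scale (g u v) (xi l)) \<in> above l"
        using A sv tu g by (intro above_mul_cong) (auto intro: A_rules)
      moreover have "mul (scale (g s t) (xi l)) (scale (g u v) (xi l)) = scale (g s t * g u v) (xi l)"
        using A by (simp add: mul_scale_left mul_scale_right A_rules xi_idem L_in_P mult.commute)
      ultimately show ?thesis using A sv tu by (simp add: cell_def mul_assoc A_rules)
    qed
    then have "?S l - scale (\<Sum>t\<in>N l. \<Sum>u\<in>N l. c l t u * (g s t * g u v)) (xi l) \<in> above l"
      by (intro above_linear_combination above_scale_cong)
    from subspace_diff[OF subspace_above S this]
    have K: "scale (\<Sum>t\<in>N l. \<Sum>u\<in>N l. c l t u * (g s t * g u v)) (xi l) \<in> above l" (is "scale ?K _ \<in> _")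
      by simp
    \<comment> \<open>That \<open>xi l\<close> has infinite order modulo the ideal is not among the
      assumptions. Multiplying by \<open>d l s\<close>, whose class belongs to a basis, transfers
      the relation to a place where the coefficient must vanish.\<close>
    have "mul (d l s) (scale ?K (xi l)) = scale ?K (d l s)"
      using A sv by (simp add: mul_scale_right d_A)
    also have "\<dots> = (\<Sum>t\<in>N l. scale (if t = s then ?K else 0) (d l t))"
      using sv N_fin[OF l] by (simp add: if_distrib[of "\<lambda>k. scale k _"] cong: if_cong)
    finally have "mul (d l s) (scale ?K (xi l)) = (\<Sum>t\<in>N l. scale (if t = s then ?K else 0) (d l t))" .
    with above_closed[OF d_A(1)[OF l sv(1)] K]
    have "(\<Sum>t\<in>N l. scale (if t = s then ?K else 0) (d l t)) \<in> above l" by simp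
    from d_independent[OF l this sv(1)] have "?K = 0" by simp
    then show ?thesis by (simp add: sum_distrib_right sum_distrib_left mult_ac)
  qed
  \<comment> \<open>From \<open>g c g = 0\<close> the two Gram factors are cancelled in turn: the
    left one for each column \<open>v\<close>, then the right one for each row
    \<open>t\<close>.\<close>
  have sum0: "(\<Sum>u\<in>N l. c l t u * g u v) = 0" if "t \<in> N l" "v \<in> N l" for t v
    by (rule gram_left[OF l g]) (use main that in auto)
  have "c l t u = 0" if "t \<in> N l" "u \<in> N l" for t u
    by (rule gram_right[OF l g, where c = "c l t"]) (use sum0 that in auto)
  with \<open>Z l\<close> show False by (auto simp: Z_def)
qed

theorem cell_datum_corner: "cell_datum scale corner mul e L (Restr ord L) N cell star"
proof -
  let ?I = "SIGMA l:L. N l \<times> N l" and ?f = "\<lambda>(l, t, u). cell l t u"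
  have fin: "finite ?I" "finite L" using finite_subset[OF L_subset finite_P] N_fin by auto
  have "c i = 0" if z: "(\<Sum>i\<in>?I. scale (c i) (?f i)) = 0" and i: "i \<in> ?I" for c i
  proof -
    have "(\<Sum>i\<in>?I. scale (c i) (?f i)) = (\<Sum>l\<in>L. \<Sum>t\<in>N l. \<Sum>u\<in>N l. scale (c (l, t, u)) (cell l t u))"
      using fin N_fin by (auto simp: sum.cartesian_product sum.Sigma intro!: sum.cong)
    with z i cells_independent[of "\<lambda>l t u. c (l, t, u)"] show ?thesis by auto
  qed
  then have inj: "inj_on ?f ?I" and ind: "independent (?f ` ?I)"
    using family_independent[OF fin(1), of ?f] by auto
  have corner: "x \<in> A" "mul e x = x" "mul x e = x" if "x \<in> corner" for x
    using that by (auto simp: corner_def)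
  show ?thesis
  proof
    show "subspace corner" by (rule corner_subspace)
    show "e \<in> corner" using e_in e_idem by (simp add: corner_def)
    show "mul a b \<in> corner" if "a \<in> corner" "b \<in> corner" for a b
      using that corner by (intro corner_mul) auto
    show "star a \<in> corner" if "a \<in> corner" for a
      using corner[OF that] star_mul[OF e_in, of a] star_mul[of a e] e_in
      by (simp add: corner_def star_in star_e)
    show "partial_order_on L (Restr ord L)"
      using order_P L_subset
      by (auto simp: partial_order_on_def preorder_on_def refl_on_def trans_def antisym_def)
    show "\<exists>\<rho>. \<forall>t\<in>N l. \<forall>u\<in>N l. mul a (cell l t u) - (\<Sum>t'\<in>N l. scale (\<rho> t' t) (cell l t' u))
        \<in> span {cell m t'' u'' | m t'' u''.
          m \<in> L \<and> (l, m) \<in> Restr ord L \<and> m \<noteq> l \<and> t'' \<in> N m \<and> u'' \<in> N m}"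
      if "l \<in> L" "a \<in> corner" for l a
    proof -
      have "{cell m t'' u'' | m t'' u''. m \<in> L \<and> (l, m) \<in> Restr ord L \<and> m \<noteq> l \<and> t'' \<in> N m \<and> u'' \<in> N m}
          = {cell m t'' u'' | m t'' u''. m \<in> L \<and> (l, m) \<in> ord \<and> m \<noteq> l \<and> t'' \<in> N m \<and> u'' \<in> N m}"
        using that by blast
      then show ?thesis using mul_cell[OF that] by (simp add: cells_above_def)
    qed
    show "star (cell l t u) = cell l u t" if "l \<in> L" "t \<in> N l" "u \<in> N l" for l t u
      using that by (simp add: cell_def star_mul d_A star_star)
  qed (use corner mul_assoc mul_add_left mul_add_right mul_scale_left mul_scale_right N_fin inj ind
        span_cells star_add star_scale star_mul star_star in auto)
qed

end

section \<open>Endomorphisms of permutation modules as invariant matrices\<close>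

text \<open>Fraction-free Gaussian elimination, one coordinate at a time.\<close>

lemma integer_relation:
  fixes f :: "'i \<Rightarrow> 'p \<Rightarrow> int"
  assumes "finite X" "finite I" "card X < card I"
  shows "\<exists>c. (\<exists>i\<in>I. c i \<noteq> 0) \<and> (\<forall>p\<in>X. (\<Sum>i\<in>I. c i * f i p) = 0)"
  using assms
proof (induction X arbitrary: I f rule: finite_induct)
  case empty
  then have "I \<noteq> {}" by auto
  then show ?case by (intro exI[of _ "\<lambda>_. 1"]) auto
next
  case (insert p X)
  show ?case
  proof (cases "\<forall>i\<in>I. f i p = 0")
    case True
    obtain c where "\<exists>i\<in>I. c i \<noteq> 0" "\<forall>p\<in>X. (\<Sum>i\<in>I. c i * f i p) = 0"
      using insert.IH[of I f] insert.hyps insert.prems by auto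
    then show ?thesis using True by (intro exI[of _ c]) auto
  next
    case False
    then obtain i0 where i0: "i0 \<in> I" "f i0 p \<noteq> 0" by blast
    let ?J = "I - {i0}" and ?f = "\<lambda>i q. f i0 p * f i q - f i p * f i0 q"
    have "finite ?J" "card X < card ?J" using insert.hyps insert.prems i0 by auto
    from insert.IH[OF this, of ?f]
    obtain c where c: "\<exists>i\<in>?J. c i \<noteq> 0" "\<forall>q\<in>X. (\<Sum>i\<in>?J. c i * ?f i q) = 0"
      by blast
    \<comment> \<open>Back substitution: the old coefficients are multiplied by the pivot
      \<open>f i0 p\<close>, so that the coefficient of \<open>i0\<close> stays an integer.\<close>
    let ?c = "\<lambda>i. if i = i0 then - (\<Sum>i\<in>?J. c i * f i p) else f i0 p * c i"
    have "(\<Sum>i\<in>I. ?c i * f i q) = (\<Sum>i\<in>?J. c i * ?f i q)" for q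
      using insert.prems i0
      by (simp add: sum.remove[of I i0] sum_distrib_left sum_distrib_right algebra_simps sum_subtractf)
    moreover have "(\<Sum>i\<in>?J. c i * ?f i p) = 0" by (simp add: algebra_simps)
    ultimately have "\<forall>q\<in>insert p X. (\<Sum>i\<in>I. ?c i * f i q) = 0" using c by auto
    moreover have "\<exists>i\<in>I. ?c i \<noteq> 0" using c(1) i0 by auto
    ultimately show ?thesis by (intro exI[of _ ?c] conjI)
  qed
qed

text \<open>Entries outside \<open>X \<times> X\<close> are ignored, so equal maps have matrices
  that agree on \<open>X\<close> only, and one \<open>K\<close> can be read over \<open>X\<close> or
  over a subset, as in \<open>proj_mat_proj\<close>.\<close>

definition mat :: "'a set \<Rightarrow> ('a \<Rightarrow> 'a \<Rightarrow> 'r::comm_ring_1) \<Rightarrow> ('a \<Rightarrow> 'r) \<Rightarrow> 'a \<Rightarrow> 'r" where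
  "mat X K v = (\<lambda>y. if y \<in> X then (\<Sum>x\<in>X. K y x * v x) else 0)"

definition entry :: "(('a \<Rightarrow> 'r::comm_ring_1) \<Rightarrow> 'a \<Rightarrow> 'r) \<Rightarrow> 'a \<Rightarrow> 'a \<Rightarrow> 'r" where
  "entry s y x = s (pt x) y"

lemma mat_cong: "(\<And>y x. y \<in> X \<Longrightarrow> x \<in> X \<Longrightarrow> K y x = K' y x) \<Longrightarrow> mat X K = mat X K'"
  by (auto simp: mat_def fun_eq_iff intro!: sum.cong)

lemma sum_pt:
  assumes "finite X"
  shows "(\<Sum>z\<in>X. f z * pt x z) = (if x \<in> X then f x else (0::'r::comm_ring_1))"
proof -
  have "(\<Sum>z\<in>X. f z * pt x z) = (\<Sum>z\<in>X. if z = x then f z else 0)"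
    by (rule sum.cong) (auto simp: pt_def)
  then show ?thesis using assms by simp
qed

lemma entry_mat:
  assumes "finite X"
  shows "entry (mat X K) y x = (if y \<in> X \<and> x \<in> X then K y x else (0::'r::comm_ring_1))"
  using assms by (simp add: entry_def mat_def sum_pt)

lemma mat_eqD:
  assumes "mat X K = mat X K'" "finite X" "y \<in> X" "x \<in> X"
  shows "K y x = K' y x"
  using arg_cong[OF assms(1), of "\<lambda>s. entry s y x"] assms(2-) by (simp add: entry_mat)

lemma mat_add: "mat X K + mat X K' = mat X (\<lambda>y x. K y x + K' y x)"
  by (auto simp: mat_def fun_eq_iff algebra_simps sum.distrib)

lemma mat_scale: "mscale c (mat X K) = mat X (\<lambda>y x. c * K y x)"
  by (auto simp: mat_def mscale_def vscale_def fun_eq_iff sum_distrib_left algebra_simps)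

lemma mat_zero: "mat X (\<lambda>y x. 0) = 0"
  by (auto simp: mat_def fun_eq_iff)

lemma mat_sum: "(\<Sum>i\<in>I. mat X (K i)) = mat X (\<lambda>y x. \<Sum>i\<in>I. K i y x)"
  by (induction I rule: infinite_finite_induct) (simp_all add: mat_zero mat_add)

lemma mat_comp: "mat X K \<circ> mat X K' = mat X (\<lambda>y x. \<Sum>z\<in>X. K y z * K' z x)"
proof -
  have "(\<Sum>z\<in>X. K y z * (\<Sum>x\<in>X. K' z x * v x)) = (\<Sum>x\<in>X. (\<Sum>z\<in>X. K y z * K' z x) * v x)" for y v
    by (simp add: sum_distrib_left sum_distrib_right mult.assoc) (rule sum.swap)
  then show ?thesis by (auto simp: mat_def fun_eq_iff)
qed

lemma proj_mat:
  assumes "finite X" "Y \<subseteq> X"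
  shows "proj Y = (mat X (\<lambda>y x. if y = x \<and> y \<in> Y then 1 else 0) :: ('a \<Rightarrow> 'r::comm_ring_1) \<Rightarrow> _)"
proof -
  have "(\<Sum>x\<in>X. (if y = x \<and> y \<in> Y then 1 else 0) * v x) = (if y \<in> Y then v y else 0)"
    if "y \<in> X" for y and v :: "'a \<Rightarrow> 'r"
    using assms that by (simp add: if_distrib[of "\<lambda>c. c * _"] cong: if_cong)
  then show ?thesis using assms by (auto simp: proj_def mat_def fun_eq_iff)
qed

lemma star_mat: "finite X \<Longrightarrow> star X (mat X K) = mat X (\<lambda>y x. K x y)"
  using entry_mat[of X K] by (auto simp: star_def mat_def entry_def fun_eq_iff intro!: sum.cong)

lemma proj_comp: "proj Y \<circ> proj Z = (proj (Y \<inter> Z) :: ('a \<Rightarrow> 'r::comm_ring_1) \<Rightarrow> _)"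
  by (auto simp: proj_def fun_eq_iff)

lemma proj_mat_comp:
  assumes "Y \<subseteq> X"
  shows "proj Y \<circ> mat X K = mat X (\<lambda>y x. if y \<in> Y then K y x else 0)"
  using assms by (auto simp: proj_def mat_def fun_eq_iff)

lemma mat_proj_comp: "mat X K \<circ> proj Y = mat X (\<lambda>y x. if x \<in> Y then K y x else 0)"
  by (auto simp: proj_def mat_def fun_eq_iff intro!: sum.cong)

lemma mat_module_hom: "Modules.module_hom vscale vscale (mat X K)"
  by (simp add: module_hom_iff module_vscale)
    (auto simp: mat_def vscale_def fun_eq_iff algebra_simps sum.distrib sum_distrib_left)

section \<open>Finite symmetric group sets and their invariant matrices\<close>

locale sym_group_elements =
  fixes n :: nat
begin

abbreviation G :: "(nat \<Rightarrow> nat) set" where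
  "G \<equiv> carrier (sym_group n)"

lemmas G_inv = sym_group_inv_closed[of _ n]

lemma G_id: "id \<in> G"
  by (simp add: sym_group_carrier permutes_id)

lemma G_comp: "g \<in> G \<Longrightarrow> h \<in> G \<Longrightarrow> g \<circ> h \<in> G"
  by (simp add: sym_group_carrier permutes_compose)

lemma G_inv_o: "g \<in> G \<Longrightarrow> g \<circ> inv' g = id" "g \<in> G \<Longrightarrow> inv' g \<circ> g = id"
  by (simp_all add: sym_group_carrier permutes_inv_o)

lemma G_inv_inv: "g \<in> G \<Longrightarrow> inv' (inv' g) = g"
  by (simp add: sym_group_carrier permutes_inv_inv)

end

text \<open>An action restated through plain composition and inverse functions instead of the
  operations of a group record.\<close>

locale sym_set = sym_group_elements n for n +
  fixes X :: "'a set" and \<phi> :: "(nat \<Rightarrow> nat) \<Rightarrow> 'a \<Rightarrow> 'a"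
  assumes fin: "finite X"
    and act_in: "g \<in> G \<Longrightarrow> x \<in> X \<Longrightarrow> \<phi> g x \<in> X"
    and act_id: "x \<in> X \<Longrightarrow> \<phi> id x = x"
    and act_comp: "g \<in> G \<Longrightarrow> h \<in> G \<Longrightarrow> x \<in> X \<Longrightarrow> \<phi> (g \<circ> h) x = \<phi> g (\<phi> h x)"
begin

lemma act_inv:
  assumes "g \<in> G" "x \<in> X"
  shows "\<phi> (inv' g) (\<phi> g x) = x" "\<phi> g (\<phi> (inv' g) x) = x"
  using act_comp[of "inv' g" g x] act_comp[of g "inv' g" x] assms
  by (simp_all add: G_inv act_id G_inv_o)

lemma act_eq_iff:
  assumes "g \<in> G" "x \<in> X" "y \<in> X"
  shows "y = \<phi> g x \<longleftrightarrow> x = \<phi> (inv' g) y"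
  using act_inv(1)[OF assms(1,2)] act_inv(2)[OF assms(1,3)] by auto

lemma act_inj: "g \<in> G \<Longrightarrow> x \<in> X \<Longrightarrow> y \<in> X \<Longrightarrow> \<phi> g x = \<phi> g y \<longleftrightarrow> x = y"
  using act_inv(1) by metis

lemma act_bij: "g \<in> G \<Longrightarrow> bij_betw (\<phi> g) X X"
  using act_in act_inv G_inv by (intro bij_betwI[where g = "\<phi> (inv' g)"]) auto

definition stable :: "'a set \<Rightarrow> bool" where
  "stable Y \<longleftrightarrow> Y \<subseteq> X \<and> (\<forall>g\<in>G. \<forall>x\<in>Y. \<phi> g x \<in> Y)"

lemma stable_iff: "stable Y \<Longrightarrow> g \<in> G \<Longrightarrow> x \<in> X \<Longrightarrow> \<phi> g x \<in> Y \<longleftrightarrow> x \<in> Y"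
  using act_inv(1)[of g x] G_inv[of g] by (force simp: stable_def)

lemma stable_X: "stable X"
  using act_in by (simp add: stable_def)

definition invariant :: "('a \<Rightarrow> 'a \<Rightarrow> 'r) \<Rightarrow> bool" where
  "invariant K \<longleftrightarrow> (\<forall>g\<in>G. \<forall>x\<in>X. \<forall>y\<in>X. K (\<phi> g y) (\<phi> g x) = K y x)"

lemma invariantD: "invariant K \<Longrightarrow> g \<in> G \<Longrightarrow> x \<in> X \<Longrightarrow> y \<in> X \<Longrightarrow> K (\<phi> g y) (\<phi> g x) = K y x"
  by (simp add: invariant_def)

lemma perm_act_eq:
  assumes g: "g \<in> G"
  shows "perm_act X \<phi> g v = (\<lambda>y. if y \<in> X then v (\<phi> (inv' g) y) else (0::'r::comm_ring_1))"
proof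
  fix y
  have "perm_act X \<phi> g v y = (\<Sum>x\<in>X. if y = \<phi> g x then v x else 0)"
    by (auto simp: perm_act_def sum_fun_apply vscale_def pt_def intro!: sum.cong)
  also have "\<dots> = (if y \<in> X then v (\<phi> (inv' g) y) else 0)"
  proof (cases "y \<in> X")
    case True
    then have "(\<Sum>x\<in>X. if y = \<phi> g x then v x else 0) = (\<Sum>x\<in>X. if x = \<phi> (inv' g) y then v x else 0)"
      using act_eq_iff g by (intro sum.cong) auto
    then show ?thesis using True fin act_in G_inv[OF g] by auto
  next
    case False
    then show ?thesis using act_in[OF g] by (auto intro!: sum.neutral)
  qed
  finally show "perm_act X \<phi> g v y = (if y \<in> X then v (\<phi> (inv' g) y) else 0)" .
qed

lemma mat_in_end:
  fixes K :: "'a \<Rightarrow> 'a \<Rightarrow> 'r::comm_ring_1"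
  assumes K: "invariant K"
  shows "mat X K \<in> perm_end n X \<phi>"
  unfolding perm_end_def perm_hom_def
proof (intro CollectI conjI ballI allI)
  show "Modules.module_hom vscale vscale (mat X K)" by (rule mat_module_hom)
  show "mat X K v \<in> perm_mod X" for v by (simp add: mat_def perm_mod_def)
  show "mat X K v = mat X K (proj X v)" for v by (auto simp: mat_def proj_def intro!: sum.cong)
  fix g and v :: "'a \<Rightarrow> 'r" assume g: "g \<in> G"
  have g': "inv' g \<in> G" using g by (rule G_inv)
  have "(\<Sum>x\<in>X. K y x * v (\<phi> (inv' g) x)) = (\<Sum>x\<in>X. K (\<phi> (inv' g) y) x * v x)" if "y \<in> X" for y
  proof -
    have "(\<Sum>x\<in>X. K (\<phi> (inv' g) y) x * v x) = (\<Sum>x\<in>X. K (\<phi> (inv' g) y) (\<phi> (inv' g) x) * v (\<phi> (inv' g) x))"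
      by (rule sum.reindex_bij_betw[OF act_bij[OF g'], symmetric])
    then show ?thesis using that invariantD[OF K g'] by simp
  qed
  then show "mat X K (perm_act X \<phi> g v) = perm_act X \<phi> g (mat X K v)"
    using act_in[OF g'] by (auto simp: perm_act_eq[OF g] mat_def fun_eq_iff)
qed

text \<open>The convention that maps ignore values outside \<open>X\<close> makes the matrix
  determine the map on all functions; equivariance, read on basis vectors, is invariance of the
  entries.\<close>

lemma end_mat:
  fixes s :: "('a \<Rightarrow> 'r::comm_ring_1) \<Rightarrow> 'a \<Rightarrow> 'r"
  assumes s: "s \<in> perm_end n X \<phi>"
  shows "s = mat X (entry s)" "invariant (entry s)"
proof -
  interpret s: Modules.module_hom vscale vscale s using s by (simp add: perm_end_def perm_hom_def)
  have sX: "s v \<in> perm_mod X" "s v = s (proj X v)" for v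
    using s by (auto simp: perm_end_def perm_hom_def)
  have sg: "s (perm_act X \<phi> g v) = perm_act X \<phi> g (s v)" if "g \<in> G" "v \<in> perm_mod X" for g v
    using s that by (auto simp: perm_end_def perm_hom_def)
  show "s = mat X (entry s)"
  proof (intro ext)
    fix v :: "'a \<Rightarrow> 'r" and y
    have "proj X v = (\<Sum>x\<in>X. vscale (v x) (pt x))"
    proof
      fix z
      have "(\<Sum>x\<in>X. vscale (v x) (pt x)) z = (\<Sum>x\<in>X. if x = z then v x else 0)"
        by (auto simp: sum_fun_apply vscale_def pt_def intro!: sum.cong)
      then show "proj X v z = (\<Sum>x\<in>X. vscale (v x) (pt x)) z" using fin by (simp add: proj_def)
    qed
    then have "s v = (\<Sum>x\<in>X. vscale (v x) (s (pt x)))"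
      using sX(2)[of v] by (simp add: s.sum s.scale)
    then show "s v y = mat X (entry s) v y"
      using sX(1)[of v] by (auto simp: mat_def entry_def perm_mod_def sum_fun_apply vscale_def mult.commute)
  qed
  show "invariant (entry s)"
    unfolding invariant_def
  proof (intro ballI)
    fix g x y assume g: "g \<in> G" and xy: "x \<in> X" "y \<in> X"
    have "perm_act X \<phi> g (pt x) = (pt (\<phi> g x) :: 'a \<Rightarrow> 'r)"
    proof
      fix z
      have "z \<in> X \<Longrightarrow> \<phi> (inv' g) z = x \<longleftrightarrow> z = \<phi> g x" using act_eq_iff[OF g] xy by metis
      then show "perm_act X \<phi> g (pt x) z = (pt (\<phi> g x) :: 'a \<Rightarrow> 'r) z"
        using xy act_in[OF g] by (auto simp: perm_act_eq[OF g] pt_def)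
    qed
    then have "s (pt (\<phi> g x)) = perm_act X \<phi> g (s (pt x))"
      using sg[OF g, of "pt x"] xy by (auto simp: perm_mod_def pt_def)
    then show "entry s (\<phi> g y) (\<phi> g x) = entry s y x"
      using xy by (simp add: entry_def perm_act_eq[OF g] act_in[OF g] act_inv[OF g])
  qed
qed

lemma end_cases:
  assumes "s \<in> perm_end n X \<phi>"
  obtains K where "invariant K" "s = mat X K"
  by (rule that[OF end_mat(2)[OF assms] end_mat(1)[OF assms]])

lemma invariant_add: "invariant K \<Longrightarrow> invariant K' \<Longrightarrow> invariant (\<lambda>y x. K y x + K' y x)"
  and invariant_diff: "invariant K \<Longrightarrow> invariant K' \<Longrightarrow> invariant (\<lambda>y x. K y x - K' y x)"
  and invariant_scale: "invariant K \<Longrightarrow> invariant (\<lambda>y x. c * K y x)"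
  and invariant_zero: "invariant (\<lambda>y x. 0)"
  and invariant_transpose: "invariant K \<Longrightarrow> invariant (\<lambda>y x. K x y)"
  for K K' :: "'a \<Rightarrow> 'a \<Rightarrow> 'r::comm_ring_1"
  by (auto simp: invariant_def)

lemma invariant_comp:
  fixes K K' :: "'a \<Rightarrow> 'a \<Rightarrow> 'r::comm_ring_1"
  assumes "invariant K" "invariant K'"
  shows "invariant (\<lambda>y x. \<Sum>z\<in>X. K y z * K' z x)"
  unfolding invariant_def
proof (intro ballI)
  fix g x y assume g: "g \<in> G" and xy: "x \<in> X" "y \<in> X"
  have "(\<Sum>z\<in>X. K (\<phi> g y) z * K' z (\<phi> g x)) = (\<Sum>z\<in>X. K (\<phi> g y) (\<phi> g z) * K' (\<phi> g z) (\<phi> g x))"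
    by (rule sum.reindex_bij_betw[OF act_bij[OF g], symmetric])
  also have "\<dots> = (\<Sum>z\<in>X. K y z * K' z x)"
    using assms g xy by (auto simp: invariant_def intro!: sum.cong)
  finally show "(\<Sum>z\<in>X. K (\<phi> g y) z * K' z (\<phi> g x)) = (\<Sum>z\<in>X. K y z * K' z x)" .
qed

lemma invariant_proj: "stable Y \<Longrightarrow> invariant (\<lambda>y x. if y = x \<and> y \<in> Y then 1 else 0)"
  by (auto simp: invariant_def act_inj stable_iff)

lemma proj_in_end: "stable Y \<Longrightarrow> proj Y \<in> perm_end n X \<phi>"
  using mat_in_end[OF invariant_proj, of Y] by (simp add: proj_mat[OF fin] stable_def)

lemma star_proj: "Y \<subseteq> X \<Longrightarrow> star X (proj Y) = proj Y"
  by (auto simp: proj_mat[OF fin] star_mat[OF fin] intro!: mat_cong)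

lemma star_algebra_end:
  "star_algebra mscale (perm_end n X \<phi> :: (('a \<Rightarrow> int) \<Rightarrow> _) set) (\<circ>) (proj X) (star X)"
proof -
  interpret m: Modules.module "mscale :: int \<Rightarrow> (('a \<Rightarrow> int) \<Rightarrow> 'a \<Rightarrow> int) \<Rightarrow> _"
    by (rule module_mscale)
  have add: "s + s' \<in> perm_end n X \<phi>"
    if "s \<in> perm_end n X \<phi>" "s' \<in> perm_end n X \<phi>" for s s' :: "('a \<Rightarrow> int) \<Rightarrow> _"
    using that by (auto elim!: end_cases simp: mat_add intro!: mat_in_end invariant_add)
  have zero: "(0 :: ('a \<Rightarrow> int) \<Rightarrow> _) \<in> perm_end n X \<phi>"
    using mat_in_end[OF invariant_zero] by (simp add: mat_zero)
  have scale: "mscale c s \<in> perm_end n X \<phi>" if "s \<in> perm_end n X \<phi>" for c and s :: "('a \<Rightarrow> int) \<Rightarrow> _"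
    using that by (auto elim!: end_cases simp: mat_scale intro!: mat_in_end invariant_scale)
  have K: "\<exists>K. s = mat X K" if "s \<in> perm_end n X \<phi>" for s :: "('a \<Rightarrow> int) \<Rightarrow> _"
    using that by (auto elim!: end_cases)
  show ?thesis
  proof
    show "m.subspace (perm_end n X \<phi>)" using add zero scale by (simp add: m.subspace_def)
    show "proj X \<in> perm_end n X \<phi>" by (rule proj_in_end[OF stable_X])
    show "s \<circ> s' \<in> perm_end n X \<phi>"
      if "s \<in> perm_end n X \<phi>" "s' \<in> perm_end n X \<phi>" for s s' :: "('a \<Rightarrow> int) \<Rightarrow> _"
      using that by (auto elim!: end_cases simp: mat_comp intro!: mat_in_end invariant_comp)
    fix a b c :: "('a \<Rightarrow> int) \<Rightarrow> 'a \<Rightarrow> int" and k :: int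
    assume a: "a \<in> perm_end n X \<phi>"
    show "proj X \<circ> a = a" "a \<circ> proj X = a"
      using K[OF a] by (auto simp: proj_mat_comp mat_proj_comp intro!: mat_cong)
    show "star X a \<in> perm_end n X \<phi>"
      using a by (auto elim!: end_cases simp: star_mat fin intro!: mat_in_end invariant_transpose)
    show "star X (mscale k a) = mscale k (star X a)" "star X (star X a) = a"
      using K[OF a] by (auto simp: star_mat fin mat_scale)
    \<comment> \<open>The diagonal entry at \<open>x\<close> is the sum of squares of column
      \<open>x\<close>; over the integers it vanishes only if the column does.\<close>
    show "a = 0" if z: "star X a \<circ> a = 0"
    proof -
      obtain K where K: "a = mat X K" using K[OF a] by blast
      have "mat X (\<lambda>y x. \<Sum>z\<in>X. K z y * K z x) = mat X (\<lambda>y x. 0)"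
        using z by (simp add: K star_mat fin mat_comp mat_zero)
      then have "(\<Sum>z\<in>X. K z x * K z x) = 0" if "x \<in> X" for x
        using mat_eqD fin that by fastforce
      then have "K z x = 0" if "x \<in> X" "z \<in> X" for x z
        using that fin by (subst (asm) sum_nonneg_eq_0_iff) auto
      then have "mat X K = mat X (\<lambda>y x. 0)" by (intro mat_cong) auto
      then show "a = 0" by (simp add: K mat_zero)
    qed
    assume b: "b \<in> perm_end n X \<phi>"
    show "mscale k a \<circ> b = mscale k (a \<circ> b)" "a \<circ> mscale k b = mscale k (a \<circ> b)"
      using K[OF a] K[OF b] by (auto simp: mat_scale mat_comp sum_distrib_left algebra_simps)
    show "star X (a + b) = star X a + star X b" "star X (a \<circ> b) = star X b \<circ> star X a"
      using K[OF a] K[OF b] by (auto simp: star_mat fin mat_add mat_comp mult.commute)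
    assume c: "c \<in> perm_end n X \<phi>"
    show "a \<circ> b \<circ> c = a \<circ> (b \<circ> c)" by (rule comp_assoc)
    show "(a + b) \<circ> c = (a \<circ> c) + (b \<circ> c)" "a \<circ> (b + c) = (a \<circ> b) + (a \<circ> c)"
      using K[OF a] K[OF b] K[OF c] by (auto simp: mat_add mat_comp sum.distrib distrib_left distrib_right)
  next
    \<comment> \<open>The range \<open>{..?k}\<close> has one index more than there are matrix
      entries.\<close>
    let ?k = "card (X \<times> X)"
    have "\<exists>c. (\<exists>i\<le>?k. c i \<noteq> 0) \<and> (\<Sum>i\<le>?k. mscale (c i) (f i)) = 0"
      if f: "\<forall>i. f i \<in> perm_end n X \<phi>" for f :: "nat \<Rightarrow> ('a \<Rightarrow> int) \<Rightarrow> 'a \<Rightarrow> int"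
    proof -
      have "\<forall>i. \<exists>K. f i = mat X K" by (intro allI K f[rule_format])
      then obtain K where K: "\<And>i. f i = mat X (K i)" by metis
      obtain c where c: "\<exists>i\<in>{..?k}. c i \<noteq> 0"
        and "\<forall>p\<in>X \<times> X. (\<Sum>i\<in>{..?k}. c i * K i (fst p) (snd p)) = 0"
        using integer_relation[of "X \<times> X" "{..?k}" "\<lambda>i p. K i (fst p) (snd p)"] fin by auto
      then have "mat X (\<lambda>y x. \<Sum>i\<le>?k. c i * K i y x) = mat X (\<lambda>y x. 0)"
        by (intro mat_cong) force
      then have "(\<Sum>i\<le>?k. mscale (c i) (f i)) = mat X (\<lambda>y x. 0)"
        by (simp only: K mat_scale mat_sum)
      with c show ?thesis by (auto simp: mat_zero)
    qed
    then show "\<exists>k::nat. \<forall>f. (\<forall>i. f i \<in> perm_end n X \<phi>) \<longrightarrow>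
        (\<exists>c. (\<exists>i\<le>k. c i \<noteq> 0) \<and> (\<Sum>i\<le>k. mscale (c i) (f i)) = (0 :: ('a \<Rightarrow> int) \<Rightarrow> _))"
      by blast
  qed
qed

end

section \<open>Compositions and dominance\<close>

definition part :: "nat list \<Rightarrow> nat \<Rightarrow> nat" where
  "part l i = (if i < length l then l ! i else 0)"

lemma sum_list_take_part: "sum_list (take a l) = (\<Sum>k<a. part l k)"
proof (induction a)
  case (Suc a)
  then show ?case by (cases "a < length l") (simp_all add: take_Suc_conv_app_nth part_def)
qed simp

lemma Par_antimono:
  assumes "l \<in> Par n"
  shows "antimono (part l)"
proof (rule antimonoI)
  fix i j :: nat assume "i \<le> j"
  then show "part l j \<le> part l i"
    using assms sorted_wrt_nth_less[of "(\<ge>)" l i j] by (cases "i = j") (auto simp: Par_def part_def)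
qed

text \<open>Remove the largest index: it is at least \<open>card A - 1\<close>, so its value is at
  most that of the last term on the right.\<close>

lemma antimono_sum_le:
  fixes f :: "nat \<Rightarrow> nat"
  assumes f: "antimono f" and "finite A"
  shows "sum f A \<le> (\<Sum>k<card A. f k)"
  using assms(2)
proof (induction A rule: finite_psubset_induct)
  case (psubset A)
  show ?case
  proof (cases "A = {}")
    case False
    let ?m = "Max A"
    have m: "?m \<in> A" using psubset.hyps False by simp
    then obtain k where k: "card A = Suc k"
      using psubset.hyps by (metis card_Suc_Diff1)
    have "A \<subseteq> {..?m}" using psubset.hyps by auto
    then have "card A \<le> Suc ?m" using card_mono[of "{..?m}" A] by simp
    then have "f ?m \<le> f k" using k f by (auto dest: antimonoD)
    moreover have "card (A - {?m}) = k" using k m by simp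
    moreover have "sum f (A - {?m}) \<le> (\<Sum>k<card (A - {?m}). f k)"
      using m by (intro psubset.IH) blast
    ultimately show ?thesis using sum.remove[OF psubset.hyps m, of f] k by simp
  qed simp
qed

lemma sorted_trailing_zeros:
  fixes ys :: "nat list"
  assumes "sorted_wrt (\<ge>) ys"
  shows "\<exists>z. ys = filter (\<lambda>k. k \<noteq> 0) ys @ replicate z 0"
  using assms
proof (induction ys)
  case (Cons y ys)
  then obtain z where z: "ys = filter (\<lambda>k. k \<noteq> 0) ys @ replicate z 0" by auto
  show ?case
  proof (cases "y = 0")
    case True
    then have "\<forall>k\<in>set (y # ys). k = 0" using Cons.prems by auto
    then have "y # ys = replicate (length (y # ys)) 0" by (metis replicate_length_same)
    moreover have "filter (\<lambda>k. k \<noteq> 0) (y # ys) = []" using \<open>\<forall>k\<in>set (y # ys). k = 0\<close> by auto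
    ultimately show ?thesis by (metis append_Nil)
  next
    case False
    then show ?thesis using z by (intro exI[of _ z]) simp
  qed
qed simp

text \<open>\<open>\<pi>\<close> sends each index to its position in the sorted list. It is a
  bijection of all naturals, identity from \<open>L\<close> on, so that it can rename letters
  globally.\<close>

lemma sort_composition:
  fixes c :: "nat \<Rightarrow> nat"
  assumes "\<And>i. i \<ge> L \<Longrightarrow> c i = 0" and "(\<Sum>i<L. c i) = n"
  shows "\<exists>m\<in>Par n. \<exists>\<pi>. bij \<pi> \<and> (\<forall>i. c i = part m (\<pi> i))"
proof -
  let ?xs = "map c [0..<L]"
  let ?ys = "rev (sort ?xs)"
  let ?m = "filter (\<lambda>k. k \<noteq> 0) ?ys"
  have sorted: "sorted_wrt (\<ge>) ?ys" by (simp add: sorted_wrt_rev)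
  then obtain z where z: "?ys = ?m @ replicate z 0" using sorted_trailing_zeros by blast
  have "mset ?xs = mset ?ys" by simp
  then obtain p where p: "p permutes {..<length ?ys}" "permute_list p ?ys = ?xs"
    by (rule mset_eq_permutation)
  have "sum_list ?m = sum_list ?ys" using arg_cong[OF z, of sum_list] by (simp add: sum_list_replicate)
  also have "\<dots> = sum_list ?xs" by (metis \<open>mset ?xs = mset ?ys\<close> sum_mset_sum_list)
  also have "\<dots> = n" using assms(2) by (simp add: interv_sum_list_conv_sum_set_nat atLeast0LessThan)
  finally have m: "?m \<in> Par n" using sorted by (auto simp: Par_def sorted_wrt_filter)
  have part: "part ?m k = (if k < L then ?ys ! k else 0)" for k
  proof -
    have "length ?ys = L" by simp
    then have L: "L = length ?m + z" by (subst (asm) z) simp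
    have "?ys ! k = (?m @ replicate z 0) ! k" using z by (rule arg_cong)
    then show ?thesis using L by (auto simp: part_def nth_append)
  qed
  have "c i = part ?m (p i)" for i
  proof (cases "i < L")
    case True
    then have "p i < L" using permutes_in_image[OF p(1), of i] by simp
    moreover have "?xs ! i = ?ys ! p i"
      using permute_list_nth[OF p(1), of i] p(2) True by simp
    ultimately show ?thesis unfolding part using True by simp
  next
    case False
    then have "p i = i" using permutes_not_in[OF p(1), of i] by simp
    then show ?thesis unfolding part using False assms(1) by simp
  qed
  then show ?thesis using m permutes_bij[OF p(1)] by blast
qed

lemma part_length: "i \<ge> length l \<Longrightarrow> part l i = 0"
  by (simp add: part_def)

lemma part_sum: "l \<in> Par n \<Longrightarrow> (\<Sum>k<length l. part l k) = n"
  using sum_list_take_part[of "length l" l] by (simp add: Par_def)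

text \<open>Moving \<open>t\<close> boxes up from row \<open>i\<close> to row \<open>j\<close> does
  not lower any partial sum and raises the one ending at row \<open>j\<close>. Sorting can only
  increase partial sums further, so the sorted partition strictly dominates
  \<open>l\<close>.\<close>

lemma dominance_raise:
  assumes l: "l \<in> Par n" and ij: "j < i" and t: "0 < t" "t \<le> part l i"
  obtains m \<pi> where "m \<in> Par n" "bij \<pi>"
    "\<And>k. ((part l)(i := part l i - t, j := part l j + t)) k = part m (\<pi> k)"
    "dominated n l m" "m \<noteq> l"
proof -
  let ?c = "(part l)(i := part l i - t, j := part l j + t)"
  \<comment> \<open>Both corrections are added, one on each side, to avoid truncated
    subtraction.\<close>
  have raise: "(\<Sum>k<a. ?c k) + (if i < a then t else 0) = (\<Sum>k<a. part l k) + (if j < a then t else 0)" for a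
    using ij t(2) by (induction a) (auto simp: less_Suc_eq split: if_splits)
  have i: "i < length l" using t by (auto simp: part_def split: if_splits)
  have zero: "?c k = 0" if "k \<ge> length l" for k
    using that i ij by (simp add: part_length)
  have "(\<Sum>k<length l. ?c k) = n"
    using raise[of "length l"] i ij part_sum[OF l] by simp
  from sort_composition[OF zero this]
  obtain m \<pi> where m: "m \<in> Par n" and \<pi>: "bij \<pi>" "\<And>k. ?c k = part m (\<pi> k)"
    by blast
  have le: "(\<Sum>k<a. ?c k) \<le> sum_list (take a m)" for a
  proof -
    have inj: "inj_on \<pi> {..<a}" using \<pi>(1) by (meson bij_is_inj inj_on_subset subset_UNIV)
    have "(\<Sum>k<a. ?c k) = sum (part m) (\<pi> ` {..<a})"
      unfolding sum.reindex[OF inj] using \<pi>(2) by simp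
    also have "\<dots> \<le> (\<Sum>k<card (\<pi> ` {..<a}). part m k)"
      by (rule antimono_sum_le[OF Par_antimono[OF m]]) simp
    finally show ?thesis using inj by (simp add: card_image sum_list_take_part)
  qed
  have "dominated n l m"
    unfolding dominated_def
  proof
    fix a
    have "sum_list (take a l) \<le> (\<Sum>k<a. ?c k)"
      using raise[of a] ij by (auto simp: sum_list_take_part split: if_splits)
    then show "sum_list (take a l) \<le> sum_list (take a m)" using le[of a] by simp
  qed
  moreover have "sum_list (take (Suc j) l) < sum_list (take (Suc j) m)"
    using raise[of "Suc j"] le[of "Suc j"] ij t by (simp add: sum_list_take_part)
  then have "m \<noteq> l" by auto
  ultimately show thesis using that[OF m \<pi>(1)] \<pi>(2) by simp
qed

lemma finite_Par: "finite (Par n)"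
proof -
  have "length l \<le> sum_list l" if "0 \<notin> set l" for l :: "nat list"
    using that by (induction l) auto
  then have "Par n \<subseteq> {l. set l \<subseteq> {..n} \<and> length l \<le> n}"
    by (auto simp: Par_def member_le_sum_list)
  then show ?thesis by (rule finite_subset) (simp add: finite_lists_length_le)
qed

text \<open>The standard word of content \<open>l\<close>: each place carries the number of its
  block, counted from 0. The value off \<open>{1..n}\<close> matches the convention for
  words.\<close>

definition base :: "nat \<Rightarrow> nat list \<Rightarrow> nat \<Rightarrow> nat" where
  "base n l x = (if x \<in> {1..n} then LEAST i. x \<le> sum_list (take (Suc i) l) else 0)"

lemma base_iff:
  assumes l: "l \<in> Par n" and x: "x \<in> {1..n}"
  shows "base n l x = i \<longleftrightarrow> x \<in> block l i"
proof
  let ?P = "\<lambda>i. x \<le> sum_list (take (Suc i) l)"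
  have "?P (length l)" using l x by (simp add: Par_def)
  then have P: "?P (base n l x)" using x LeastI[of ?P] by (simp only: base_def if_True)
  assume i: "base n l x = i"
  have "sum_list (take i l) < x"
  proof (cases i)
    case 0
    then show ?thesis using x by simp
  next
    case (Suc k)
    then show ?thesis using i x not_less_Least[of k ?P] by (auto simp: base_def)
  qed
  then show "x \<in> block l i" using P i by (simp add: block_def)
next
  assume "x \<in> block l i"
  then have i: "sum_list (take i l) < x" "x \<le> sum_list (take (Suc i) l)" by (auto simp: block_def)
  have "i \<le> k" if "x \<le> sum_list (take (Suc k) l)" for k
  proof (rule ccontr)
    assume "\<not> i \<le> k"
    then have "sum_list (take (Suc k) l) \<le> sum_list (take i l)"
      by (auto simp only: sum_list_take_part intro!: sum_mono2)
    then show False using that i by simp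
  qed
  then have "(LEAST k. x \<le> sum_list (take (Suc k) l)) = i" using i by (intro Least_equality)
  then show "base n l x = i" using x by (simp add: base_def)
qed

lemma block_subset: "l \<in> Par n \<Longrightarrow> block l i \<subseteq> {1..n}"
proof -
  assume l: "l \<in> Par n"
  have "sum_list (take (Suc i) l) \<le> sum_list (take (Suc i) l) + sum_list (drop (Suc i) l)" by simp
  also have "\<dots> = n" using l by (metis (mono_tags, lifting) Par_def append_take_drop_id mem_Collect_eq sum_list_append)
  finally show ?thesis by (auto simp: block_def)
qed

lemma base_fiber: "l \<in> Par n \<Longrightarrow> {x \<in> {1..n}. base n l x = i} = block l i"
  using base_iff block_subset by blast

lemma card_block: "card (block l i) = part l i"
  by (simp add: block_def sum_list_take_part)

text \<open>As the stabiliser of a word, the Young subgroup lets its cosets be read as words. An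
  injective map of a finite block into itself is onto, which gives the equality of sets in the
  definition.\<close>

lemma young_subgroup_base:
  assumes l: "l \<in> Par n"
  shows "young_subgroup n l = {g \<in> carrier (sym_group n). base n l \<circ> g = base n l}"
proof (intro equalityI subsetI CollectI conjI)
  fix g assume g: "g \<in> young_subgroup n l"
  then show G: "g \<in> carrier (sym_group n)" by (simp add: young_subgroup_def)
  show "base n l \<circ> g = base n l"
  proof
    fix x
    show "(base n l \<circ> g) x = base n l x"
    proof (cases "x \<in> {1..n}")
      case True
      let ?i = "base n l x"
      have x: "x \<in> block l ?i" using base_iff[OF l True, of ?i] by (simp only: refl)
      then have "?i < length l" using part_length[of l ?i] card_block[of l ?i]
        by (metis block_def card_0_eq empty_iff finite_atLeastAtMost not_less)
      then have "g x \<in> block l ?i" using g x by (auto simp: young_subgroup_def)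
      moreover from this have "g x \<in> {1..n}" using block_subset[OF l] by blast
      ultimately show ?thesis using base_iff[OF l, of "g x" ?i] by simp
    next
      case False
      then show ?thesis using G permutes_not_in[of g "{1..n}" x] by (simp add: sym_group_carrier)
    qed
  qed
next
  fix g assume "g \<in> {g \<in> carrier (sym_group n). base n l \<circ> g = base n l}"
  then have G: "g permutes {1..n}" and b: "base n l \<circ> g = base n l" by (auto simp: sym_group_carrier)
  have "g ` block l i = block l i" for i
  proof (rule endo_inj_surj)
    show "finite (block l i)" by (simp add: block_def)
    show "g ` block l i \<subseteq> block l i"
    proof
      fix y assume "y \<in> g ` block l i"
      then obtain x where x: "x \<in> block l i" "y = g x" by blast
      then have xn: "x \<in> {1..n}" using block_subset[OF l] by blast
      then have "y \<in> {1..n}" using permutes_in_image[OF G] x by simp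
      then show "y \<in> block l i"
        using base_iff[OF l xn, of i] base_iff[OF l, of y i] x fun_cong[OF b, of x] by simp
    qed
    show "inj_on g (block l i)" using permutes_inj[OF G] by (rule inj_on_subset) simp
  qed
  then show "g \<in> young_subgroup n l" using G by (simp add: young_subgroup_def sym_group_carrier)
qed

section \<open>Orbits as sets of words\<close>

definition places :: "nat \<Rightarrow> nat set" where
  "places n = {1..n}"

text \<open>The words vanish off \<open>{1..n}\<close> so that equality of functions is equality of words.\<close>

definition words :: "nat \<Rightarrow> (nat \<Rightarrow> nat) \<Rightarrow> (nat \<Rightarrow> nat) set" where
  "words n c = {w. (\<forall>p. p \<notin> places n \<longrightarrow> w p = 0) \<and> (\<forall>k. card {p \<in> places n. w p = k} = c k)}"

lemma finite_places [simp]: "finite (places n)"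
  by (simp add: places_def)

lemma words_card: "w \<in> words n c \<Longrightarrow> card {p \<in> places n. w p = k} = c k"
  by (simp add: words_def)

lemma words_eqI:
  assumes "w \<in> words n c" "w' \<in> words n c'" "\<And>p. p \<in> places n \<Longrightarrow> w p = w' p"
  shows "w = w'"
proof
  fix p show "w p = w' p" using assms by (cases "p \<in> places n") (auto simp: words_def)
qed

lemma sym_group_places: "g \<in> carrier (sym_group n) \<longleftrightarrow> g permutes places n"
  by (simp add: sym_group_carrier places_def)

lemma base_in_words: "l \<in> Par n \<Longrightarrow> base n l \<in> words n (part l)"
  using base_fiber[of l n] card_block[of l] by (auto simp: words_def places_def base_def)

lemma words_comp:
  assumes w: "w \<in> words n c" and "g \<in> carrier (sym_group n)"
  shows "w \<circ> g \<in> words n c"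
proof -
  have g: "g permutes places n" using assms(2) by (simp add: sym_group_places)
  have "bij_betw g {p \<in> places n. w (g p) = k} {p \<in> places n. w p = k}" for k
  proof (rule bij_betwI')
    fix p q show "g p = g q \<longleftrightarrow> p = q" using permutes_inj[OF g] by (auto dest: injD)
  next
    fix q assume "q \<in> {p \<in> places n. w p = k}"
    then have "inv' g q \<in> {p \<in> places n. w (g p) = k}" "q = g (inv' g q)"
      using permutes_in_image[OF permutes_inv[OF g]] permutes_inverses(1)[OF g] by auto
    then show "\<exists>p\<in>{p \<in> places n. w (g p) = k}. q = g p" by blast
  qed (use permutes_in_image[OF g] in auto)
  from bij_betw_same_card[OF this] show ?thesis
    using w permutes_not_in[OF g] by (simp add: words_def)
qed

text \<open>Equal fibre sizes mean equal multisets of values. The value type is arbitrary because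
  straightening applies this to triples as well as to words.\<close>

lemma same_fibers_conjugate:
  assumes "\<And>k. card {p \<in> places n. f p = k} = card {p \<in> places n. f' p = k}"
  obtains g where "g \<in> carrier (sym_group n)" "\<And>p. p \<in> places n \<Longrightarrow> f p = f' (g p)"
proof -
  have "image_mset f (mset_set (places n)) = image_mset f' (mset_set (places n))"
  proof (rule multiset_eqI)
    fix k
    have "count (image_mset h (mset_set (places n))) k = card {p \<in> places n. h p = k}" for h :: "nat \<Rightarrow> 'a"
      by (auto simp: count_image_mset' intro!: arg_cong[of _ _ card])
    then show "count (image_mset f (mset_set (places n))) k = count (image_mset f' (mset_set (places n))) k"
      using assms by simp
  qed
  then obtain g where "g permutes places n" "\<forall>p\<in>places n. f p = f' (g p)"
    by (rule image_mset_eq_implies_permutes[OF finite_places])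
  then show thesis using that by (simp add: sym_group_places)
qed

text \<open>Read forwards it gives the content of a modified word; read backwards it recovers the
  number of modified places from the two contents.\<close>

lemma card_fiber_change:
  assumes D: "D \<subseteq> places n" "\<And>p. p \<in> D \<Longrightarrow> w p = i \<and> u p = j"
    and eq: "\<And>p. p \<in> places n \<Longrightarrow> p \<notin> D \<Longrightarrow> u p = w p" and ij: "i \<noteq> j"
  shows "card {p \<in> places n. u p = k} = ((\<lambda>k. card {p \<in> places n. w p = k})
    (i := card {p \<in> places n. w p = i} - card D, j := card {p \<in> places n. w p = j} + card D)) k"
proof -
  have fin: "finite D" using D(1) finite_places by (rule finite_subset)
  have u: "u p = (if p \<in> D then j else w p)" if "p \<in> places n" for p
    using D(2) eq that by simp
  have w: "w p = i" "p \<in> places n" if "p \<in> D" for p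
    using D that by auto
  have "{p \<in> places n. u p = j} = {p \<in> places n. w p = j} \<union> D" "{p \<in> places n. w p = j} \<inter> D = {}"
    "{p \<in> places n. u p = i} = {p \<in> places n. w p = i} - D" "D \<subseteq> {p \<in> places n. w p = i}"
    using u w ij by (auto split: if_splits)
  moreover have "{p \<in> places n. u p = k} = {p \<in> places n. w p = k}" if "k \<noteq> i" "k \<noteq> j"
    using u w that by (auto split: if_splits)
  ultimately show ?thesis using fin by (simp add: card_Un_disjoint card_Diff_subset)
qed

context sym_set
begin

text \<open>The content \<open>c\<close> need not be decreasing: one orbit then carries coordinates
  for every rearrangement of its parts, in particular for a raised content before sorting.\<close>

definition coord :: "'a set \<Rightarrow> (nat \<Rightarrow> nat) \<Rightarrow> ('a \<Rightarrow> nat \<Rightarrow> nat) \<Rightarrow> bool" where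
  "coord Q c u \<longleftrightarrow> Q \<subseteq> X \<and> bij_betw u Q (words n c) \<and>
    (\<forall>g\<in>G. \<forall>q\<in>Q. \<phi> g q \<in> Q \<and> u (\<phi> g q) = u q \<circ> inv' g)"

lemma coordD:
  assumes "coord Q c u"
  shows "Q \<subseteq> X" "\<And>q. q \<in> Q \<Longrightarrow> u q \<in> words n c"
    "\<And>g q. g \<in> G \<Longrightarrow> q \<in> Q \<Longrightarrow> \<phi> g q \<in> Q"
    "\<And>g q. g \<in> G \<Longrightarrow> q \<in> Q \<Longrightarrow> u (\<phi> g q) = u q \<circ> inv' g"
    "\<And>q q'. q \<in> Q \<Longrightarrow> q' \<in> Q \<Longrightarrow> u q = u q' \<Longrightarrow> q = q'"
    "\<And>w. w \<in> words n c \<Longrightarrow> \<exists>q\<in>Q. u q = w"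
proof -
  have "inj_on u Q" "u ` Q = words n c" using assms by (auto simp: coord_def bij_betw_def)
  then show "\<And>q. q \<in> Q \<Longrightarrow> u q \<in> words n c" "\<And>w. w \<in> words n c \<Longrightarrow> \<exists>q\<in>Q. u q = w"
    "\<And>q q'. q \<in> Q \<Longrightarrow> q' \<in> Q \<Longrightarrow> u q = u q' \<Longrightarrow> q = q'"
    by (auto dest: inj_onD) (metis imageE)
qed (use assms in \<open>auto simp: coord_def\<close>)

lemma coord_stable: "coord Q c u \<Longrightarrow> stable Q"
  by (auto simp: coord_def stable_def)

lemma coord_transitive:
  assumes Q: "coord Q c u" and q: "q \<in> Q" "q' \<in> Q"
  shows "\<exists>g\<in>G. q' = \<phi> g q"
proof -
  note w = coordD(2)[OF Q q(1)] coordD(2)[OF Q q(2)]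
  have "card {p \<in> places n. u q p = k} = card {p \<in> places n. u q' p = k}" for k
    using w by (simp add: words_card)
  then obtain g where g: "g \<in> G" "\<And>p. p \<in> places n \<Longrightarrow> u q p = u q' (g p)"
    by (rule same_fibers_conjugate) blast
  have "u q = u q' \<circ> g"
    using g w words_comp by (intro words_eqI[of _ n c _ c]) auto
  then have "u (\<phi> g q) = u q' \<circ> (g \<circ> inv' g)" using coordD(4)[OF Q g(1) q(1)] by (simp add: comp_assoc)
  then have "\<phi> g q = q'" using coordD(3,5)[OF Q] g(1) q by (simp add: G_inv_o)
  then show ?thesis using g(1) by blast
qed

lemma coord_orbit:
  assumes x: "x \<in> X" and l: "l \<in> Par n" and stab: "stabilizer (sym_group n) \<phi> x = young_subgroup n l"
  shows "\<exists>u. coord (orbit (sym_group n) \<phi> x) (part l) u"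
proof -
  let ?b = "base n l" and ?Q = "orbit (sym_group n) \<phi> x"
  have fix_iff: "\<phi> g x = x \<longleftrightarrow> ?b \<circ> g = ?b" if "g \<in> G" for g
    using stab that by (auto simp: stabilizer_def young_subgroup_base[OF l])
  have eq_iff: "\<phi> g x = \<phi> h x \<longleftrightarrow> ?b \<circ> inv' g = ?b \<circ> inv' h" if gh: "g \<in> G" "h \<in> G" for g h
  proof -
    have "\<phi> g x = \<phi> h x \<longleftrightarrow> \<phi> (inv' h) (\<phi> g x) = x"
      using act_eq_iff[OF gh(2), of x "\<phi> g x"] act_in gh x by auto
    also have "\<dots> \<longleftrightarrow> ?b \<circ> (inv' h \<circ> g) = ?b"
      using fix_iff[of "inv' h \<circ> g"] act_comp[of "inv' h" g x] gh x by (simp add: G_inv G_comp)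
    also have "\<dots> \<longleftrightarrow> ?b \<circ> inv' g = ?b \<circ> inv' h"
    proof
      assume "?b \<circ> (inv' h \<circ> g) = ?b"
      then have "?b \<circ> inv' g = ?b \<circ> (inv' h \<circ> (g \<circ> inv' g))" by (metis comp_assoc)
      then show "?b \<circ> inv' g = ?b \<circ> inv' h" using gh by (simp add: G_inv_o)
    next
      assume "?b \<circ> inv' g = ?b \<circ> inv' h"
      then have "?b \<circ> (inv' h \<circ> g) = ?b \<circ> (inv' g \<circ> g)" by (metis comp_assoc)
      then show "?b \<circ> (inv' h \<circ> g) = ?b" using gh by (simp add: G_inv_o)
    qed
    finally show ?thesis .
  qed
  \<comment> \<open>The choice of \<open>g\<close> is harmless by \<open>eq_iff\<close>: two group
    elements give the same point exactly when they give the same word.\<close>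
  define u where "u q = ?b \<circ> inv' (SOME g. g \<in> G \<and> q = \<phi> g x)" for q
  have u: "u (\<phi> g x) = ?b \<circ> inv' g" if "g \<in> G" for g
  proof -
    have "(SOME h. h \<in> G \<and> \<phi> g x = \<phi> h x) \<in> G \<and> \<phi> g x = \<phi> (SOME h. h \<in> G \<and> \<phi> g x = \<phi> h x) x"
      using that by (intro someI[of "\<lambda>h. h \<in> G \<and> \<phi> g x = \<phi> h x" g]) simp
    then have "?b \<circ> inv' g = ?b \<circ> inv' (SOME h. h \<in> G \<and> \<phi> g x = \<phi> h x)"
      using eq_iff[OF that] by blast
    then show ?thesis by (simp only: u_def)
  qed
  have "coord ?Q (part l) u"
    unfolding coord_def
  proof (intro conjI ballI)
    show "?Q \<subseteq> X" using act_in x by (auto simp: orbit_def)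
    show "bij_betw u ?Q (words n (part l))"
    proof (rule bij_betwI')
      fix q q' assume "q \<in> ?Q" "q' \<in> ?Q"
      then show "u q = u q' \<longleftrightarrow> q = q'" using u eq_iff by (auto simp: orbit_def)
    next
      fix q assume "q \<in> ?Q"
      then show "u q \<in> words n (part l)"
        using u words_comp[OF base_in_words[OF l]] G_inv by (auto simp: orbit_def)
    next
      fix w assume w: "w \<in> words n (part l)"
      have "card {p \<in> places n. w p = k} = card {p \<in> places n. ?b p = k}" for k
        using w base_in_words[OF l] by (simp add: words_card)
      then obtain g where g: "g \<in> G" "\<And>p. p \<in> places n \<Longrightarrow> w p = ?b (g p)"
        by (rule same_fibers_conjugate) blast
      have "w = ?b \<circ> g"
        using g w words_comp[OF base_in_words[OF l]] by (intro words_eqI) auto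
      then have "w = u (\<phi> (inv' g) x)" using u[of "inv' g"] g(1) by (simp add: G_inv G_inv_inv)
      then show "\<exists>q\<in>?Q. w = u q" using g(1) G_inv by (auto simp: orbit_def)
    qed
    fix g q assume g: "g \<in> G" and "q \<in> ?Q"
    then obtain h where h: "h \<in> G" "q = \<phi> h x" by (auto simp: orbit_def)
    then have gq: "\<phi> g q = \<phi> (g \<circ> h) x" using act_comp g x by simp
    then show "\<phi> g q \<in> ?Q" using G_comp g h by (auto simp: orbit_def)
    have "inv' (g \<circ> h) = inv' h \<circ> inv' g"
      using g h by (intro o_inv_distrib) (auto simp: sym_group_carrier permutes_bij)
    then show "u (\<phi> g q) = u q \<circ> inv' g"
      using u[OF G_comp[OF g h(1)]] u[OF h(1)] gq h by (simp add: comp_assoc)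
  qed
  then show ?thesis by blast
qed

text \<open>Renaming letters commutes with permuting places, so it changes the content without
  changing the orbit.\<close>

lemma coord_relabel:
  assumes Q: "coord Q c u" and \<pi>: "bij \<pi>" and c': "\<And>k. c' k = c (\<pi> k)"
  shows "\<exists>u'. coord Q c' u'"
proof -
  \<comment> \<open>Renaming is confined to the places, because \<open>f\<close> may move 0 while
    words must remain 0 elsewhere.\<close>
  define r where "r f w = (\<lambda>p. if p \<in> places n then f (w p) else 0 :: nat)" for f :: "nat \<Rightarrow> nat" and w
  have r_words: "r f w \<in> words n (\<lambda>k. c (f' k))"
    if w: "w \<in> words n c" and f: "\<And>k m. f m = k \<longleftrightarrow> m = f' k" for f f' w and c :: "nat \<Rightarrow> nat"
  proof -
    have "{p \<in> places n. r f w p = k} = {p \<in> places n. w p = f' k}" for k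
      using f by (auto simp: r_def)
    then show ?thesis using w by (simp add: words_def r_def)
  qed
  have \<pi>_iff: "inv' \<pi> m = k \<longleftrightarrow> m = \<pi> k" "\<pi> m = k \<longleftrightarrow> m = inv' \<pi> k" for m k
    using \<pi> by (metis bij_inv_eq_iff)+
  have r1: "r (inv' \<pi>) w \<in> words n c'" if "w \<in> words n c" for w
    using r_words[OF that \<pi>_iff(1)] c' by presburger
  have r2: "r \<pi> w \<in> words n c" if "w \<in> words n c'" for w
    using r_words[OF that \<pi>_iff(2)] c' \<pi> by (simp add: bij_is_surj surj_f_inv_f)
  have bij: "bij_betw (r (inv' \<pi>)) (words n c) (words n c')"
  proof (rule bij_betw_byWitness[where f' = "r \<pi>"])
    show "\<forall>w\<in>words n c. r \<pi> (r (inv' \<pi>) w) = w"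
      using \<pi> by (auto simp: r_def fun_eq_iff words_def bij_is_surj surj_f_inv_f)
    show "\<forall>w\<in>words n c'. r (inv' \<pi>) (r \<pi> w) = w"
      using \<pi> by (auto simp: r_def fun_eq_iff words_def bij_is_inj)
  qed (use r1 r2 in auto)
  have "r f (w \<circ> g) = r f w \<circ> g" if "g \<in> G" for f w g
    using that permutes_in_image[of g "places n"] by (auto simp: r_def fun_eq_iff sym_group_places)
  then have "coord Q c' (\<lambda>q. r (inv' \<pi>) (u q))"
    using Q bij_betw_trans[OF _ bij, of u Q] G_inv by (auto simp: coord_def o_def)
  then show ?thesis by blast
qed

section \<open>Orbit maps\<close>

definition orel :: "'a \<Rightarrow> 'a \<Rightarrow> ('a \<times> 'a) set" where
  "orel y x = {(\<phi> g y, \<phi> g x) | g. g \<in> G}"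

text \<open>The basis element of the integral endomorphism ring attached to the diagonal orbit of
  \<open>(y, x)\<close>.\<close>

definition omap :: "'a \<Rightarrow> 'a \<Rightarrow> ('a \<Rightarrow> int) \<Rightarrow> 'a \<Rightarrow> int" where
  "omap y x = mat X (\<lambda>y' x'. if (y', x') \<in> orel y x then 1 else 0)"

lemma orel_refl: "y \<in> X \<Longrightarrow> x \<in> X \<Longrightarrow> (y, x) \<in> orel y x"
  using act_id G_id by (force simp: orel_def)

lemma orel_act:
  assumes "y \<in> X" "x \<in> X" "g \<in> G"
  shows "orel (\<phi> g y) (\<phi> g x) = orel y x"
proof
  show "orel (\<phi> g y) (\<phi> g x) \<subseteq> orel y x"
    using assms act_comp[of _ g y] act_comp[of _ g x] G_comp[of _ g] unfolding orel_def by (smt (verit) Collect_mono)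
  have "(\<phi> h y, \<phi> h x) \<in> orel (\<phi> g y) (\<phi> g x)" if h: "h \<in> G" for h
  proof -
    have "\<phi> (h \<circ> inv' g) (\<phi> g z) = \<phi> h z" if "z \<in> X" for z
      using act_comp[of h "inv' g" "\<phi> g z"] act_in act_inv assms h that G_inv by simp
    then show ?thesis using assms h G_comp[OF h G_inv, of g] unfolding orel_def by force
  qed
  then show "orel y x \<subseteq> orel (\<phi> g y) (\<phi> g x)" by (auto simp: orel_def)
qed

lemma orel_eq: "y \<in> X \<Longrightarrow> x \<in> X \<Longrightarrow> (y', x') \<in> orel y x \<Longrightarrow> orel y' x' = orel y x"
  using orel_act by (force simp: orel_def[of y x])

lemma invariant_orel:
  assumes "y \<in> X" "x \<in> X"
  shows "invariant (\<lambda>y' x'. if (y', x') \<in> orel y x then 1 else 0)"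
proof -
  have "(\<phi> g y', \<phi> g x') \<in> orel y x \<longleftrightarrow> (y', x') \<in> orel y x" if "g \<in> G" "y' \<in> X" "x' \<in> X" for g y' x'
    using orel_eq[OF assms] orel_act that orel_refl act_in by metis
  then show ?thesis by (auto simp: invariant_def)
qed

lemma omap_in_end: "y \<in> X \<Longrightarrow> x \<in> X \<Longrightarrow> omap y x \<in> perm_end n X \<phi>"
  unfolding omap_def by (intro mat_in_end invariant_orel)

text \<open>Subtracting \<open>K y x\<close> times the orbit map of \<open>(y, x)\<close> clears one
  diagonal orbit from the support and leaves the other entries alone, so the number of nonzero
  entries drops.\<close>

lemma omap_expansion:
  fixes K :: "'a \<Rightarrow> 'a \<Rightarrow> int"
  assumes W: "module.subspace mscale W" and "invariant K"
    and "\<And>y x. y \<in> X \<Longrightarrow> x \<in> X \<Longrightarrow> K y x \<noteq> 0 \<Longrightarrow> omap y x \<in> W"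
  shows "mat X K \<in> W"
  using assms(2,3)
proof (induction "card {(y, x) \<in> X \<times> X. K y x \<noteq> 0}" arbitrary: K rule: less_induct)
  case (less K)
  note m = module.subspace_0[OF module_mscale W] module.subspace_add[OF module_mscale W]
    module.subspace_scale[OF module_mscale W]
  show ?case
  proof (cases "\<forall>y\<in>X. \<forall>x\<in>X. K y x = 0")
    case True
    then have "mat X K = mat X (\<lambda>y x. 0)" by (intro mat_cong) auto
    then show ?thesis using m by (simp add: mat_zero)
  next
    case False
    then obtain y x where yx: "y \<in> X" "x \<in> X" "K y x \<noteq> 0" by blast
    let ?I = "\<lambda>y' x'. if (y', x') \<in> orel y x then 1 else 0"
    let ?K = "\<lambda>y' x'. K y' x' - K y x * ?I y' x'"
    have on_orbit: "K y' x' = K y x" if "(y', x') \<in> orel y x" for y' x'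
      using that yx invariantD[OF less.prems(1)] by (auto simp: orel_def)
    have K0: "?K y' x' \<noteq> 0 \<Longrightarrow> K y' x' \<noteq> 0" for y' x' using on_orbit by (auto split: if_splits)
    have inv: "invariant ?K"
      by (intro invariant_diff invariant_scale invariant_orel less.prems yx)
    have "mat X ?K \<in> W"
    proof (rule less.hyps[OF _ inv])
      show "card {(y, x) \<in> X \<times> X. ?K y x \<noteq> 0} < card {(y, x) \<in> X \<times> X. K y x \<noteq> 0}"
      proof (rule psubset_card_mono)
        show "finite {(y, x) \<in> X \<times> X. K y x \<noteq> 0}"
          by (rule finite_subset[of _ "X \<times> X"]) (use fin in auto)
        have "(y, x) \<in> {(y, x) \<in> X \<times> X. K y x \<noteq> 0} - {(y, x) \<in> X \<times> X. ?K y x \<noteq> 0}"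
          using yx orel_refl by simp
        then show "{(y, x) \<in> X \<times> X. ?K y x \<noteq> 0} \<subset> {(y, x) \<in> X \<times> X. K y x \<noteq> 0}"
          using K0 by blast
      qed
      show "omap y' x' \<in> W" if "y' \<in> X" "x' \<in> X" "?K y' x' \<noteq> 0" for y' x'
        using less.prems(2)[OF that(1,2)] K0[OF that(3)] by blast
    qed
    moreover have "mat X K = mat X ?K + mscale (K y x) (omap y x)"
      unfolding omap_def mat_scale mat_add by (intro mat_cong) simp
    ultimately show ?thesis using m less.prems(2)[OF yx] by simp
  qed
qed

end

section \<open>Straightening\<close>

context sym_set
begin

context
  fixes O' P' :: "'a set" and c c\<^sub>P :: "nat \<Rightarrow> nat" and w v :: "'a \<Rightarrow> nat \<Rightarrow> nat"
    and J W :: "(('a \<Rightarrow> int) \<Rightarrow> 'a \<Rightarrow> int) set"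
  assumes cO: "coord O' c w" and cP: "coord P' c\<^sub>P v"
    and J: "\<And>i j t. j < i \<Longrightarrow> 0 < t \<Longrightarrow> t \<le> c i \<Longrightarrow>
      \<exists>Q u. coord Q (c(i := c i - t, j := c j + t)) u \<and>
        (\<forall>s\<in>perm_end n X \<phi>. \<forall>s'\<in>perm_end n X \<phi>. s \<circ> proj Q \<circ> s' \<in> J)"
    and W: "module.subspace mscale W" and JW: "J \<subseteq> W"
begin

text \<open>A truncation of the condition \<open>w \<le> v\<close> to the columns before
  \<open>k\<close>: void at \<open>k = 0\<close>, and the full pointwise inequality once
  \<open>k\<close> exceeds all letters of \<open>w\<close>.\<close>

definition upper :: "nat \<Rightarrow> 'a \<Rightarrow> 'a \<Rightarrow> bool" where
  "upper k y x \<longleftrightarrow> (\<forall>p\<in>places n. v x p < k \<longrightarrow> w y p \<le> v x p)"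

definition defect :: "nat \<Rightarrow> 'a \<Rightarrow> 'a \<Rightarrow> nat" where
  "defect j y x = card {p \<in> places n. v x p = j \<and> w y p > j}"

lemma W_diff: "a \<in> W \<Longrightarrow> b \<in> W \<Longrightarrow> a - b \<in> W"
  using module.subspace_diff[OF module_mscale W] .

text \<open>In a pair of words \<open>(w, v)\<close>, change to \<open>j\<close> the letters of \<open>w\<close> equal to some \<open>i > j\<close> at the \<open>t\<close> places
  where \<open>v\<close> has the letter \<open>j\<close>.  The orbit map of \<open>(w, v)\<close> is the leading term, with coefficient 1, of a
  composite through the orbit of the new word, whose content is higher in the dominance order; all other
  terms have smaller defect at \<open>j\<close>, and the columns before \<open>j\<close> are not disturbed.\<close>

lemma straighten_column:
  assumes next_column: "\<And>y x. y \<in> O' \<Longrightarrow> x \<in> P' \<Longrightarrow> upper (Suc j) y x \<Longrightarrow> omap y x \<in> W"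
    and "y \<in> O'" "x \<in> P'" "upper j y x"
  shows "omap y x \<in> W"
  using assms(2-)
proof (induction "defect j y x" arbitrary: y rule: less_induct)
  case less
  note y = \<open>y \<in> O'\<close> and x = \<open>x \<in> P'\<close> and upper = \<open>upper j y x\<close>
  have yX: "y \<in> X" and xX: "x \<in> X" using y x coordD(1)[OF cO] coordD(1)[OF cP] by auto
  show ?case
  proof (cases "\<exists>p\<in>places n. v x p = j \<and> w y p > j")
    case False
    then have "upper (Suc j) y x" using upper by (force simp: upper_def less_Suc_eq)
    then show ?thesis using next_column y x by blast
  next
    case True
    then obtain p0 where p0: "p0 \<in> places n" "v x p0 = j" "w y p0 > j" by blast
    \<comment> \<open>\<open>D\<close> takes every place of column \<open>j\<close> with the bad
      letter \<open>i\<close>; this maximality is what makes the leading coefficient 1 in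
      \<open>unique\<close>.\<close>
    define i where "i = w y p0"
    define D where "D = {p \<in> places n. v x p = j \<and> w y p = i}"
    define t where "t = card D"
    have ij: "j < i" using p0 by (simp add: i_def)
    have Dsub: "D \<subseteq> places n" by (auto simp: D_def)
    have finD: "finite D" using finite_subset[OF Dsub finite_places] .
    have t0: "0 < t" using p0 finD by (auto simp: t_def card_gt_0_iff D_def i_def)
    have cw: "card {p \<in> places n. w y p = k} = c k" for k
      using words_card[OF coordD(2)[OF cO y]] .
    have ti: "t \<le> c i" unfolding t_def cw[symmetric] by (intro card_mono) (auto simp: D_def)
    let ?c = "c(i := c i - t, j := c j + t)"
    obtain Q u where Q: "coord Q ?c u"
      and QJ: "\<And>s s'. s \<in> perm_end n X \<phi> \<Longrightarrow> s' \<in> perm_end n X \<phi> \<Longrightarrow> s \<circ> proj Q \<circ> s' \<in> J"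
      using J[OF ij t0 ti] by blast
    define u0 where "u0 p = (if p \<in> D then j else w y p)" for p
    have "card {p \<in> places n. u0 p = k} = ((\<lambda>k. card {p \<in> places n. w y p = k})
        (i := card {p \<in> places n. w y p = i} - card D, j := card {p \<in> places n. w y p = j} + card D)) k" for k
      by (rule card_fiber_change[OF Dsub]) (use ij in \<open>auto simp: u0_def D_def\<close>)
    then have "card {p \<in> places n. u0 p = k} = ?c k" for k
      by (simp only: cw t_def)
    moreover have "u0 p = 0" if "p \<notin> places n" for p
      using that coordD(2)[OF cO y] by (auto simp: u0_def words_def D_def)
    ultimately have "u0 \<in> words n ?c" by (simp add: words_def)
    then obtain q where q: "q \<in> Q" "u q = u0" using coordD(6)[OF Q] by blast
    have qX: "q \<in> X" using q coordD(1)[OF Q] by blast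
    \<comment> \<open>\<open>r\<close> arises from \<open>z\<close> by changing some letters
      \<open>i\<close> to \<open>j\<close>. The contents of the two orbits force exactly
      \<open>t\<close> changes.\<close>
    define E where "E z r \<longleftrightarrow> z \<in> O' \<and> r \<in> Q \<and> (\<forall>p\<in>places n. w z p \<noteq> u r p \<longrightarrow> w z p = i \<and> u r p = j)"
      for z r
    have E_card: "card {p \<in> places n. w z p \<noteq> u r p} = t" if "E z r" for z r
    proof -
      let ?D = "{p \<in> places n. w z p \<noteq> u r p}"
      have zr: "z \<in> O'" "r \<in> Q" using that by (auto simp: E_def)
      have "card {p \<in> places n. u r p = j} = ((\<lambda>k. card {p \<in> places n. w z p = k})
        (i := card {p \<in> places n. w z p = i} - card ?D, j := card {p \<in> places n. w z p = j} + card ?D)) j"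
        by (rule card_fiber_change) (use that ij in \<open>auto simp: E_def\<close>)
      then show ?thesis
        using words_card[OF coordD(2)[OF cO zr(1)]] words_card[OF coordD(2)[OF Q zr(2)]] by simp
    qed
    have E_act: "E (\<phi> g z) (\<phi> g r)" if g: "g \<in> G" and "E z r" for g z r
    proof -
      have "inv' g p \<in> places n" if "p \<in> places n" for p
        using that G_inv[OF g] permutes_in_image by (fastforce simp: sym_group_places)
      then show ?thesis
        using \<open>E z r\<close> coordD(3,4)[OF cO g] coordD(3,4)[OF Q g] by (auto simp: E_def)
    qed
    have E_iff: "E (\<phi> g z) (\<phi> g r) \<longleftrightarrow> E z r" if g: "g \<in> G" and "z \<in> X" "r \<in> X" for g z r
      using E_act[OF g, of z r] E_act[OF G_inv[OF g], of "\<phi> g z" "\<phi> g r"] that by (auto simp: act_inv)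
    have Eyq: "E y q" using y q by (auto simp: E_def u0_def D_def)
    \<comment> \<open>A word \<open>u z\<close> conjugate to \<open>u0\<close> over
      \<open>v x\<close> has no letter \<open>i\<close> in column \<open>j\<close>, so it must
      differ from \<open>w y\<close> on all of \<open>D\<close>; having only \<open>t\<close>
      changes, it differs nowhere else.\<close>
    have unique: "z = q" if z: "E y z" "(z, x) \<in> orel q x" for z
    proof -
      obtain g where g: "g \<in> G" "z = \<phi> g q" "x = \<phi> g x" using z(2) by (auto simp: orel_def)
      have gp: "inv' g p \<in> places n" if "p \<in> places n" for p
        using that G_inv[OF g(1)] permutes_in_image by (fastforce simp: sym_group_places)
      have uz: "u z p = u0 (inv' g p)" "v x p = v x (inv' g p)" for p
        using coordD(4)[OF Q g(1) q(1)] coordD(4)[OF cP g(1) x] g q by (simp_all add: fun_eq_iff)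
      have "u z p \<noteq> i" if "p \<in> D" for p
        using that gp[of p] uz[of p] ij by (auto simp: u0_def D_def)
      then have "D \<subseteq> {p \<in> places n. w y p \<noteq> u z p}" by (force simp: D_def)
      then have D_eq: "D = {p \<in> places n. w y p \<noteq> u z p}"
        using E_card[OF z(1)] by (intro card_subset_eq) (auto simp: t_def)
      have zQ: "z \<in> Q" using z by (simp add: E_def)
      have "u z = u q"
      proof (rule words_eqI[OF coordD(2)[OF Q zQ] coordD(2)[OF Q q(1)]])
        fix p assume p: "p \<in> places n"
        show "u z p = u q p"
        proof (cases "p \<in> D")
          case True
          then show ?thesis using z(1) p D_eq q(2) by (auto simp: E_def u0_def)
        next
          case False
          then show ?thesis using p D_eq q(2) by (auto simp: u0_def)
        qed
      qed
      then show ?thesis using coordD(5)[OF Q zQ q(1)] by blast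
    qed
    \<comment> \<open>Going back from \<open>u0\<close>, \<open>t\<close> letters \<open>j\<close>
      become \<open>i\<close>. The defect reaches its old value only if all of these lie in column
      \<open>j\<close>, and then the pair is conjugate to the original one.\<close>
    have smaller: "omap z x \<in> W \<or> (z, x) \<in> orel y x" if z: "E z q" for z
    proof -
      have zO: "z \<in> O'" using z by (simp add: E_def)
      let ?D = "{p \<in> places n. w z p \<noteq> u0 p}"
      have D': "w z p = i" "u0 p = j" if "p \<in> ?D" for p using z that q by (auto simp: E_def)
      have cD: "card ?D = t" using E_card[OF z] q by simp
      have same: "w z p = w y p" if "p \<in> places n" "v x p < j" for p
        using D'[of p] that upper ij by (force simp: upper_def u0_def D_def)
      then have up: "upper j z x" using upper by (simp add: upper_def)
      let ?B = "{p \<in> places n. v x p = j \<and> u0 p > j}"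
      have "{p \<in> places n. v x p = j \<and> w y p > j} = ?B \<union> D" "?B \<inter> D = {}"
        using ij by (auto simp: u0_def D_def)
      then have def_y: "defect j y x = card ?B + t"
        using finD by (simp add: defect_def t_def card_Un_disjoint)
      have "w z p > j \<longleftrightarrow> u0 p > j \<or> w z p \<noteq> u0 p" "\<not> (u0 p > j \<and> w z p \<noteq> u0 p)"
        if "p \<in> places n" for p
      proof -
        have "w z p = u0 p \<or> (w z p = i \<and> u0 p = j)" using D'[of p] that by blast
        then show "w z p > j \<longleftrightarrow> u0 p > j \<or> w z p \<noteq> u0 p" "\<not> (u0 p > j \<and> w z p \<noteq> u0 p)"
          using ij by linarith+
      qed
      then have "{p \<in> places n. v x p = j \<and> w z p > j} = ?B \<union> {p \<in> ?D. v x p = j}"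
        "?B \<inter> {p \<in> ?D. v x p = j} = {}"
        by blast+
      then have def_z: "defect j z x = card ?B + card {p \<in> ?D. v x p = j}"
        by (simp add: defect_def card_Un_disjoint)
      have le: "card {p \<in> ?D. v x p = j} \<le> t" unfolding cD[symmetric] by (intro card_mono) auto
      show ?thesis
      proof (cases "card {p \<in> ?D. v x p = j} = t")
        case False
        then have "omap z x \<in> W" using le def_y def_z zO x up by (intro less.hyps) auto
        then show ?thesis ..
      next
        case True
        then have "{p \<in> ?D. v x p = j} = ?D" using cD by (intro card_subset_eq) auto
        then have vD: "v x p = j" if "p \<in> ?D" for p using that by blast
        \<comment> \<open>Both \<open>D\<close> and \<open>?D\<close> are sets of \<open>t\<close>
          places at which \<open>u0\<close> and \<open>v x\<close> equal \<open>j\<close>, so the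
          joint fibre counts cannot tell them apart.\<close>
        have fiber: "card {p \<in> places n. (u0 p, v x p, p \<in> A) = (a, b, \<tau>)}
            = (if \<tau> then if a = j \<and> b = j then t else 0
               else card {p \<in> places n. u0 p = a \<and> v x p = b} - (if a = j \<and> b = j then t else 0))"
          if A: "A \<subseteq> places n" "\<forall>p\<in>A. u0 p = j \<and> v x p = j" "card A = t" for A a b \<tau>
        proof -
          have finA: "finite A" using finite_subset[OF A(1) finite_places] .
          have "{p \<in> places n. (u0 p, v x p, p \<in> A) = (a, b, \<tau>)}
              = (if \<tau> then if a = j \<and> b = j then A else {}
                 else {p \<in> places n. u0 p = a \<and> v x p = b} - (if a = j \<and> b = j then A else {}))"
            by (cases \<tau>) (use A(1,2) in \<open>auto split: if_splits\<close>)
          moreover have "A \<subseteq> {p \<in> places n. u0 p = j \<and> v x p = j}" using A by blast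
          ultimately show ?thesis using finA A(3) by (simp add: card_Diff_subset)
        qed
                have D0: "\<forall>p\<in>D. u0 p = j \<and> v x p = j" by (simp add: u0_def D_def)
        have D1: "\<forall>p\<in>?D. u0 p = j \<and> v x p = j" using D'(2) vD by blast
        have D1sub: "?D \<subseteq> places n" by blast
        have "card {p \<in> places n. (u0 p, v x p, p \<in> D) = k} = card {p \<in> places n. (u0 p, v x p, p \<in> ?D) = k}" for k
        proof -
          obtain a b \<tau> where k: "k = (a, b, \<tau>)" by (metis prod_cases3)
          show ?thesis
            unfolding k by (rule trans[OF fiber[OF Dsub D0 t_def[symmetric]] fiber[OF D1sub D1 cD, symmetric]])
        qed
        \<comment> \<open>Preserving \<open>u0\<close> and \<open>v x\<close> while carrying
          \<open>D\<close> to \<open>?D\<close>, this permutation fixes \<open>x\<close> and sends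
          \<open>y\<close> to \<open>z\<close>.\<close>
        then obtain g where g: "g \<in> G"
          and "\<And>p. p \<in> places n \<Longrightarrow> (u0 p, v x p, p \<in> D) = (u0 (g p), v x (g p), g p \<in> ?D)"
          by (rule same_fibers_conjugate) blast
        then have gp: "u0 p = u0 (g p)" "v x p = v x (g p)" "p \<in> D \<longleftrightarrow> g p \<in> ?D" if "p \<in> places n" for p
          using that by blast+
        have gpl: "g p \<in> places n" if "p \<in> places n" for p
          using that g permutes_in_image by (fastforce simp: sym_group_places)
        have "w z \<circ> g = w y"
        proof (rule words_eqI[OF words_comp[OF coordD(2)[OF cO zO] g] coordD(2)[OF cO y]])
          fix p assume p: "p \<in> places n"
          show "(w z \<circ> g) p = w y p"
          proof (cases "p \<in> D")
            case True
            then show ?thesis using D'(1) gp(3)[OF p] by (simp add: D_def)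
          next
            case False
            then have "w z (g p) = u0 (g p)" using gp(3)[OF p] gpl[OF p] by blast
            then show ?thesis using gp(1)[OF p] False by (simp add: u0_def)
          qed
        qed
        then have "w (\<phi> g y) = w z \<circ> (g \<circ> inv' g)"
          using coordD(4)[OF cO g y] by (metis comp_assoc)
        then have gy: "\<phi> g y = z" using coordD(3,5)[OF cO] g y zO by (simp add: G_inv_o)
        have "v x = v x \<circ> g"
          by (rule words_eqI[OF coordD(2)[OF cP x] words_comp[OF coordD(2)[OF cP x] g]]) (use gp in simp)
        then have "v (\<phi> g x) = v x \<circ> (g \<circ> inv' g)"
          using coordD(4)[OF cP g x] by (metis comp_assoc)
        then have gx: "\<phi> g x = x" using coordD(3,5)[OF cP] g x by (simp add: G_inv_o)
        from gy gx g have "(z, x) \<in> orel y x" by (force simp: orel_def)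
        then show ?thesis ..
      qed
    qed
    \<comment> \<open>The relation \<open>E\<close> is itself an endomorphism through
      \<open>Q\<close>; composing it with the orbit map of \<open>(q, x)\<close> gives the element
      of \<open>J\<close> whose leading term is the orbit map of \<open>(y, x)\<close>.\<close>
    let ?E = "\<lambda>z r. if E z r then 1 else 0 :: int"
    let ?T = "\<lambda>r x'. if (r, x') \<in> orel q x then 1 else 0 :: int"
    let ?K = "\<lambda>z x'. \<Sum>r\<in>X. ?E z r * ?T r x'"
    have invE: "invariant ?E" using E_iff by (simp add: invariant_def)
    have invK: "invariant ?K" by (intro invariant_comp invE invariant_orel qX xX)
    have "mat X ?E \<circ> proj Q = mat X ?E"
      unfolding mat_proj_comp by (intro mat_cong) (auto simp: E_def)
    then have "mat X ?K = mat X ?E \<circ> proj Q \<circ> omap q x"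
      by (simp add: omap_def mat_comp)
    also have "\<dots> \<in> J" by (intro QJ mat_in_end invE omap_in_end qX xX)
    finally have KW: "mat X ?K \<in> W" using JW by blast
    have Kyx: "?K y x = 1"
    proof -
      have "?K y x = (\<Sum>r\<in>X. if r = q then 1 else 0)"
        using unique Eyq orel_refl[OF qX xX] by (intro sum.cong) auto
      then show ?thesis using fin qX by simp
    qed
    let ?R = "\<lambda>z x'. ?K z x' - (if (z, x') \<in> orel y x then 1 else 0)"
    have invR: "invariant ?R" by (intro invariant_diff invK invariant_orel yX xX)
    have "mat X ?R \<in> W"
    proof (rule omap_expansion[OF W invR])
      fix z x' assume z: "z \<in> X" "x' \<in> X" "?R z x' \<noteq> 0"
      have "(z, x') \<notin> orel y x"
      proof
        assume "(z, x') \<in> orel y x"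
        then obtain g where g: "g \<in> G" "z = \<phi> g y" "x' = \<phi> g x" by (auto simp: orel_def)
        have "?R z x' = ?R y x" unfolding g(2,3) by (rule invariantD[OF invR g(1) xX yX])
        then show False using z(3) Kyx orel_refl[OF yX xX] by simp
      qed
      then have "?K z x' \<noteq> 0" using z(3) by simp
      then obtain r where "r \<in> X" "?E z r * ?T r x' \<noteq> 0"
        by (rule sum.not_neutral_contains_not_neutral)
      then have r: "r \<in> X" "E z r" "(r, x') \<in> orel q x" by (auto split: if_splits)
      then obtain g where g: "g \<in> G" "r = \<phi> g q" "x' = \<phi> g x" by (auto simp: orel_def)
      let ?z = "\<phi> (inv' g) z"
      have zX: "?z \<in> X" using act_in G_inv g z by simp
      have zg: "\<phi> g ?z = z" using act_inv g z by simp
      have "E ?z q" using r(2) E_iff[OF g(1) zX qX] by (simp only: zg g(2))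
      moreover have orel_z: "orel z x' = orel ?z x" using orel_act[OF zX xX g(1)] by (simp only: zg g(3))
      moreover have "(?z, x) \<notin> orel y x"
        using \<open>(z, x') \<notin> orel y x\<close> orel_z orel_eq[OF yX xX, of ?z x]
          orel_refl[OF z(1,2)] by blast
      ultimately show "omap z x' \<in> W" using smaller[of ?z] by (simp add: omap_def)
    qed
    then have "mat X ?K - mat X ?R \<in> W" using KW W_diff by blast
    moreover have "mat X ?K = mat X ?R + omap y x"
      unfolding omap_def mat_add by (intro mat_cong) simp
    ultimately show ?thesis by simp
  qed
qed

text \<open>Columns are removed from the hypothesis \<open>upper\<close> one by one, from
  \<open>L\<close> down to 0. \<open>W\<close> may exceed \<open>J\<close>: it is used both as the
  ideal itself and as the ideal enlarged by the multiples of an idempotent.\<close>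

lemma straighten:
  assumes L: "\<And>k. k \<ge> L \<Longrightarrow> c k = 0"
    and base: "\<And>y x. y \<in> O' \<Longrightarrow> x \<in> P' \<Longrightarrow> (\<forall>p\<in>places n. w y p \<le> v x p) \<Longrightarrow> omap y x \<in> W"
    and s: "s \<in> perm_end n X \<phi>"
  shows "proj O' \<circ> s \<circ> proj P' \<in> W"
proof -
  have "omap y x \<in> W" if "k \<le> L" "y \<in> O'" "x \<in> P'" "upper k y x" for k y x
    using that
  proof (induction arbitrary: y x rule: inc_induct)
    case base
    have "w y p \<le> v x p" if p: "p \<in> places n" for p
    proof (cases "v x p < L")
      case True
      then show ?thesis using base.prems p by (simp add: upper_def)
    next
      case False
      have "0 < card {p' \<in> places n. w y p' = w y p}" using p by (auto simp: card_gt_0_iff)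
      then have "c (w y p) \<noteq> 0"
        using words_card[OF coordD(2)[OF cO base.prems(1)], of "w y p"] by simp
      then have "w y p < L" using L[of "w y p"] by (meson not_less)
      then show ?thesis using False by simp
    qed
    then show ?case using assms(2) base.prems by blast
  next
    case (step k)
    show ?case by (rule straighten_column[OF _ step.prems]) (use step.IH in blast)
  qed
  from this[of 0] have all: "omap y x \<in> W" if "y \<in> O'" "x \<in> P'" for y x
    using that by (simp add: upper_def)
  obtain K where K: "invariant K" "s = mat X K" using s by (rule end_cases)
  have eq: "proj O' \<circ> s \<circ> proj P' = mat X (\<lambda>y x. if x \<in> P' then if y \<in> O' then K y x else 0 else 0)"
    unfolding K(2) proj_mat_comp[OF coordD(1)[OF cO]] mat_proj_comp ..
  show ?thesis
    unfolding eq
  proof (rule omap_expansion[OF W])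
    show "invariant (\<lambda>y x. if x \<in> P' then if y \<in> O' then K y x else 0 else 0)"
      using K(1) stable_iff[OF coord_stable[OF cO]] stable_iff[OF coord_stable[OF cP]]
      by (simp add: invariant_def)
  qed (use all in \<open>auto split: if_splits\<close>)
qed

end

end

section \<open>The cell datum of a Young set\<close>

lemma proj_mat_proj:
  assumes "Y \<subseteq> X" "finite X"
  shows "proj Y \<circ> mat X K \<circ> proj Y = mat Y K"
proof -
  have row: "(\<Sum>x\<in>X. (if x \<in> Y then if y \<in> Y then K y x else 0 else 0) * v x) = (\<Sum>x\<in>Y. K y x * v x)"
    if "y \<in> Y" for y v
    using assms that by (intro sum.mono_neutral_cong_right) auto
  have "mat X (\<lambda>y x. if x \<in> Y then if y \<in> Y then K y x else 0 else 0) v y = mat Y K v y" for v y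
  proof (cases "y \<in> Y")
    case True
    then show ?thesis using row assms(1) by (auto simp: mat_def)
  next
    case False
    then show ?thesis by (auto simp: mat_def intro!: sum.neutral)
  qed
  then show ?thesis unfolding proj_mat_comp[OF assms(1)] mat_proj_comp by blast
qed

lemma young_set_sym_set:
  assumes "young_set n X \<phi>"
  shows "sym_set n X \<phi>"
proof -
  interpret group_action "sym_group n" X \<phi> using assms by (simp add: young_set_def)
  show ?thesis
  proof
    show "finite X" using assms by (simp add: young_set_def)
    show "\<phi> id x = x" if "x \<in> X" for x
      using that fun_cong[OF id_eq_one, of x] by (simp add: sym_group_one)
    show "\<phi> g x \<in> X" if "g \<in> carrier (sym_group n)" "x \<in> X" for g x
      using element_image[OF that refl] .
    show "\<phi> (g \<circ> h) x = \<phi> g (\<phi> h x)"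
      if "g \<in> carrier (sym_group n)" "h \<in> carrier (sym_group n)" "x \<in> X" for g h x
      using composition_rule[OF that(3,1,2)] by (simp add: sym_group_mult)
  qed
qed

context sym_set
begin

lemma orbit_member:
  assumes "Q \<in> orbits (sym_group n) X \<phi>" "x \<in> Q"
  shows "x \<in> X" "Q = orbit (sym_group n) \<phi> x"
proof -
  obtain z where z: "z \<in> X" "Q = orbit (sym_group n) \<phi> z" using assms(1) by (auto simp: orbits_def)
  then obtain g where g: "g \<in> G" "x = \<phi> g z" using assms(2) by (auto simp: orbit_def)
  show "x \<in> X" using act_in g z by simp
  have 1: "\<phi> h z = \<phi> (h \<circ> inv' g) x" if "h \<in> G" for h
    using that g z act_comp[of h "inv' g" x] act_inv act_in G_inv by simp
  have 2: "\<phi> h x = \<phi> (h \<circ> g) z" if "h \<in> G" for h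
    using that g z act_comp by simp
  show "Q = orbit (sym_group n) \<phi> x"
  proof (intro equalityI subsetI)
    fix q assume "q \<in> Q"
    then obtain h where "h \<in> G" "q = \<phi> h z" using z(2) by (auto simp: orbit_def)
    then show "q \<in> orbit (sym_group n) \<phi> x"
      using 1[of h] G_comp[OF _ G_inv[OF g(1)], of h] by (auto simp: orbit_def)
  next
    fix q assume "q \<in> orbit (sym_group n) \<phi> x"
    then obtain h where "h \<in> G" "q = \<phi> h x" by (auto simp: orbit_def)
    then show "q \<in> Q" using 2[of h] G_comp[OF _ g(1), of h] z(2) by (auto simp: orbit_def)
  qed
qed

text \<open>A Young set controls stabilisers up to conjugacy, whereas the support asks for exact
  Young subgroups; translating the point bridges the two.\<close>

lemma young_stabilizer_conjugate:
  assumes x: "x \<in> X" and g: "g \<in> G"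
    and stab: "stabilizer (sym_group n) \<phi> x
      = g <#\<^bsub>sym_group n\<^esub> H #>\<^bsub>sym_group n\<^esub> (inv\<^bsub>sym_group n\<^esub> g)"
    and H: "H \<subseteq> G"
  shows "stabilizer (sym_group n) \<phi> (\<phi> (inv' g) x) = H"
proof -
  have g': "inv' g \<in> G" using g by (rule G_inv)
  interpret group "sym_group n" by (rule sym_group_is_group)
  have "inv\<^bsub>sym_group n\<^esub> g = inv' g"
    using g g' by (intro inv_equality) (simp_all add: sym_group_mult sym_group_one G_inv_o)
  then have stab: "stabilizer (sym_group n) \<phi> x = {g \<circ> h \<circ> inv' g | h. h \<in> H}"
    unfolding stab by (auto simp: l_coset_def r_coset_def sym_group_mult)
  have iff: "\<phi> h (\<phi> (inv' g) x) = \<phi> (inv' g) x \<longleftrightarrow> g \<circ> h \<circ> inv' g \<in> stabilizer (sym_group n) \<phi> x"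
    if h: "h \<in> G" for h
  proof -
    have "\<phi> (g \<circ> h \<circ> inv' g) x = \<phi> g (\<phi> h (\<phi> (inv' g) x))"
      using act_comp[of "g \<circ> h" "inv' g" x] act_comp[of g h "\<phi> (inv' g) x"] g g' h x G_comp act_in by simp
    moreover have "x = \<phi> g (\<phi> h (\<phi> (inv' g) x)) \<longleftrightarrow> \<phi> h (\<phi> (inv' g) x) = \<phi> (inv' g) x"
      using act_eq_iff[OF g, of "\<phi> h (\<phi> (inv' g) x)" x] act_in g' h x by simp
    ultimately show ?thesis using g h g' G_comp by (auto simp: stabilizer_def)
  qed
  have cancel: "h = h'" if "g \<circ> h \<circ> inv' g = g \<circ> h' \<circ> inv' g" for h h'
  proof -
    have "inv' g \<circ> (g \<circ> h \<circ> inv' g) \<circ> g = inv' g \<circ> (g \<circ> h' \<circ> inv' g) \<circ> g" using that by simp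
    then have "(inv' g \<circ> g) \<circ> h \<circ> (inv' g \<circ> g) = (inv' g \<circ> g) \<circ> h' \<circ> (inv' g \<circ> g)"
      by (simp only: comp_assoc)
    then show ?thesis using g by (simp add: G_inv_o)
  qed
  show ?thesis
  proof (intro equalityI subsetI)
    fix h assume "h \<in> stabilizer (sym_group n) \<phi> (\<phi> (inv' g) x)"
    then have "h \<in> G" "\<phi> h (\<phi> (inv' g) x) = \<phi> (inv' g) x" by (auto simp: stabilizer_def)
    then obtain h' where h': "h' \<in> H" "g \<circ> h \<circ> inv' g = g \<circ> h' \<circ> inv' g" using iff stab by auto
    from cancel[OF h'(2)] h'(1) show "h \<in> H" by simp
  next
    fix h assume "h \<in> H"
    then show "h \<in> stabilizer (sym_group n) \<phi> (\<phi> (inv' g) x)"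
      using iff[of h] H stab by (simp add: stabilizer_def) blast
  qed
qed

text \<open>With equal stabilisers, \<open>\<phi> g y \<mapsto> \<phi> g z\<close> is an isomorphism
  of orbits. Each nonzero entry of the composite therefore comes from a single intermediate point,
  and no multiplicity appears.\<close>

lemma omap_factor:
  assumes X: "y \<in> X" "z \<in> X" "x \<in> X" and stab: "\<And>g. g \<in> G \<Longrightarrow> \<phi> g y = y \<longleftrightarrow> \<phi> g z = z"
    and Q: "stable Q" "z \<in> Q"
  shows "omap y x = omap y z \<circ> proj Q \<circ> omap z x"
proof -
  let ?I = "\<lambda>y x y' x'. if (y', x') \<in> orel y x then 1 else 0 :: int"
  have same: "\<phi> g y = \<phi> h y \<longleftrightarrow> \<phi> g z = \<phi> h z" if gh: "g \<in> G" "h \<in> G" for g h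
  proof -
    have "\<phi> g r = \<phi> h r \<longleftrightarrow> \<phi> (inv' h \<circ> g) r = r" if "r \<in> X" for r
      using act_eq_iff[OF gh(2) that, of "\<phi> g r"] act_comp[of "inv' h" g r] act_in gh that G_inv by auto
    then show ?thesis using stab[of "inv' h \<circ> g"] X gh G_comp G_inv by simp
  qed
  have Qz: "r \<in> Q" if "(y', r) \<in> orel y z" for y' r
    using that Q by (auto simp: orel_def stable_def)
  have "omap y z \<circ> proj Q = omap y z"
    unfolding omap_def mat_proj_comp using Qz by (intro mat_cong) auto
  moreover have "(\<Sum>r\<in>X. ?I y z y' r * ?I z x r x') = ?I y x y' x'" for y' x'
  proof (cases "\<exists>g\<in>G. y' = \<phi> g y")
    case True
    then obtain g where g: "g \<in> G" "y' = \<phi> g y" by blast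
    have r: "(y', r) \<in> orel y z \<longleftrightarrow> r = \<phi> g z" for r
      using same g by (auto simp: orel_def)
    have "(\<phi> g z, x') \<in> orel z x \<longleftrightarrow> (y', x') \<in> orel y x"
      using same g by (auto simp: orel_def)
    moreover have "(\<Sum>r\<in>X. ?I y z y' r * ?I z x r x') = (\<Sum>r\<in>X. if r = \<phi> g z then ?I z x r x' else 0)"
      using r by (intro sum.cong) auto
    ultimately show ?thesis using fin act_in[OF g(1) X(2)] by simp
  next
    case False
    then have "(y', r) \<notin> orel y z" "(y', x') \<notin> orel y x" for r by (auto simp: orel_def)
    then show ?thesis by simp
  qed
  ultimately show ?thesis by (simp add: omap_def mat_comp)
qed

end

lemma words_card_less:
  assumes "w \<in> words n c"
  shows "card {p \<in> places n. w p < a} = (\<Sum>i<a. c i)"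
proof -
  have "{p \<in> places n. w p < a} = (\<Union>i<a. {p \<in> places n. w p = i})" by auto
  then have "card {p \<in> places n. w p < a} = (\<Sum>i<a. card {p \<in> places n. w p = i})"
    by (simp only:) (rule card_UN_disjoint, auto)
  then show ?thesis using assms by (simp add: words_card)
qed

text \<open>Where \<open>v\<close> has a letter below \<open>a\<close>, so has \<open>w\<close>; the
  two counts are the partial sums of \<open>m\<close> and \<open>l\<close>.\<close>

lemma pointwise_le_dominated:
  assumes "w \<in> words n (part l)" "v \<in> words n (part m)" "\<forall>p\<in>places n. w p \<le> v p"
  shows "dominated n m l"
  unfolding dominated_def
proof
  fix a
  have "card {p \<in> places n. v p < a} \<le> card {p \<in> places n. w p < a}"
    using assms(3) by (intro card_mono) (auto intro: le_less_trans)
  then show "sum_list (take a m) \<le> sum_list (take a l)"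
    using assms(1,2) by (simp add: words_card_less sum_list_take_part)
qed

text \<open>With equal contents these nested sets have the same size, hence coincide for every
  bound.\<close>

lemma pointwise_le_equal:
  assumes w: "w \<in> words n c" and v: "v \<in> words n c" and le: "\<forall>p\<in>places n. w p \<le> v p"
  shows "w = v"
proof (rule words_eqI[OF w v])
  fix p assume p: "p \<in> places n"
  have "{q \<in> places n. v q < Suc (w p)} \<subseteq> {q \<in> places n. w q < Suc (w p)}"
    using le by (auto intro: le_less_trans)
  then have "{q \<in> places n. v q < Suc (w p)} = {q \<in> places n. w q < Suc (w p)}"
    by (intro card_subset_eq) (simp_all only: words_card_less[OF w] words_card_less[OF v], simp)
  then have "v p < Suc (w p)" using p by blast
  then show "w p = v p" using le p by (simp add: le_antisym)
qed

locale cell_setting = sym_set n \<Omega> \<phi>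
  for n and \<Omega> :: "'a set" and \<phi> +
  fixes \<Gamma> :: "'a set" and \<gamma> :: "(nat \<Rightarrow> nat) \<Rightarrow> 'a \<Rightarrow> 'a"
    and ord :: "(nat list \<times> nat list) set" and orb :: "nat list \<Rightarrow> 'a set"
    and d :: "nat list \<Rightarrow> nat \<Rightarrow> ('a \<Rightarrow> int) \<Rightarrow> 'a \<Rightarrow> int"
  assumes young_\<Gamma>: "young_set n \<Gamma> \<gamma>" and cosaturated: "cosaturated n \<Omega> \<phi>"
    and sub: "\<Gamma> \<subseteq> \<Omega>" and agree: "\<forall>g\<in>carrier (sym_group n). \<forall>x\<in>\<Gamma>. \<phi> g x = \<gamma> g x"
    and order: "partial_order_on (supp n \<Omega> \<phi>) ord"
    and refines: "\<forall>l\<in>supp n \<Omega> \<phi>. \<forall>m\<in>supp n \<Omega> \<phi>. dominated n l m \<longrightarrow> (l, m) \<in> ord"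
    and orb: "chosen_orbits n \<Omega> \<phi> orb"
    and lifts: "\<forall>l\<in>supp_up n \<Gamma> \<gamma>. chosen_lifts n \<Omega> \<phi> \<Gamma> orb ord l (d l)"
begin

abbreviation S :: "(('a \<Rightarrow> int) \<Rightarrow> 'a \<Rightarrow> int) set" where
  "S \<equiv> perm_end n \<Omega> \<phi>"

interpretation g: sym_set n \<Gamma> \<gamma>
  by (rule young_set_sym_set[OF young_\<Gamma>])

lemma stable_\<Gamma>: "stable \<Gamma>"
  using sub agree g.act_in by (auto simp: stable_def)

lemma perm_end_\<Gamma>: "(perm_end n \<Gamma> \<gamma> :: (('a \<Rightarrow> int) \<Rightarrow> 'a \<Rightarrow> int) set) = {proj \<Gamma> \<circ> s \<circ> proj \<Gamma> | s. s \<in> S}"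
proof (intro equalityI subsetI)
  fix s :: "('a \<Rightarrow> int) \<Rightarrow> 'a \<Rightarrow> int" assume "s \<in> perm_end n \<Gamma> \<gamma>"
  then obtain K where K: "g.invariant K" "s = mat \<Gamma> K" by (rule g.end_cases)
  let ?K = "\<lambda>y x. if y \<in> \<Gamma> \<and> x \<in> \<Gamma> then K y x else 0"
  have "invariant ?K"
    using K(1) agree stable_iff[OF stable_\<Gamma>] by (auto simp: invariant_def g.invariant_def)
  moreover have "s = proj \<Gamma> \<circ> mat \<Omega> ?K \<circ> proj \<Gamma>"
    unfolding proj_mat_proj[OF sub fin] K(2) by (intro mat_cong) auto
  ultimately show "s \<in> {proj \<Gamma> \<circ> s \<circ> proj \<Gamma> | s. s \<in> S}" using mat_in_end by blast
next
  fix s :: "('a \<Rightarrow> int) \<Rightarrow> 'a \<Rightarrow> int" assume "s \<in> {proj \<Gamma> \<circ> s \<circ> proj \<Gamma> | s. s \<in> S}"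
  then obtain s' where s': "s' \<in> S" "s = proj \<Gamma> \<circ> s' \<circ> proj \<Gamma>" by blast
  obtain K where K: "invariant K" "s' = mat \<Omega> K" using s'(1) by (rule end_cases)
  have "g.invariant K"
    using K(1) agree sub by (auto simp: invariant_def g.invariant_def subset_iff) (metis subsetD)
  then show "s \<in> perm_end n \<Gamma> \<gamma>" unfolding s'(2) K(2) proj_mat_proj[OF sub fin] by (rule g.mat_in_end)
qed

lemma orb_coord:
  assumes "l \<in> supp n \<Omega> \<phi>"
  obtains u z where "coord (orb l) (part l) u" "z \<in> orb l" "z \<in> \<Omega>"
    "stabilizer (sym_group n) \<phi> z = young_subgroup n l"
proof -
  obtain z where z: "orb l \<in> orbits (sym_group n) \<Omega> \<phi>" "z \<in> orb l"
    "stabilizer (sym_group n) \<phi> z = young_subgroup n l"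
    using orb assms by (auto simp: chosen_orbits_def)
  then have "z \<in> \<Omega>" "orb l = orbit (sym_group n) \<phi> z" using orbit_member by auto
  moreover have "l \<in> Par n" using assms by (simp add: supp_def)
  ultimately show thesis using coord_orbit[of z l] z that by auto
qed

lemma stable_orb: "l \<in> supp n \<Omega> \<phi> \<Longrightarrow> stable (orb l)"
  by (metis orb_coord coord_stable)

sublocale idempotent_poset mscale S "(\<circ>)" "proj \<Omega>" "star \<Omega>" "supp n \<Omega> \<phi>" ord "\<lambda>l. proj (orb l)" "proj \<Gamma>"
proof -
  interpret star_algebra mscale S "(\<circ>)" "proj \<Omega>" "star \<Omega>" by (rule star_algebra_end)
  show "idempotent_poset mscale S (\<circ>) (proj \<Omega>) (star \<Omega>) (supp n \<Omega> \<phi>) ord (\<lambda>l. proj (orb l)) (proj \<Gamma>)"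
  proof
    show "finite (supp n \<Omega> \<phi>)" by (rule finite_subset[OF _ finite_Par[of n]]) (auto simp: supp_def)
    show "partial_order_on (supp n \<Omega> \<phi>) ord" by (rule order)
    show "proj \<Gamma> \<in> S" using proj_in_end stable_\<Gamma> by blast
    show "proj \<Gamma> \<circ> proj \<Gamma> = (proj \<Gamma> :: ('a \<Rightarrow> int) \<Rightarrow> _)" by (simp add: proj_comp)
    show "star \<Omega> (proj \<Gamma>) = (proj \<Gamma> :: ('a \<Rightarrow> int) \<Rightarrow> _)" by (rule star_proj[OF sub])
    fix l assume l: "l \<in> supp n \<Omega> \<phi>"
    show "proj (orb l) \<in> S" using proj_in_end stable_orb l by blast
    show "proj (orb l) \<circ> proj (orb l) = (proj (orb l) :: ('a \<Rightarrow> int) \<Rightarrow> _)" by (simp add: proj_comp)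
    show "star \<Omega> (proj (orb l)) = (proj (orb l) :: ('a \<Rightarrow> int) \<Rightarrow> _)"
      using stable_orb[OF l] by (intro star_proj) (simp add: stable_def)
  qed
qed

lemma above_ideal_above: "above l = ideal_above n \<Omega> \<phi> orb ord l"
  unfolding above_def ideal_above_def ..

text \<open>Cosaturation puts the sorted raised content \<open>m\<close> into the support, and
  refinement of dominance makes it lie strictly above \<open>l\<close>. Renaming letters then turns
  the orbit of \<open>m\<close> into words of the unsorted content.\<close>

lemma raised_orbit:
  assumes l: "l \<in> supp n \<Omega> \<phi>" and ij: "j < i" and t: "0 < t" "t \<le> part l i"
  shows "\<exists>Q u. coord Q ((part l)(i := part l i - t, j := part l j + t)) u \<and>
    (\<forall>s\<in>S. \<forall>s'\<in>S. s \<circ> proj Q \<circ> s' \<in> above l)"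
proof -
  have lP: "l \<in> Par n" using l by (simp add: supp_def)
  obtain m \<pi> where m: "m \<in> Par n" "bij \<pi>"
    "\<And>k. ((part l)(i := part l i - t, j := part l j + t)) k = part m (\<pi> k)" "dominated n l m" "m \<noteq> l"
    using dominance_raise[OF lP ij t] by blast
  have mS: "m \<in> supp n \<Omega> \<phi>" using cosaturated l m by (auto simp: cosaturated_def)
  obtain u where "coord (orb m) (part m) u" using orb_coord[OF mS] by blast
  from coord_relabel[OF this m(2,3)]
  obtain u' where "coord (orb m) ((part l)(i := part l i - t, j := part l j + t)) u'" by blast
  moreover have "s \<circ> proj (orb m) \<circ> s' \<in> above l" if "s \<in> S" "s' \<in> S" for s s'
    using that mS l m refines by (intro above_gen) auto
  ultimately show ?thesis by blast
qed

text \<open>The final case of straightening is empty here, since a pointwise inequality would force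
  dominance.\<close>

lemma hom_above:
  assumes l: "l \<in> supp n \<Omega> \<phi>" and m: "m \<in> supp n \<Omega> \<phi>" and "\<not> dominated n m l" and a: "a \<in> S"
  shows "proj (orb l) \<circ> a \<circ> proj (orb m) \<in> above l"
proof -
  obtain w where w: "coord (orb l) (part l) w" using orb_coord[OF l] by blast
  obtain v where v: "coord (orb m) (part m) v" using orb_coord[OF m] by blast
  show ?thesis
  proof (rule straighten[OF w v raised_orbit[OF l] subspace_above order_refl part_length _ a])
    fix y x assume "y \<in> orb l" "x \<in> orb m" "\<forall>p\<in>places n. w y p \<le> v x p"
    then have "dominated n m l" using pointwise_le_dominated coordD(2)[OF w] coordD(2)[OF v] by blast
    then show "omap y x \<in> above l" using assms by blast
  qed
qed

text \<open>Straightening into the subgroup of multiples of the idempotent plus the ideal. Only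
  pairs with \<open>y = x\<close> remain, and their orbit map is the identity of the orbit.\<close>

lemma end_local:
  assumes l: "l \<in> supp n \<Omega> \<phi>" and a: "a \<in> S"
  shows "\<exists>k. (proj (orb l) \<circ> a \<circ> proj (orb l)) - mscale k (proj (orb l)) \<in> above l"
proof -
  obtain w where w: "coord (orb l) (part l) w" using orb_coord[OF l] by blast
  let ?W = "{s. \<exists>k. s - mscale k (proj (orb l)) \<in> above l}"
  have W: "subspace ?W"
  proof (rule subspaceI)
    show "0 \<in> ?W" using subspace_0[OF subspace_above] by (auto intro: exI[of _ 0])
    fix s s' c assume s: "s \<in> ?W"
    then obtain k where k: "s - mscale k (proj (orb l)) \<in> above l" by blast
    have "mscale c s - mscale (c * k) (proj (orb l)) \<in> above l"
      using subspace_scale[OF subspace_above k, of c] by (simp add: scale_right_diff_distrib)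
    then show "mscale c s \<in> ?W" by blast
    assume "s' \<in> ?W"
    then obtain k' where k': "s' - mscale k' (proj (orb l)) \<in> above l" by blast
    have "s + s' - mscale (k + k') (proj (orb l)) \<in> above l"
      using subspace_add[OF subspace_above k k'] by (simp add: scale_left_distrib algebra_simps)
    then show "s + s' \<in> ?W" by blast
  qed
  have sub_W: "above l \<subseteq> ?W" by (auto intro: exI[of _ 0])
  have "proj (orb l) \<circ> a \<circ> proj (orb l) \<in> ?W"
  proof (rule straighten[OF w w raised_orbit[OF l] W sub_W part_length _ a])
    fix y x assume yx: "y \<in> orb l" "x \<in> orb l" "\<forall>p\<in>places n. w y p \<le> w x p"
    then have "w y = w x" using pointwise_le_equal coordD(2)[OF w] by blast
    then have eq: "y = x" using coordD(5)[OF w] yx by blast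
    have "(y', x') \<in> orel x x \<longleftrightarrow> y' = x' \<and> y' \<in> orb l" for y' x'
      using coord_transitive[OF w yx(2)] coordD(3)[OF w] yx(2) by (auto simp: orel_def)
    then have "omap y x = proj (orb l)"
      unfolding omap_def eq proj_mat[OF fin coordD(1)[OF w]] by simp
    then have "omap y x - mscale 1 (proj (orb l)) = 0" by simp
    then show "omap y x \<in> ?W" using subspace_0[OF subspace_above] by (metis (mono_tags, lifting) mem_Collect_eq)
  qed
  then show ?thesis by (rule CollectD)
qed

text \<open>The pair is translated until \<open>y\<close> has an exact Young subgroup as stabiliser,
  that of a point in the chosen orbit. The last conclusion records that \<open>s'\<close> sees only
  the orbit of \<open>x\<close>, so a projection onto a stable set containing \<open>x\<close> can
  be inserted.\<close>

lemma \<Gamma>_factor: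
  assumes y: "y \<in> \<Gamma>" and x: "x \<in> \<Omega>"
  obtains l s s' x' where "l \<in> supp n \<Gamma> \<gamma>" "l \<in> supp n \<Omega> \<phi>" "s \<in> S" "s' \<in> S"
    "omap y x = s \<circ> proj (orb l) \<circ> s'"
    "\<And>Q. stable Q \<Longrightarrow> x \<in> Q \<Longrightarrow> s' \<circ> proj Q = s'"
proof -
  obtain l g where l: "l \<in> Par n" and g: "g \<in> G" and stab: "stabilizer (sym_group n) \<gamma> y =
      g <#\<^bsub>sym_group n\<^esub> young_subgroup n l #>\<^bsub>sym_group n\<^esub> (inv\<^bsub>sym_group n\<^esub> g)"
    using young_\<Gamma> y by (auto simp: young_set_def)
  let ?y = "\<gamma> (inv' g) y"
  have y': "?y \<in> \<Gamma>" "?y = \<phi> (inv' g) y" using g y G_inv g.act_in agree by auto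
  have stab_y: "stabilizer (sym_group n) \<gamma> ?y = young_subgroup n l"
    by (rule g.young_stabilizer_conjugate[OF y g stab]) (auto simp: young_subgroup_def)
  then have l\<Gamma>: "l \<in> supp n \<Gamma> \<gamma>" using l y' by (auto simp: supp_def)
  have stab_\<phi>: "stabilizer (sym_group n) \<phi> ?y = young_subgroup n l"
    unfolding stab_y[symmetric] using agree y'(1) by (auto simp: stabilizer_def)
  then have l\<Omega>: "l \<in> supp n \<Omega> \<phi>" using l y' sub by (auto simp: supp_def)
  obtain z where z: "z \<in> orb l" "z \<in> \<Omega>" "stabilizer (sym_group n) \<phi> z = young_subgroup n l"
    using orb_coord[OF l\<Omega>] by blast
  let ?x = "\<phi> (inv' g) x"
  have X: "?y \<in> \<Omega>" "?x \<in> \<Omega>" "y \<in> \<Omega>" using y' sub act_in G_inv g x y by auto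
  have "\<phi> h ?y = ?y \<longleftrightarrow> \<phi> h z = z" if "h \<in> G" for h
    using stab_\<phi> z(3) that by (auto simp: stabilizer_def)
  then have factor: "omap ?y ?x = omap ?y z \<circ> proj (orb l) \<circ> omap z ?x"
    using X z stable_orb[OF l\<Omega>] by (intro omap_factor) auto
  have "omap y x = omap ?y ?x"
    unfolding omap_def y'(2) orel_act[OF X(3) x G_inv[OF g]] ..
  moreover have "omap z ?x \<circ> proj Q = omap z ?x" if Q: "stable Q" "x \<in> Q" for Q
  proof -
    have "x' \<in> Q" if "(z', x') \<in> orel z ?x" for z' x'
      using that Q G_inv[OF g] by (auto simp: orel_def stable_def)
    then show ?thesis unfolding omap_def mat_proj_comp by (intro mat_cong) auto
  qed
  ultimately show thesis
    using that[OF l\<Gamma> l\<Omega> omap_in_end omap_in_end, of ?y z z ?x] factor X z by simp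
qed

lemma \<Gamma>_hom_above:
  assumes l: "l \<in> supp n \<Omega> \<phi>" "l \<notin> supp_up n \<Gamma> \<gamma>" and a: "a \<in> S"
  shows "proj \<Gamma> \<circ> a \<circ> proj (orb l) \<in> above l"
proof -
  obtain K where K: "invariant K" "a = mat \<Omega> K" using a by (rule end_cases)
  note st = stable_iff[OF stable_\<Gamma>] stable_iff[OF stable_orb[OF l(1)]]
  have eq: "proj \<Gamma> \<circ> a \<circ> proj (orb l) = mat \<Omega> (\<lambda>y x. if x \<in> orb l then if y \<in> \<Gamma> then K y x else 0 else 0)"
    unfolding K(2) proj_mat_comp[OF sub] mat_proj_comp ..
  show ?thesis
    unfolding eq
  proof (rule omap_expansion[OF subspace_above])
    show "invariant (\<lambda>y x. if x \<in> orb l then if y \<in> \<Gamma> then K y x else 0 else 0)"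
      using K(1) st by (simp add: invariant_def)
    fix y x assume "x \<in> \<Omega>" "(if x \<in> orb l then if y \<in> \<Gamma> then K y x else 0 else 0) \<noteq> 0"
    then have yx: "y \<in> \<Gamma>" "x \<in> \<Omega>" "x \<in> orb l" by (auto split: if_splits)
    obtain m s s' where m: "m \<in> supp n \<Gamma> \<gamma>" "m \<in> supp n \<Omega> \<phi>" "s \<in> S" "s' \<in> S"
      "omap y x = s \<circ> proj (orb m) \<circ> s'" "s' \<circ> proj (orb l) = s'"
      using \<Gamma>_factor[OF yx(1,2)] stable_orb[OF l(1)] yx(3) by metis
    \<comment> \<open>\<open>hom_above\<close> has the idempotent of \<open>l\<close> on the left,
      while here it stands on the right; the ideal is closed under the transpose, which exchanges
      the sides.\<close>
    have "\<not> dominated n m l" using l m by (auto simp: supp_up_def supp_def)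
    then have "proj (orb l) \<circ> star \<Omega> s' \<circ> proj (orb m) \<in> above l"
      using hom_above l(1) m(2,4) star_in by blast
    then have "star \<Omega> (proj (orb l) \<circ> star \<Omega> s' \<circ> proj (orb m)) \<in> above l"
      using above_closed[OF one_in] by blast
    also have "star \<Omega> (proj (orb l) \<circ> star \<Omega> s' \<circ> proj (orb m)) = proj (orb m) \<circ> (s' \<circ> proj (orb l))"
      using l(1) m(2,4) by (simp add: star_mul xi_in star_in star_xi star_star mul_in)
    finally have "proj (orb m) \<circ> s' \<in> above l" by (simp only: m(6))
    then show "omap y x \<in> above l" using above_closed[OF m(3)] by (simp add: m(5) comp_assoc)
  qed
qed

text \<open>Every orbit map between points of \<Gamma> factors through a chosen orbit, and the
  projections onto \<Gamma> do not change it.\<close>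

lemma corner_sandwiches:
  "corner \<subseteq> span {proj \<Gamma> \<circ> s \<circ> proj (orb m) \<circ> s' \<circ> proj \<Gamma> | s s' m. s \<in> S \<and> s' \<in> S \<and> m \<in> supp n \<Omega> \<phi>}"
  (is "_ \<subseteq> span ?B")
proof
  fix x assume "x \<in> corner"
  then obtain a where a: "a \<in> S" "x = proj \<Gamma> \<circ> a \<circ> proj \<Gamma>" by (auto simp: corner_eq)
  obtain K where K: "invariant K" "a = mat \<Omega> K" using a(1) by (rule end_cases)
  have eq: "x = mat \<Omega> (\<lambda>y x. if x \<in> \<Gamma> then if y \<in> \<Gamma> then K y x else 0 else 0)"
    unfolding a(2) K(2) proj_mat_comp[OF sub] mat_proj_comp ..
  show "x \<in> span ?B"
    unfolding eq
  proof (rule omap_expansion[OF subspace_span])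
    show "invariant (\<lambda>y x. if x \<in> \<Gamma> then if y \<in> \<Gamma> then K y x else 0 else 0)"
      using K(1) stable_iff[OF stable_\<Gamma>] by (simp add: invariant_def)
    fix y x assume "(if x \<in> \<Gamma> then if y \<in> \<Gamma> then K y x else 0 else 0) \<noteq> 0"
    then have yx: "y \<in> \<Gamma>" "x \<in> \<Gamma>" "x \<in> \<Omega>" using sub by (auto split: if_splits)
    obtain m s s' where m: "m \<in> supp n \<Omega> \<phi>" "s \<in> S" "s' \<in> S" "omap y x = s \<circ> proj (orb m) \<circ> s'"
      using \<Gamma>_factor[OF yx(1,3)] by metis
    have "y' \<in> \<Gamma> \<and> x' \<in> \<Gamma>" if "(y', x') \<in> orel y x" for y' x'
      using that yx stable_\<Gamma> by (auto simp: orel_def stable_def)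
    then have "omap y x = proj \<Gamma> \<circ> omap y x \<circ> proj \<Gamma>"
      unfolding omap_def proj_mat_comp[OF sub] mat_proj_comp by (intro mat_cong) auto
    also have "\<dots> = proj \<Gamma> \<circ> s \<circ> proj (orb m) \<circ> s' \<circ> proj \<Gamma>" by (simp add: m(4) comp_assoc)
    finally show "omap y x \<in> span ?B" using m(1,2,3) by (intro span_base) blast
  qed
qed

sublocale cell_ideals mscale S "(\<circ>)" "proj \<Omega>" "star \<Omega>" "supp n \<Omega> \<phi>" ord "\<lambda>l. proj (orb l)" "proj \<Gamma>"
  "supp_up n \<Gamma> \<gamma>" "N_idx n \<Omega> \<phi> \<Gamma>" d
proof
  have stab: "stabilizer (sym_group n) \<gamma> x = stabilizer (sym_group n) \<phi> x" if "x \<in> \<Gamma>" for x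
    using agree that by (auto simp: stabilizer_def)
  then have "supp n \<Gamma> \<gamma> \<subseteq> supp n \<Omega> \<phi>" using sub by (auto simp: supp_def)
  then show L: "supp_up n \<Gamma> \<gamma> \<subseteq> supp n \<Omega> \<phi>"
    using cosaturated by (auto simp: supp_up_def cosaturated_def)
  show "\<exists>k. (proj (orb l) \<circ> a \<circ> proj (orb l)) - mscale k (proj (orb l)) \<in> above l"
    if "l \<in> supp_up n \<Gamma> \<gamma>" "a \<in> S" for l a
    using end_local L that by blast
  show "proj (orb l) \<circ> a \<circ> proj (orb m) \<in> above l"
    if "l \<in> supp n \<Omega> \<phi>" "m \<in> supp n \<Omega> \<phi>" "(m, l) \<notin> ord" "a \<in> S" for l m a
    using hom_above that refines by blast
  show "corner \<subseteq> span {proj \<Gamma> \<circ> s \<circ> proj (orb m) \<circ> s' \<circ> proj \<Gamma> | s s' m. s \<in> S \<and> s' \<in> S \<and> m \<in> supp n \<Omega> \<phi>}"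
    by (rule corner_sandwiches)
  show "d l t \<in> {proj \<Gamma> \<circ> s \<circ> proj (orb l) | s. s \<in> S}"
    if "l \<in> supp_up n \<Gamma> \<gamma>" "t \<in> N_idx n \<Omega> \<phi> \<Gamma> l" for l t
    using lifts that by (simp add: chosen_lifts_def eSxi_def)
  show "basis_mod mscale {a + b | a b. a \<in> {proj \<Gamma> \<circ> s \<circ> proj (orb l) | s. s \<in> S} \<and> b \<in> above l}
      (above l) (N_idx n \<Omega> \<phi> \<Gamma> l) (d l)" if "l \<in> supp_up n \<Gamma> \<gamma>" for l
    using lifts that by (simp add: chosen_lifts_def eSxi_def above_ideal_above)
qed (rule \<Gamma>_hom_above)

end

theorem theorem6p3:
  fixes n :: nat
    and \<Gamma> \<Omega> :: "'a set"
    and \<gamma> \<phi> :: "(nat \<Rightarrow> nat) \<Rightarrow> 'a \<Rightarrow> 'a"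
    and ord :: "(nat list \<times> nat list) set"
    and orb :: "nat list \<Rightarrow> 'a set"
    and d :: "nat list \<Rightarrow> nat \<Rightarrow> ('a \<Rightarrow> int) \<Rightarrow> 'a \<Rightarrow> int"
  assumes "n > 0"
    and "young_set n \<Gamma> \<gamma>"
    and "young_set n \<Omega> \<phi>" and "cosaturated n \<Omega> \<phi>"
    and "\<Gamma> \<subseteq> \<Omega>" and "\<forall>g\<in>carrier (sym_group n). \<forall>x\<in>\<Gamma>. \<phi> g x = \<gamma> g x"
    and "partial_order_on (supp n \<Omega> \<phi>) ord"
    and "\<forall>l\<in>supp n \<Omega> \<phi>. \<forall>m\<in>supp n \<Omega> \<phi>. dominated n l m \<longrightarrow> (l, m) \<in> ord"
    and "chosen_orbits n \<Omega> \<phi> orb"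
    and "\<forall>l\<in>supp_up n \<Gamma> \<gamma>. chosen_lifts n \<Omega> \<phi> \<Gamma> orb ord l (d l)"
  shows "(perm_end n \<Gamma> \<gamma> :: (('a \<Rightarrow> int) \<Rightarrow> 'a \<Rightarrow> int) set)
      = {proj \<Gamma> \<circ> s \<circ> proj \<Gamma> | s. s \<in> perm_end n \<Omega> \<phi>} \<and>
    cell_datum mscale (perm_end n \<Gamma> \<gamma> :: (('a \<Rightarrow> int) \<Rightarrow> 'a \<Rightarrow> int) set) (\<circ>) (proj \<Gamma>)
      (supp_up n \<Gamma> \<gamma>) (Restr ord (supp_up n \<Gamma> \<gamma>)) (N_idx n \<Omega> \<phi> \<Gamma>)
      (\<lambda>l t u. d l t \<circ> star \<Omega> (d l u)) (star \<Omega>)"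
proof -
  interpret sym_set n \<Omega> \<phi> using assms(3) by (rule young_set_sym_set)
  interpret cell_setting n \<Omega> \<phi> \<Gamma> \<gamma> ord orb d
    using assms by unfold_locales
  have "(\<lambda>l t u. d l t \<circ> star \<Omega> (d l u)) = cell" by (simp add: cell_def fun_eq_iff)
  then show ?thesis using cell_datum_corner perm_end_\<Gamma> by (simp add: corner_eq)
qed

end
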